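(* Let $R\subseteq T$ be rings forming a regular conductor square with conductor $C$, and set $A=R/C$, $B=T/C$. Assume that $T$ is flat as an $R$-module, that $C$ is a principal ideal of $T$, and that every non-zero 2-generated ideal $I$ of $R$ satisfies the following condition: there are elements $r,s\in R$ and an ideal $U\subseteq R$ such that $UT=T=rT$ and $rI=sU$, and such that the multiplication maps $I\xrightarrow{r}rI$ and $U\xrightarrow{s}sU$ are isomorphisms. Assume further that $A$ is locally a domain and has finite Krull dimension. Then $R$ is a generalized GCD ring if and only if $A$ is a generalized GCD ring; these conditions imply that $T$ is a generalized GCD ring.
   Context: All rings are commutative with identity. A conductor square consists of a ring $T$, a subring $R\subseteq T$ such that $R$ and $T$ have a common non-zero ideal, the largest common ideal $C$ of $R$ and $T$ (called the conductor of $T$ into $R$), and the rings $A=R/C$ and $B=T/C$, together with the inclusions $R\hookrightarrow T$, $A\hookrightarrow B$ and the projections $\eta_2\colon R\twoheadrightarrow A$, $\eta_1\colon T\twoheadrightarrow B$; equivalently, $R$ is the pullback $\{(a,t)\in A\times T\mid a=\eta_1(t)\text{ in }B\}$ and $C=\operatorname{Ker}(\eta_1)=\operatorname{Ker}(\eta_2)$ is the largest common ideal. The square is regular if $C$ contains a non-zero-divisor of $T$. An ideal is 2-generated if it can be generated by two elements. A ring is a generalized GCD ring if every principal ideal of it is projective and every intersection of two finitely generated flat ideals is finitely generated and flat. A ring $A$ is locally a domain if $A_{\mathfrak p}$ is an integral domain for every prime ideal $\mathfrak p$ of $A$. *)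

theory Defs
  imports
    "HOL-Algebra.QuotRing"
    "HOL-Algebra.Subrings"
    "HOL-Algebra.Module"
    "HOL-Algebra.Free_Abelian_Groups"
    "HOL-Library.Extended_Nat"
begin

section \<open>Modules\<close>

definition module_hom :: "('a, 'r) ring_scheme \<Rightarrow> ('a, 'b, 'x) module_scheme
    \<Rightarrow> ('a, 'c, 'y) module_scheme \<Rightarrow> ('b \<Rightarrow> 'c) set"
  where "module_hom R M N =
    {f \<in> carrier M \<rightarrow> carrier N.
       (\<forall>x\<in>carrier M. \<forall>y\<in>carrier M. f (x \<oplus>\<^bsub>M\<^esub> y) = f x \<oplus>\<^bsub>N\<^esub> f y) \<and>
       (\<forall>r\<in>carrier R. \<forall>x\<in>carrier M. f (r \<odot>\<^bsub>M\<^esub> x) = r \<odot>\<^bsub>N\<^esub> f x)}"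

definition module_iso :: "('a, 'r) ring_scheme \<Rightarrow> ('a, 'b, 'x) module_scheme
    \<Rightarrow> ('a, 'c, 'y) module_scheme \<Rightarrow> ('b \<Rightarrow> 'c) set"
  where "module_iso R M N = {f \<in> module_hom R M N. bij_betw f (carrier M) (carrier N)}"

text \<open>A subset \<open>X\<close> of a ring \<open>S\<close>, with scalars acting through the multiplication of \<open>S\<close>.
  It is used for ideals of \<open>S\<close> and for \<open>S\<close> itself as a module over a subring.
  (The fields \<^term>\<open>mult\<close> and \<^term>\<open>one\<close> of a module record carry no meaning.)\<close>

definition as_module :: "('a, 'r) ring_scheme \<Rightarrow> 'a set \<Rightarrow> ('a, 'a) module"
  where "as_module S X = \<lparr>carrier = X, monoid.mult = monoid.mult S, one = one S,
           ring.zero = ring.zero S, add = add S, smult = monoid.mult S\<rparr>"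

section \<open>Tensor products and flat modules\<close>

text \<open>\<open>N \<otimes> M\<close> is the free abelian group on \<open>N \<times> M\<close> modulo the subgroup generated by the
  bilinearity relations; only its additive group is needed.\<close>

definition tensor_gens :: "('a, 'r) ring_scheme \<Rightarrow> ('a, 'n, 'x) module_scheme
    \<Rightarrow> ('a, 'm, 'y) module_scheme \<Rightarrow> ('n \<times> 'm \<Rightarrow>\<^sub>0 int) set"
  where "tensor_gens R N M =
    {frag_of (n \<oplus>\<^bsub>N\<^esub> n', m) - frag_of (n, m) - frag_of (n', m) | n n' m.
       n \<in> carrier N \<and> n' \<in> carrier N \<and> m \<in> carrier M} \<union>
    {frag_of (n, m \<oplus>\<^bsub>M\<^esub> m') - frag_of (n, m) - frag_of (n, m') | n m m'.
       n \<in> carrier N \<and> m \<in> carrier M \<and> m' \<in> carrier M} \<union>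
    {frag_of (r \<odot>\<^bsub>N\<^esub> n, m) - frag_of (n, r \<odot>\<^bsub>M\<^esub> m) | r n m.
       r \<in> carrier R \<and> n \<in> carrier N \<and> m \<in> carrier M}"

definition tensor_rels :: "('a, 'r) ring_scheme \<Rightarrow> ('a, 'n, 'x) module_scheme
    \<Rightarrow> ('a, 'm, 'y) module_scheme \<Rightarrow> ('n \<times> 'm \<Rightarrow>\<^sub>0 int) set"
  where "tensor_rels R N M =
    generate (free_Abelian_group (carrier N \<times> carrier M)) (tensor_gens R N M)"

definition tensor :: "('a, 'r) ring_scheme \<Rightarrow> ('a, 'n, 'x) module_scheme
    \<Rightarrow> ('a, 'm, 'y) module_scheme \<Rightarrow> ('n \<times> 'm \<Rightarrow>\<^sub>0 int) set monoid"
  where "tensor R N M =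
    free_Abelian_group (carrier N \<times> carrier M) Mod tensor_rels R N M"

text \<open>The homomorphism \<open>N \<otimes> M \<rightarrow> N' \<otimes> M\<close> induced by \<open>f : N \<rightarrow> N'\<close>, sending the coset of
  \<open>(n, m)\<close> to the coset of \<open>(f n, m)\<close>. The image in the definition is a singleton because
  \<open>f \<otimes> id\<close> maps relations to relations.\<close>

definition tensor_map :: "('a, 'r) ring_scheme \<Rightarrow> ('a, 'n', 'x) module_scheme
    \<Rightarrow> ('a, 'm, 'y) module_scheme \<Rightarrow> ('n \<Rightarrow> 'n')
    \<Rightarrow> ('n \<times> 'm \<Rightarrow>\<^sub>0 int) set \<Rightarrow> ('n' \<times> 'm \<Rightarrow>\<^sub>0 int) set"
  where "tensor_map R N' M f X =
    the_elem ((\<lambda>x. tensor_rels R N' M #>\<^bsub>free_Abelian_group (carrier N' \<times> carrier M)\<^esub>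
                   frag_extend (\<lambda>(n, m). frag_of (f n, m)) x) ` X)"

text \<open>\<open>M\<close> is flat if tensoring with \<open>M\<close> preserves injective homomorphisms. A definition cannot
  quantify over all types, so the test modules \<open>N\<close>, \<open>N'\<close> have elements in
  \<^typ>\<open>(nat \<Rightarrow> 'a) set\<close>. Up to isomorphism this includes every subquotient of the free
  module of countable rank (as cosets), in particular \<open>R\<close>, its ideals and all finitely generated
  modules together with their submodules. Since the inclusions of ideals into \<open>R\<close> already detect
  flatness, the choice of this type does not change the notion.\<close>

definition flat_module :: "('a, 'r) ring_scheme \<Rightarrow> ('a, 'm, 'x) module_scheme \<Rightarrow> bool"
  where "flat_module R M \<longleftrightarrow> module R M \<and>
    (\<forall>(N :: ('a, (nat \<Rightarrow> 'a) set) module) (N' :: ('a, (nat \<Rightarrow> 'a) set) module) f.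
       module R N \<and> module R N' \<and> f \<in> module_hom R N N' \<and> inj_on f (carrier N) \<longrightarrow>
       inj_on (tensor_map R N' M f) (carrier (tensor R N M)))"

section \<open>Projective modules\<close>

text \<open>The lifting property. As for flatness the test modules live in a fixed type: here
  \<^typ>\<open>('p \<Rightarrow> 'a) set\<close>, which contains copies of \<open>P\<close> and of the free module on
  the elements of \<open>P\<close>. Lifting the identity of \<open>P\<close> along the canonical surjection from that
  free module makes \<open>P\<close> a direct summand of it, so the choice does not change the notion.\<close>

definition projective_module :: "('a, 'r) ring_scheme \<Rightarrow> ('a, 'p, 'x) module_scheme \<Rightarrow> bool"
  where "projective_module R P \<longleftrightarrow> module R P \<and>
    (\<forall>(N :: ('a, ('p \<Rightarrow> 'a) set) module) (N' :: ('a, ('p \<Rightarrow> 'a) set) module) g h.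
       module R N \<and> module R N' \<and>
       g \<in> module_hom R N N' \<and> g ` carrier N = carrier N' \<and> h \<in> module_hom R P N' \<longrightarrow>
       (\<exists>k\<in>module_hom R P N. \<forall>x\<in>carrier P. g (k x) = h x))"

section \<open>Ideals and generalized GCD rings\<close>

definition fg_ideal :: "'a set \<Rightarrow> ('a, 'r) ring_scheme \<Rightarrow> bool"
  where "fg_ideal I R \<longleftrightarrow> (\<exists>S. finite S \<and> S \<subseteq> carrier R \<and> I = Idl\<^bsub>R\<^esub> S)"

definition two_generated_ideal :: "'a set \<Rightarrow> ('a, 'r) ring_scheme \<Rightarrow> bool"
  where "two_generated_ideal I R \<longleftrightarrow> (\<exists>a\<in>carrier R. \<exists>b\<in>carrier R. I = Idl\<^bsub>R\<^esub> {a, b})"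

definition generalized_GCD_ring :: "('a, 'r) ring_scheme \<Rightarrow> bool"
  where "generalized_GCD_ring R \<longleftrightarrow> cring R \<and>
    (\<forall>I. principalideal I R \<longrightarrow> projective_module R (as_module R I)) \<and>
    (\<forall>I J. fg_ideal I R \<and> flat_module R (as_module R I) \<and>
           fg_ideal J R \<and> flat_module R (as_module R J) \<longrightarrow>
           fg_ideal (I \<inter> J) R \<and> flat_module R (as_module R (I \<inter> J)))"

section \<open>Localization and Krull dimension\<close>

definition frac_rel :: "('a, 'r) ring_scheme \<Rightarrow> 'a set \<Rightarrow> (('a \<times> 'a) \<times> ('a \<times> 'a)) set"
  where "frac_rel R S = {((a, s), (b, t)).
    a \<in> carrier R \<and> s \<in> S \<and> b \<in> carrier R \<and> t \<in> S \<and>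
    (\<exists>u\<in>S. u \<otimes>\<^bsub>R\<^esub> (t \<otimes>\<^bsub>R\<^esub> a \<ominus>\<^bsub>R\<^esub> s \<otimes>\<^bsub>R\<^esub> b) = \<zero>\<^bsub>R\<^esub>)}"

text \<open>\<open>S\<^sup>-\<^sup>1R\<close> for a multiplicative set \<open>S\<close>; the pair \<open>(a, s)\<close> represents \<open>a / s\<close>. The unions in
  the operations run over representatives and are single classes.\<close>

definition localization :: "('a, 'r) ring_scheme \<Rightarrow> 'a set \<Rightarrow> ('a \<times> 'a) set ring"
  where "localization R S =
    \<lparr>carrier = (carrier R \<times> S) // frac_rel R S,
     monoid.mult = (\<lambda>X Y. \<Union>(a, s)\<in>X. \<Union>(b, t)\<in>Y.
               frac_rel R S `` {(a \<otimes>\<^bsub>R\<^esub> b, s \<otimes>\<^bsub>R\<^esub> t)}),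
     one = frac_rel R S `` {(\<one>\<^bsub>R\<^esub>, \<one>\<^bsub>R\<^esub>)},
     ring.zero = frac_rel R S `` {(\<zero>\<^bsub>R\<^esub>, \<one>\<^bsub>R\<^esub>)},
     add = (\<lambda>X Y. \<Union>(a, s)\<in>X. \<Union>(b, t)\<in>Y.
               frac_rel R S `` {(t \<otimes>\<^bsub>R\<^esub> a \<oplus>\<^bsub>R\<^esub> s \<otimes>\<^bsub>R\<^esub> b, s \<otimes>\<^bsub>R\<^esub> t)})\<rparr>"

definition locally_domain :: "('a, 'r) ring_scheme \<Rightarrow> bool"
  where "locally_domain R \<longleftrightarrow>
    (\<forall>P. primeideal P R \<longrightarrow> domain (localization R (carrier R - P)))"

text \<open>With values in \<^typ>\<open>enat\<close> the zero ring gets dimension \<open>0\<close>; in particular it counts as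
  finite-dimensional.\<close>

definition krull_dim :: "('a, 'r) ring_scheme \<Rightarrow> enat"
  where "krull_dim R = Sup {enat k | k.
    \<exists>P. (\<forall>i\<le>k. primeideal (P i) R) \<and> (\<forall>i<k. P i \<subset> P (Suc i))}"

section \<open>Conductor squares\<close>

definition common_ideal :: "'a set \<Rightarrow> 'a ring \<Rightarrow> 'a ring \<Rightarrow> bool"
  where "common_ideal J R T \<longleftrightarrow> ideal J R \<and> ideal J T"

text \<open>\<open>R\<close> is a subring of \<open>T\<close>, as a record with the operations of \<open>T\<close>. The maps of the square need
  not be recorded: they are the inclusion, the two quotient maps, and the inclusion of
  \<open>R / C\<close> into \<open>T / C\<close>, which is literal because a coset \<open>C + x\<close> is the same set in both.\<close>

definition conductor_square ::
    "'a ring \<Rightarrow> 'a ring \<Rightarrow> 'a set \<Rightarrow> 'a set ring \<Rightarrow> 'a set ring \<Rightarrow> bool"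
  where "conductor_square R T C A B \<longleftrightarrow>
    cring T \<and> subring (carrier R) T \<and> R = T\<lparr>carrier := carrier R\<rparr> \<and>
    (\<exists>J. common_ideal J R T \<and> J \<noteq> {\<zero>\<^bsub>T\<^esub>}) \<and>
    common_ideal C R T \<and> (\<forall>J. common_ideal J R T \<longrightarrow> J \<subseteq> C) \<and>
    A = R Quot C \<and> B = T Quot C"

definition non_zero_divisor :: "'a \<Rightarrow> ('a, 'r) ring_scheme \<Rightarrow> bool"
  where "non_zero_divisor c R \<longleftrightarrow>
    c \<in> carrier R \<and> (\<forall>x\<in>carrier R. c \<otimes>\<^bsub>R\<^esub> x = \<zero>\<^bsub>R\<^esub> \<longrightarrow> x = \<zero>\<^bsub>R\<^esub>)"

definition regular_conductor_square ::
    "'a ring \<Rightarrow> 'a ring \<Rightarrow> 'a set \<Rightarrow> 'a set ring \<Rightarrow> 'a set ring \<Rightarrow> bool"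
  where "regular_conductor_square R T C A B \<longleftrightarrow>
    conductor_square R T C A B \<and> (\<exists>c\<in>C. non_zero_divisor c T)"

text \<open>The condition imposed on the 2-generated ideals \<open>I\<close> of \<open>R\<close>. The extension \<open>UT\<close> is
  \<^term>\<open>Idl\<^bsub>T\<^esub> U\<close>, and \<open>rI\<close> is \<^term>\<open>r <#\<^bsub>R\<^esub> I\<close>.\<close>

definition extension_condition :: "'a ring \<Rightarrow> 'a ring \<Rightarrow> 'a set \<Rightarrow> bool"
  where "extension_condition R T I \<longleftrightarrow>
    (\<exists>r\<in>carrier R. \<exists>s\<in>carrier R. \<exists>U. ideal U R \<and>
       Idl\<^bsub>T\<^esub> U = carrier T \<and> r <#\<^bsub>T\<^esub> carrier T = carrier T \<and>
       r <#\<^bsub>R\<^esub> I = s <#\<^bsub>R\<^esub> U \<and>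
       (\<lambda>x. r \<otimes>\<^bsub>R\<^esub> x) \<in> module_iso R (as_module R I) (as_module R (r <#\<^bsub>R\<^esub> I)) \<and>
       (\<lambda>x. s \<otimes>\<^bsub>R\<^esub> x) \<in> module_iso R (as_module R U) (as_module R (s <#\<^bsub>R\<^esub> U)))"

end

theory Submission
  imports Defs "HOL-Algebra.Ideal_Product"
begin

text \<open>Every non-zero 2-generated ideal \<open>I\<close> of \<open>R\<close> is isomorphic to an ideal \<open>U = uR + vR\<close> with
  \<open>UT = T\<close>. Applied to principal ideals and to the ideals \<open>(ct, c)\<close>, where \<open>C = cT\<close>, this shows that
  \<open>T\<close> is a Bezout domain and a localization of \<open>R\<close>; in particular \<open>T\<close> is always a generalized GCD
  ring. Annihilators of elements in \<open>T / C\<close> are principal, and since \<open>A\<close> is locally a domain,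
  annihilators of elements of \<open>A\<close> are generated by idempotents.

  In a ring with the latter property the finitely generated flat ideals are the locally principal ones,
  so the ring is a generalized GCD ring iff \<open>aR \<inter> bR\<close> is locally principal for all \<open>a, b\<close>. In \<open>R\<close>
  and in \<open>A\<close> it suffices to treat pairs \<open>u, v\<close> of \<open>R\<close> with \<open>uT + vT = T\<close>. For these
  \<open>uR \<inter> vR\<close> maps onto \<open>uA \<inter> vA\<close>, which gives one direction. For the other,
  \<open>uR \<inter> vR\<close> is isomorphic to the inverse \<open>W\<close> of \<open>uR + vR\<close> in \<open>T\<close>, which contains \<open>C\<close>, and local
  generators of \<open>W\<close> are lifted along \<open>W \<rightarrow> W / C\<close>.\<close>

section \<open>Locally principal ideals\<close>

text \<open>Apart from the hypothesis on \<open>A\<close>, localizations are avoided: a property at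
  a prime \<open>P\<close> is stated with a scalar outside \<open>P\<close>, and such statements are
  glued by noting that the scalars for which a claim holds form an ideal. The first obstacle is that
  \<open>A\<close> has zero divisors although \<open>T\<close> is a domain. Idempotent annihilators
  make division by a zero divisor linear, which gives flatness and projectivity. They also allow u,
  v to be replaced by u' = u + xv and v + x'u', which generate the same ideal and are regular modulo
  C; only then can uv be cancelled in T / C. The second obstacle is to turn a local generator x of W
  modulo C into a generator of W. Since 1 lies in W, some multiple of x differs by an element of C
  from a scalar outside \<open>P\<close>, so that multiple is itself such a scalar. All errors lie
  in C, which is stable under multiplication by T, and the square of this scalar absorbs
  them.\<close>

lemma (in ring) minus_zero_imp_eq:
  "a \<ominus> b = \<zero> \<Longrightarrow> a \<in> carrier R \<Longrightarrow> b \<in> carrier R \<Longrightarrow> a = b"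
  by (metis a_minus_def a_inv_closed local.minus_minus minus_equality)

text \<open>Zorn's lemma applies to the ideals that contain \<open>Z\<close> and avoid 1, because
  the union of a chain of them still avoids 1. A maximal member is a maximal ideal, hence
  prime.\<close>

lemma (in cring) exists_primeideal:
  assumes Z: "ideal Z R" and "\<one> \<notin> Z"
  shows "\<exists>P. primeideal P R \<and> Z \<subseteq> P"
proof -
  let ?A = "{I. ideal I R \<and> Z \<subseteq> I \<and> \<one> \<notin> I}"
  have "\<exists>M\<in>?A. \<forall>X\<in>?A. M \<subseteq> X \<longrightarrow> X = M"
  proof (rule subset_Zorn_nonempty)
    show "?A \<noteq> {}" using assms by blast
    fix \<C> assume ne: "\<C> \<noteq> {}" and ch: "subset.chain ?A \<C>"
    then have sub: "\<C> \<subseteq> ?A" and tot: "\<And>X Y. X \<in> \<C> \<Longrightarrow> Y \<in> \<C> \<Longrightarrow> X \<subseteq> Y \<or> Y \<subseteq> X"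
      by (auto simp: subset.chain_def)
    have "ideal (\<Union>\<C>) R"
    proof (rule idealI[OF ring_axioms])
      show "subgroup (\<Union>\<C>) (add_monoid R)"
      proof (rule add.subgroupI)
        show "\<Union>\<C> \<subseteq> carrier R" using sub ideal.Icarr by fastforce
        show "\<Union>\<C> \<noteq> {}" using ne sub
          by (metis (no_types, lifting) Sup_upper additive_subgroup.zero_closed all_not_in_conv
              ideal.axioms(1) mem_Collect_eq subset_iff)
        fix a assume "a \<in> \<Union>\<C>"
        then obtain I where I: "I \<in> \<C>" "a \<in> I" by blast
        then have "\<ominus> a \<in> I" using sub additive_subgroup.a_inv_closed ideal.axioms(1) by fastforce
        then show "\<ominus> a \<in> \<Union>\<C>" using I by blast
      next
        fix a b assume "a \<in> \<Union>\<C>" "b \<in> \<Union>\<C>"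
        then obtain I where I: "I \<in> \<C>" "a \<in> I" "b \<in> I" using tot by blast
        then have "a \<oplus> b \<in> I" using sub additive_subgroup.a_closed ideal.axioms(1) by fastforce
        then show "a \<oplus> b \<in> \<Union>\<C>" using I by auto
      qed
    next
      fix a x assume a: "a \<in> \<Union>\<C>" and x: "x \<in> carrier R"
      then obtain I where I: "I \<in> \<C>" "a \<in> I" "ideal I R" using sub by blast
      show "x \<otimes> a \<in> \<Union>\<C>" using I ideal.I_l_closed[of I R a x] x by blast
      show "a \<otimes> x \<in> \<Union>\<C>" using I ideal.I_r_closed[of I R a x] x by blast
    qed
    then show "\<Union>\<C> \<in> ?A" using ne sub by blast
  qed
  then obtain M where "M \<in> ?A" and max: "\<forall>X\<in>?A. M \<subseteq> X \<longrightarrow> X = M" ..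
  then have M: "ideal M R" "Z \<subseteq> M" "\<one> \<notin> M" by auto
  have "maximalideal M R"
  proof (rule maximalidealI)
    show "ideal M R" by fact
    show "carrier R \<noteq> M" using M by auto
    fix J assume J: "ideal J R" "M \<subseteq> J" "J \<subseteq> carrier R"
    show "J = M \<or> J = carrier R"
    proof (cases "\<one> \<in> J")
      case True
      then show ?thesis using J(1) ideal.one_imp_carrier by blast
    next
      case False
      then have "J \<in> ?A" using J M by auto
      then show ?thesis using max J(2) by blast
    qed
  qed
  then show ?thesis using maximalideal_prime M by blast
qed

text \<open>The local-to-global principle of the development: \<open>Z\<close> will be the set of
  scalars that make some claim true after multiplication, and the local argument at each prime
  supplies one such scalar outside it.\<close>

corollary (in cring) ideal_one_closedI:
  assumes "ideal Z R" "\<And>P. primeideal P R \<Longrightarrow> \<exists>e\<in>Z. e \<notin> P"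
  shows "\<one> \<in> Z"
  using exists_primeideal assms by blast

lemma (in ring) idealI':
  assumes "I \<subseteq> carrier R" "\<zero> \<in> I" "\<And>a b. a \<in> I \<Longrightarrow> b \<in> I \<Longrightarrow> a \<oplus> b \<in> I"
    "\<And>a x. a \<in> I \<Longrightarrow> x \<in> carrier R \<Longrightarrow> x \<otimes> a \<in> I"
    "\<And>a x. a \<in> I \<Longrightarrow> x \<in> carrier R \<Longrightarrow> a \<otimes> x \<in> I"
  shows "ideal I R"
proof (rule idealI[OF ring_axioms])
  show "subgroup I (add_monoid R)"
  proof (rule add.subgroupI)
    fix a assume a: "a \<in> I"
    then have "\<ominus> \<one> \<otimes> a \<in> I" using assms(4) by blast
    then show "\<ominus> a \<in> I" using a assms(1) l_minus[of \<one> a] by auto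
  qed (use assms in auto)
qed (use assms in auto)

lemma mem_cgenideal: "y \<in> PIdl\<^bsub>R\<^esub> a \<longleftrightarrow> (\<exists>g\<in>carrier R. y = g \<otimes>\<^bsub>R\<^esub> a)"
  unfolding cgenideal_def by auto

lemma (in cring) primeideal_not_mult:
  assumes "primeideal P R" "a \<in> carrier R - P" "b \<in> carrier R - P"
  shows "a \<otimes> b \<in> carrier R - P"
  using assms primeideal.I_prime[OF assms(1), of a b] by blast

text \<open>One denominator \<open>e\<close> serves all \<open>y\<close> at once, so
  \<open>e\<close> carries all of \<open>V\<close> into the multiples of \<open>x\<close>. This
  uniformity is stronger than principality of the localization at \<open>P\<close> and is what
  yields finite generation later.\<close>

definition locally_principal :: "('a, 'r) ring_scheme \<Rightarrow> 'a set \<Rightarrow> bool"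
  where "locally_principal R V \<longleftrightarrow> (\<forall>P. primeideal P R \<longrightarrow>
    (\<exists>e\<in>carrier R - P. \<exists>x\<in>V. \<forall>y\<in>V. \<exists>k\<in>carrier R. e \<otimes>\<^bsub>R\<^esub> y = x \<otimes>\<^bsub>R\<^esub> k))"

text \<open>The projectivity of principal ideals in terms of annihilators: taking \<open>z = x\<close> shows that
  \<open>x\<close> is idempotent.\<close>

definition elementwise_pp :: "('a, 'r) ring_scheme \<Rightarrow> bool"
  where "elementwise_pp R \<longleftrightarrow> (\<forall>a\<in>carrier R. \<exists>x\<in>carrier R. x \<otimes>\<^bsub>R\<^esub> a = \<zero>\<^bsub>R\<^esub> \<and>
    (\<forall>z\<in>carrier R. z \<otimes>\<^bsub>R\<^esub> a = \<zero>\<^bsub>R\<^esub> \<longrightarrow> z \<otimes>\<^bsub>R\<^esub> x = z))"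

text \<open>Near \<open>P\<close> the two ideals look like xR and zR: the product ef carries V
  \<inter> W into xR \<inter> zR, which lies in V \<inter> W. A local generator of xR \<inter> zR is
  therefore one of V \<inter> W, with denominator gef.\<close>

lemma (in cring) locally_principal_Int:
  assumes pr: "\<And>a b. a \<in> carrier R \<Longrightarrow> b \<in> carrier R \<Longrightarrow> locally_principal R (PIdl a \<inter> PIdl b)"
    and V: "ideal V R" "locally_principal R V" and W: "ideal W R" "locally_principal R W"
  shows "locally_principal R (V \<inter> W)"
  unfolding locally_principal_def
proof (intro allI impI)
  fix P assume P: "primeideal P R"
  obtain e x where e: "e \<in> carrier R - P" "x \<in> V" "\<And>y. y \<in> V \<Longrightarrow> \<exists>k\<in>carrier R. e \<otimes> y = x \<otimes> k"
    using V(2) P unfolding locally_principal_def by meson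
  obtain f z where f: "f \<in> carrier R - P" "z \<in> W" "\<And>y. y \<in> W \<Longrightarrow> \<exists>k\<in>carrier R. f \<otimes> y = z \<otimes> k"
    using W(2) P unfolding locally_principal_def by meson
  have xz: "x \<in> carrier R" "z \<in> carrier R" using e f V W ideal.Icarr by fast+
  obtain g w where g: "g \<in> carrier R - P" "w \<in> PIdl x \<inter> PIdl z"
      "\<And>y. y \<in> PIdl x \<inter> PIdl z \<Longrightarrow> \<exists>k\<in>carrier R. g \<otimes> y = w \<otimes> k"
    using pr[OF xz] P unfolding locally_principal_def by meson
  have w: "w \<in> V \<inter> W"
    using g(2) e(2) f(2) V(1) W(1) by (auto simp: cgenideal_def intro: ideal.I_l_closed)
  have "\<exists>k\<in>carrier R. (g \<otimes> (e \<otimes> f)) \<otimes> y = w \<otimes> k" if y: "y \<in> V \<inter> W" for y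
  proof -
    have yc: "y \<in> carrier R" using y V ideal.Icarr by fast
    obtain k l where k: "k \<in> carrier R" "e \<otimes> y = x \<otimes> k" and l: "l \<in> carrier R" "f \<otimes> y = z \<otimes> l"
      using e(3) f(3) y by blast
    have c: "e \<in> carrier R" "f \<in> carrier R" "g \<in> carrier R" using e f g by auto
    have "(e \<otimes> f) \<otimes> y = f \<otimes> k \<otimes> x" "(e \<otimes> f) \<otimes> y = e \<otimes> l \<otimes> z"
      using c k l yc xz m_ac by (metis m_closed)+
    then have "(e \<otimes> f) \<otimes> y \<in> PIdl x \<inter> PIdl z"
      unfolding cgenideal_def using c k l by blast
    then have "\<exists>k\<in>carrier R. g \<otimes> ((e \<otimes> f) \<otimes> y) = w \<otimes> k" by (rule g(3))
    moreover have "g \<otimes> ((e \<otimes> f) \<otimes> y) = (g \<otimes> (e \<otimes> f)) \<otimes> y" using c yc by (simp add: m_assoc)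
    ultimately show ?thesis by simp
  qed
  moreover have "g \<otimes> (e \<otimes> f) \<in> carrier R - P"
    using e f g P primeideal_not_mult by metis
  ultimately show "\<exists>e\<in>carrier R - P. \<exists>x\<in>V \<inter> W. \<forall>y\<in>V \<inter> W. \<exists>k\<in>carrier R. e \<otimes> y = x \<otimes> k"
    using w by blast
qed

lemma (in cring) locally_principal_cgenideal:
  assumes "a \<in> carrier R"
  shows "locally_principal R (PIdl a)"
  unfolding locally_principal_def
proof (intro allI impI)
  fix P assume P: "primeideal P R"
  then have 1: "\<one> \<in> carrier R - P"
    using ideal.one_imp_carrier primeideal.I_notcarr primeideal.axioms(1) by fastforce
  have "\<exists>k\<in>carrier R. \<one> \<otimes> y = a \<otimes> k" if "y \<in> PIdl a" for y
    using that assms m_comm unfolding cgenideal_def by force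
  then show "\<exists>e\<in>carrier R - P. \<exists>x\<in>PIdl a. \<forall>y\<in>PIdl a. \<exists>k\<in>carrier R. e \<otimes> y = x \<otimes> k"
    using 1 cgenideal_self[OF assms] by blast
qed

text \<open>If y = ga = hb, then only s(gu - hv) = 0 follows, and \<open>s\<close> may be a zero
  divisor. With \<open>x\<close> the idempotent that generates the annihilator of \<open>s\<close>,
  the elements (1 - x)gu and (1 - x)hv agree and form a true common multiple of u and v; nothing is
  lost because s(1 - x) = s. Conversely, a common multiple of u and v yields one of a and b, because
  \<open>r\<close> is cancellable.\<close>

lemma (in cring) locally_principal_Int_cancel:
  assumes pp: "elementwise_pp R"
    and c: "r \<in> carrier R" "s \<in> carrier R" "a \<in> carrier R" "b \<in> carrier R" "u \<in> carrier R" "v \<in> carrier R"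
    and r: "\<And>z. z \<in> carrier R \<Longrightarrow> r \<otimes> z = \<zero> \<Longrightarrow> z = \<zero>"
    and ra: "r \<otimes> a = s \<otimes> u" and rb: "r \<otimes> b = s \<otimes> v"
    and uv: "locally_principal R (PIdl u \<inter> PIdl v)"
  shows "locally_principal R (PIdl a \<inter> PIdl b)"
  unfolding locally_principal_def
proof (intro allI impI)
  fix P assume P: "primeideal P R"
  have rcancel: "y = z" if "y \<in> carrier R" "z \<in> carrier R" "r \<otimes> y = r \<otimes> z" for y z
  proof -
    have "r \<otimes> (y \<ominus> z) = r \<otimes> y \<ominus> r \<otimes> z" using that c by (simp add: minus_eq r_distr r_minus)
    then have "r \<otimes> (y \<ominus> z) = \<zero>" using that c by simp
    then show ?thesis using r that by (metis minus_closed minus_zero_imp_eq)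
  qed
  obtain x where x: "x \<in> carrier R" "x \<otimes> s = \<zero>" "\<And>z. z \<in> carrier R \<Longrightarrow> z \<otimes> s = \<zero> \<Longrightarrow> z \<otimes> x = z"
    using pp c unfolding elementwise_pp_def by meson
  obtain e w where e: "e \<in> carrier R - P" "w \<in> PIdl u \<inter> PIdl v"
      "\<And>y. y \<in> PIdl u \<inter> PIdl v \<Longrightarrow> \<exists>k\<in>carrier R. e \<otimes> y = w \<otimes> k"
    using uv P unfolding locally_principal_def by meson
  obtain \<alpha> \<beta> where \<alpha>: "\<alpha> \<in> carrier R" "w = \<alpha> \<otimes> u" and \<beta>: "\<beta> \<in> carrier R" "w = \<beta> \<otimes> v"
    using e(2) by (auto simp: cgenideal_def)
  have wc: "w \<in> carrier R" and ec: "e \<in> carrier R" using \<alpha> c e by auto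
  have "r \<otimes> (\<alpha> \<otimes> a) = \<alpha> \<otimes> (s \<otimes> u)" using c \<alpha> ra by (metis m_lcomm)
  then have z1: "r \<otimes> (\<alpha> \<otimes> a) = s \<otimes> w" using c \<alpha> by (metis m_lcomm)
  have "r \<otimes> (\<beta> \<otimes> b) = \<beta> \<otimes> (s \<otimes> v)" using c \<beta> rb by (metis m_lcomm)
  then have z2: "r \<otimes> (\<beta> \<otimes> b) = s \<otimes> w" using c \<beta> by (metis m_lcomm)
  have z3: "\<alpha> \<otimes> a = \<beta> \<otimes> b" using rcancel z1 z2 c \<alpha> \<beta> by simp
  define z where "z = \<alpha> \<otimes> a"
  have "z \<in> PIdl a" "z \<in> PIdl b"
    using z3 \<alpha>(1) \<beta>(1) unfolding cgenideal_def z_def by blast+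
  then have z: "z \<in> PIdl a \<inter> PIdl b" "r \<otimes> z = s \<otimes> w" "z \<in> carrier R"
    using z1 \<alpha>(1) c by (auto simp: z_def)
  have "\<exists>k\<in>carrier R. e \<otimes> y = z \<otimes> k" if "y \<in> PIdl a \<inter> PIdl b" for y
  proof -
    have y: "y \<in> PIdl a" "y \<in> PIdl b" using that by auto
    obtain g where g: "g \<in> carrier R" "y = g \<otimes> a" using y(1) unfolding mem_cgenideal by blast
    obtain h where h: "h \<in> carrier R" "y = h \<otimes> b" using y(2) unfolding mem_cgenideal by blast
    have yc: "y \<in> carrier R" using g c by auto
    have y1: "r \<otimes> y = s \<otimes> (g \<otimes> u)" using c g ra by (metis m_lcomm)
    have y2: "r \<otimes> y = s \<otimes> (h \<otimes> v)" using c h rb by (metis m_lcomm)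
    define d where "d = g \<otimes> u \<ominus> h \<otimes> v"
    have dc: "d \<in> carrier R" using c g h by (simp add: d_def)
    have "d \<otimes> s = s \<otimes> (g \<otimes> u) \<ominus> s \<otimes> (h \<otimes> v)"
      using c g h unfolding d_def by algebra
    then have "d \<otimes> s = \<zero>" using y1 y2 c h by (simp add: minus_eq r_neg)
    then have dx: "d \<otimes> x = d" using x dc by blast
    have "(\<one> \<ominus> x) \<otimes> d = d \<ominus> d \<otimes> x" using x(1) dc by algebra
    then have "(\<one> \<ominus> x) \<otimes> d = \<zero>" using dx dc by simp
    moreover have "(\<one> \<ominus> x) \<otimes> d = (\<one> \<ominus> x) \<otimes> (g \<otimes> u) \<ominus> (\<one> \<ominus> x) \<otimes> (h \<otimes> v)"
      using c g h x(1) unfolding d_def by algebra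
    ultimately have "(\<one> \<ominus> x) \<otimes> (g \<otimes> u) \<ominus> (\<one> \<ominus> x) \<otimes> (h \<otimes> v) = \<zero>" by simp
    then have eq: "(\<one> \<ominus> x) \<otimes> (g \<otimes> u) = (\<one> \<ominus> x) \<otimes> (h \<otimes> v)"
      using c g h x by simp
    have "(\<one> \<ominus> x) \<otimes> (g \<otimes> u) = ((\<one> \<ominus> x) \<otimes> g) \<otimes> u" "(\<one> \<ominus> x) \<otimes> (h \<otimes> v) = ((\<one> \<ominus> x) \<otimes> h) \<otimes> v"
      using c g h x by (simp_all add: m_assoc)
    then have "(\<one> \<ominus> x) \<otimes> (g \<otimes> u) \<in> PIdl u \<inter> PIdl v"
      unfolding Int_iff mem_cgenideal using eq c g h x by (metis m_closed minus_closed one_closed)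
    then obtain k where k: "k \<in> carrier R" "e \<otimes> ((\<one> \<ominus> x) \<otimes> (g \<otimes> u)) = w \<otimes> k" using e(3) by blast
    have "s \<otimes> (\<one> \<ominus> x) = s \<ominus> x \<otimes> s" using c x(1) by algebra
    then have s1: "s \<otimes> (\<one> \<ominus> x) = s" using x c by (simp add: minus_eq)
    have "r \<otimes> (e \<otimes> y) = e \<otimes> (s \<otimes> (g \<otimes> u))" using y1 c ec yc by (metis m_lcomm)
    also have "\<dots> = e \<otimes> ((s \<otimes> (\<one> \<ominus> x)) \<otimes> (g \<otimes> u))" using s1 by simp
    also have "\<dots> = s \<otimes> (e \<otimes> ((\<one> \<ominus> x) \<otimes> (g \<otimes> u)))" using c g(1) x(1) ec by algebra
    also have "\<dots> = r \<otimes> (z \<otimes> k)" using k z c wc by (metis m_assoc)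
    finally have "e \<otimes> y = z \<otimes> k" using rcancel[of "e \<otimes> y" "z \<otimes> k"] ec yc z k by simp
    then show ?thesis using k by blast
  qed
  then show "\<exists>e\<in>carrier R - P. \<exists>x\<in>PIdl a \<inter> PIdl b. \<forall>y\<in>PIdl a \<inter> PIdl b. \<exists>k\<in>carrier R. e \<otimes> y = x \<otimes> k"
    using e(1) z(1) by blast
qed

section \<open>Vanishing in tensor products\<close>

text \<open>The map f \<otimes> g on formal sums, before the relations are divided out. The
  arguments about tensor products run on such representatives and ask only whether a sum lies in
  \<open>tensor_rels\<close>.\<close>

definition tensor_frag_map :: "('n \<Rightarrow> 'n') \<Rightarrow> ('m \<Rightarrow> 'm') \<Rightarrow> ('n \<times> 'm \<Rightarrow>\<^sub>0 int) \<Rightarrow> ('n' \<times> 'm' \<Rightarrow>\<^sub>0 int)"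
  where "tensor_frag_map f g = frag_extend (\<lambda>(n, m). frag_of (f n, g m))"

lemma tensor_frag_map_of [simp]: "tensor_frag_map f g (frag_of (n, m)) = frag_of (f n, g m)"
  by (simp add: tensor_frag_map_def)

lemma tensor_frag_map_linear [simp]:
  "tensor_frag_map f g 0 = 0"
  "tensor_frag_map f g (x + y) = tensor_frag_map f g x + tensor_frag_map f g y"
  "tensor_frag_map f g (x - y) = tensor_frag_map f g x - tensor_frag_map f g y"
  "tensor_frag_map f g (- x) = - tensor_frag_map f g x"
  by (simp_all add: tensor_frag_map_def frag_extend_add frag_extend_diff frag_extend_minus)

lemma keys_tensor_frag_map:
  assumes "Poly_Mapping.keys z \<subseteq> A \<times> B" "f ` A \<subseteq> A'" "g ` B \<subseteq> B'"
  shows "Poly_Mapping.keys (tensor_frag_map f g z) \<subseteq> A' \<times> B'"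
  unfolding tensor_frag_map_def
  using assms by (intro order_trans[OF keys_frag_extend]) (force simp: keys_frag_of)

lemma tensor_gens_closed:
  assumes "module R N" "module R M"
  shows "tensor_gens R N M \<subseteq> carrier (free_Abelian_group (carrier N \<times> carrier M))"
proof -
  interpret N: module R N by fact
  interpret M: module R M by fact
  have 3: "Poly_Mapping.keys (frag_of a - frag_of b - frag_of c) \<subseteq> S" if "{a, b, c} \<subseteq> S"
    for a b c :: "'c \<times> 'e" and S
    using that keys_diff[of "frag_of a - frag_of b" "frag_of c"] keys_diff[of "frag_of a" "frag_of b"]
    by (auto simp: keys_frag_of)
  have 2: "Poly_Mapping.keys (frag_of a - frag_of b) \<subseteq> S" if "{a, b} \<subseteq> S"
    for a b :: "'c \<times> 'e" and S
    using that keys_diff[of "frag_of a" "frag_of b"] by (auto simp: keys_frag_of)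
  show ?thesis
  proof
    fix x assume "x \<in> tensor_gens R N M"
    then show "x \<in> carrier (free_Abelian_group (carrier N \<times> carrier M))"
      unfolding tensor_gens_def carrier_free_Abelian_group_iff Un_iff mem_Collect_eq
      by (elim disjE exE conjE) (simp_all add: 2 3)
  qed
qed

lemma tensor_rels_subgroup:
  assumes "module R N" "module R M"
  shows "subgroup (tensor_rels R N M) (free_Abelian_group (carrier N \<times> carrier M))"
  unfolding tensor_rels_def
  using tensor_gens_closed[OF assms] group.generate_is_subgroup group_free_Abelian_group by blast

lemma tensor_rels_closed:
  assumes "module R N" "module R M"
  shows "z \<in> tensor_rels R N M \<Longrightarrow> Poly_Mapping.keys z \<subseteq> carrier N \<times> carrier M"
    and "0 \<in> tensor_rels R N M"
    and "x \<in> tensor_rels R N M \<Longrightarrow> y \<in> tensor_rels R N M \<Longrightarrow> x + y \<in> tensor_rels R N M"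
    and "x \<in> tensor_rels R N M \<Longrightarrow> - x \<in> tensor_rels R N M"
    and "x \<in> tensor_rels R N M \<Longrightarrow> y \<in> tensor_rels R N M \<Longrightarrow> x - y \<in> tensor_rels R N M"
proof -
  let ?F = "free_Abelian_group (carrier N \<times> carrier M)"
  interpret subgroup "tensor_rels R N M" ?F
    by (rule tensor_rels_subgroup[OF assms])
  show keys: "z \<in> tensor_rels R N M \<Longrightarrow> Poly_Mapping.keys z \<subseteq> carrier N \<times> carrier M" for z
    by (drule subsetD[OF subset]) simp
  show "0 \<in> tensor_rels R N M" using one_closed by simp
  show add: "x \<in> tensor_rels R N M \<Longrightarrow> y \<in> tensor_rels R N M \<Longrightarrow> x + y \<in> tensor_rels R N M" for x y
    using m_closed[of x y] by simp
  show neg: "x \<in> tensor_rels R N M \<Longrightarrow> - x \<in> tensor_rels R N M" for x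
    using m_inv_closed[of x] keys[of x] by simp
  show "x \<in> tensor_rels R N M \<Longrightarrow> y \<in> tensor_rels R N M \<Longrightarrow> x - y \<in> tensor_rels R N M"
    using add[OF _ neg, of x y] by simp
qed

lemma tensor_rels_incl: "x \<in> tensor_gens R N M \<Longrightarrow> x \<in> tensor_rels R N M"
  unfolding tensor_rels_def by (rule generate.incl)

lemma tensor_rels_add_left:
  "n \<in> carrier N \<Longrightarrow> n' \<in> carrier N \<Longrightarrow> m \<in> carrier M \<Longrightarrow>
   frag_of (n \<oplus>\<^bsub>N\<^esub> n', m) - frag_of (n, m) - frag_of (n', m) \<in> tensor_rels R N M"
  by (rule tensor_rels_incl) (auto simp: tensor_gens_def)

lemma tensor_rels_add_right:
  "n \<in> carrier N \<Longrightarrow> m \<in> carrier M \<Longrightarrow> m' \<in> carrier M \<Longrightarrow>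
   frag_of (n, m \<oplus>\<^bsub>M\<^esub> m') - frag_of (n, m) - frag_of (n, m') \<in> tensor_rels R N M"
  by (rule tensor_rels_incl) (auto simp: tensor_gens_def)

lemma tensor_rels_smult:
  "r \<in> carrier R \<Longrightarrow> n \<in> carrier N \<Longrightarrow> m \<in> carrier M \<Longrightarrow>
   frag_of (r \<odot>\<^bsub>N\<^esub> n, m) - frag_of (n, r \<odot>\<^bsub>M\<^esub> m) \<in> tensor_rels R N M"
  by (rule tensor_rels_incl) (auto simp: tensor_gens_def)

lemma tensor_rels_induct [consumes 3, case_names add_left add_right smult zero add minus]:
  assumes mods: "module R N" "module R M" and z: "z \<in> tensor_rels R N M"
    and "\<And>n n' m. n \<in> carrier N \<Longrightarrow> n' \<in> carrier N \<Longrightarrow> m \<in> carrier M \<Longrightarrow>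
      P (frag_of (n \<oplus>\<^bsub>N\<^esub> n', m) - frag_of (n, m) - frag_of (n', m))"
    and "\<And>n m m'. n \<in> carrier N \<Longrightarrow> m \<in> carrier M \<Longrightarrow> m' \<in> carrier M \<Longrightarrow>
      P (frag_of (n, m \<oplus>\<^bsub>M\<^esub> m') - frag_of (n, m) - frag_of (n, m'))"
    and "\<And>r n m. r \<in> carrier R \<Longrightarrow> n \<in> carrier N \<Longrightarrow> m \<in> carrier M \<Longrightarrow>
      P (frag_of (r \<odot>\<^bsub>N\<^esub> n, m) - frag_of (n, r \<odot>\<^bsub>M\<^esub> m))"
    and "P 0"
    and "\<And>x y. x \<in> tensor_rels R N M \<Longrightarrow> y \<in> tensor_rels R N M \<Longrightarrow> P x \<Longrightarrow> P y \<Longrightarrow> P (x + y)"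
    and "\<And>x. x \<in> tensor_rels R N M \<Longrightarrow> P x \<Longrightarrow> P (- x)"
  shows "P z"
proof -
  let ?F = "free_Abelian_group (carrier N \<times> carrier M)"
  have gens: "P x" if "x \<in> tensor_gens R N M" for x
    using that assms(4-6) unfolding tensor_gens_def by blast
  from z have "z \<in> generate ?F (tensor_gens R N M)" by (simp add: tensor_rels_def)
  then show "P z"
  proof induction
    case one
    then show ?case using \<open>P 0\<close> by simp
  next
    case (incl h)
    then show ?case by (rule gens)
  next
    case (inv h)
    then have "h \<in> tensor_rels R N M" by (rule tensor_rels_incl)
    then show ?case
      using assms(9)[of h] gens[OF inv] tensor_rels_closed(1)[OF mods] by simp
  next
    case (eng x y)
    then show ?case using assms(8) by (simp add: tensor_rels_def)
  qed
qed

lemma module_homD: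
  assumes "f \<in> module_hom R M N"
  shows "f \<in> carrier M \<rightarrow> carrier N"
    and "x \<in> carrier M \<Longrightarrow> y \<in> carrier M \<Longrightarrow> f (x \<oplus>\<^bsub>M\<^esub> y) = f x \<oplus>\<^bsub>N\<^esub> f y"
    and "r \<in> carrier R \<Longrightarrow> x \<in> carrier M \<Longrightarrow> f (r \<odot>\<^bsub>M\<^esub> x) = r \<odot>\<^bsub>N\<^esub> f x"
    and "x \<in> carrier M \<Longrightarrow> f x \<in> carrier N"
  using assms by (auto simp: module_hom_def)

lemma module_hom_zero:
  assumes "module R M" "module R N" "f \<in> module_hom R M N"
  shows "f \<zero>\<^bsub>M\<^esub> = \<zero>\<^bsub>N\<^esub>"
proof -
  interpret M: module R M by fact
  interpret N: module R N by fact
  have "f (\<zero>\<^bsub>R\<^esub> \<odot>\<^bsub>M\<^esub> \<zero>\<^bsub>M\<^esub>) = \<zero>\<^bsub>R\<^esub> \<odot>\<^bsub>N\<^esub> f \<zero>\<^bsub>M\<^esub>"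
    by (rule module_homD(3)[OF assms(3)]) simp_all
  then show ?thesis using module_homD(4)[OF assms(3), of "\<zero>\<^bsub>M\<^esub>"] by simp
qed

lemma tensor_frag_map_rels:
  assumes "module R N" "module R M" "module R N'" "module R M'"
    and f: "f \<in> module_hom R N N'" and g: "g \<in> module_hom R M M'"
    and z: "z \<in> tensor_rels R N M"
  shows "tensor_frag_map f g z \<in> tensor_rels R N' M'"
  using assms(1,2) z
proof (induction rule: tensor_rels_induct)
  case (add_left n n' m)
  then show ?case using tensor_rels_add_left[of "f n" N' "f n'" "g m" M']
    by (simp add: module_homD[OF f] module_homD[OF g])
next
  case (add_right n m m')
  then show ?case using tensor_rels_add_right[of "f n" N' "g m" M' "g m'"]
    by (simp add: module_homD[OF f] module_homD[OF g])
next
  case (smult r n m)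
  then show ?case using tensor_rels_smult[of r R "f n" N' "g m" M']
    by (simp add: module_homD[OF f] module_homD[OF g])
qed (use tensor_rels_closed[OF assms(3,4)] in auto)

lemma tensor_rels_coset_eq_iff:
  assumes "module R N" "module R M"
  defines "F \<equiv> free_Abelian_group (carrier N \<times> carrier M)"
  shows "tensor_rels R N M #>\<^bsub>F\<^esub> x = tensor_rels R N M #>\<^bsub>F\<^esub> y \<longleftrightarrow> x - y \<in> tensor_rels R N M"
proof -
  let ?K = "tensor_rels R N M"
  note K = tensor_rels_closed[OF assms(1,2)]
  have coset: "?K #>\<^bsub>F\<^esub> x = {z. z - x \<in> ?K}" for x
    unfolding r_coset_def F_def by (auto intro!: bexI[of _ "_ - x"])
  show ?thesis
  proof
    assume "?K #>\<^bsub>F\<^esub> x = ?K #>\<^bsub>F\<^esub> y"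
    moreover have "x \<in> ?K #>\<^bsub>F\<^esub> x" using K(2) by (simp add: coset)
    ultimately show "x - y \<in> ?K" by (simp add: coset)
  next
    assume xy: "x - y \<in> ?K"
    have "z - x \<in> ?K \<longleftrightarrow> z - y \<in> ?K" for z
      using K(3)[of "z - x" "x - y"] K(5)[of "z - y" "x - y"] xy by auto
    then show "?K #>\<^bsub>F\<^esub> x = ?K #>\<^bsub>F\<^esub> y" by (simp add: coset)
  qed
qed

text \<open>A group homomorphism is injective iff its kernel is trivial. In terms of representatives
  the kernel condition involves neither cosets nor \<open>the_elem\<close>; flatness is used and
  proved only in this form.\<close>

lemma inj_on_tensor_map_iff:
  assumes N: "module R N" and N': "module R N'" and M: "module R M" and f: "f \<in> module_hom R N N'"
  shows "inj_on (tensor_map R N' M f) (carrier (tensor R N M)) \<longleftrightarrow>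
    (\<forall>z. Poly_Mapping.keys z \<subseteq> carrier N \<times> carrier M \<longrightarrow>
      tensor_frag_map f id z \<in> tensor_rels R N' M \<longrightarrow> z \<in> tensor_rels R N M)"
proof -
  let ?F = "free_Abelian_group (carrier N \<times> carrier M)"
  let ?F' = "free_Abelian_group (carrier N' \<times> carrier M)"
  let ?K = "tensor_rels R N M"
  let ?K' = "tensor_rels R N' M"
  have id: "id \<in> module_hom R M M" by (auto simp: module_hom_def)
  have carr: "carrier (tensor R N M) = {?K #>\<^bsub>?F\<^esub> z | z. Poly_Mapping.keys z \<subseteq> carrier N \<times> carrier M}"
    by (auto simp: tensor_def FactGroup_def RCOSETS_def)
  have map: "tensor_map R N' M f (?K #>\<^bsub>?F\<^esub> z) = ?K' #>\<^bsub>?F'\<^esub> tensor_frag_map f id z"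
    if "Poly_Mapping.keys z \<subseteq> carrier N \<times> carrier M" for z
  proof -
    have "(\<lambda>x. ?K' #>\<^bsub>?F'\<^esub> tensor_frag_map f id x) ` (?K #>\<^bsub>?F\<^esub> z) = {?K' #>\<^bsub>?F'\<^esub> tensor_frag_map f id z}"
    proof -
      have "?K' #>\<^bsub>?F'\<^esub> tensor_frag_map f id x = ?K' #>\<^bsub>?F'\<^esub> tensor_frag_map f id z"
        if x: "x \<in> ?K #>\<^bsub>?F\<^esub> z" for x
      proof -
        obtain k where "k \<in> ?K" "x = k \<otimes>\<^bsub>?F\<^esub> z" using x unfolding r_coset_def by blast
        then show ?thesis
          using tensor_frag_map_rels[OF N M N' M f id, of k]
          by (simp add: tensor_rels_coset_eq_iff[OF N' M])
      qed
      moreover have "z \<in> ?K #>\<^bsub>?F\<^esub> z"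
        using tensor_rels_closed(2)[OF N M] by (force simp: r_coset_def)
      ultimately show ?thesis by blast
    qed
    then show ?thesis
      by (simp add: tensor_map_def tensor_frag_map_def id_def)
  qed
  show ?thesis
  proof
    assume inj: "inj_on (tensor_map R N' M f) (carrier (tensor R N M))"
    show "\<forall>z. Poly_Mapping.keys z \<subseteq> carrier N \<times> carrier M \<longrightarrow>
      tensor_frag_map f id z \<in> ?K' \<longrightarrow> z \<in> ?K"
    proof (intro allI impI)
      fix z assume z: "Poly_Mapping.keys z \<subseteq> carrier N \<times> carrier M" "tensor_frag_map f id z \<in> ?K'"
      have "?K' #>\<^bsub>?F'\<^esub> tensor_frag_map f id z = ?K' #>\<^bsub>?F'\<^esub> tensor_frag_map f id 0"
        using z by (simp add: tensor_rels_coset_eq_iff[OF N' M])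
      then have "tensor_map R N' M f (?K #>\<^bsub>?F\<^esub> z) = tensor_map R N' M f (?K #>\<^bsub>?F\<^esub> 0)"
        using map[of z] map[of 0] z by simp
      then have "?K #>\<^bsub>?F\<^esub> z = ?K #>\<^bsub>?F\<^esub> 0"
        by (rule inj_onD[OF inj]) (use z in \<open>auto simp: carr intro: exI[of _ 0]\<close>)
      then show "z \<in> ?K" by (simp add: tensor_rels_coset_eq_iff[OF N M])
    qed
  next
    assume *: "\<forall>z. Poly_Mapping.keys z \<subseteq> carrier N \<times> carrier M \<longrightarrow>
      tensor_frag_map f id z \<in> ?K' \<longrightarrow> z \<in> ?K"
    show "inj_on (tensor_map R N' M f) (carrier (tensor R N M))"
    proof (rule inj_onI)
      fix X Y assume "X \<in> carrier (tensor R N M)" "Y \<in> carrier (tensor R N M)"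
        and eq: "tensor_map R N' M f X = tensor_map R N' M f Y"
      then obtain x y where x: "X = ?K #>\<^bsub>?F\<^esub> x" "Poly_Mapping.keys x \<subseteq> carrier N \<times> carrier M"
        and y: "Y = ?K #>\<^bsub>?F\<^esub> y" "Poly_Mapping.keys y \<subseteq> carrier N \<times> carrier M"
        unfolding carr by blast
      have "tensor_frag_map f id x - tensor_frag_map f id y \<in> ?K'"
        using eq map x y by (simp add: tensor_rels_coset_eq_iff[OF N' M])
      moreover have "Poly_Mapping.keys (x - y) \<subseteq> carrier N \<times> carrier M"
        using keys_diff[of x y] x y by blast
      ultimately have "x - y \<in> ?K" using *[rule_format, of "x - y"] by simp
      then show "X = Y" using x y by (simp add: tensor_rels_coset_eq_iff[OF N M])
    qed
  qed
qed

text \<open>Maps that are bilinear only modulo a subgroup \<open>H\<close> are allowed, so that maps out of quotient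
  modules may be given by a choice of representatives.\<close>

lemma tensor_eval:
  fixes G (structure)
  assumes "module R N" "module R M" and G: "abelian_group G" and H: "subgroup H (add_monoid G)"
    and \<phi>: "\<And>n m. n \<in> carrier N \<Longrightarrow> m \<in> carrier M \<Longrightarrow> \<phi> n m \<in> carrier G"
    and add_left: "\<And>n n' m. n \<in> carrier N \<Longrightarrow> n' \<in> carrier N \<Longrightarrow> m \<in> carrier M \<Longrightarrow>
      \<phi> (n \<oplus>\<^bsub>N\<^esub> n') m \<ominus> \<phi> n m \<ominus> \<phi> n' m \<in> H"
    and add_right: "\<And>n m m'. n \<in> carrier N \<Longrightarrow> m \<in> carrier M \<Longrightarrow> m' \<in> carrier M \<Longrightarrow>
      \<phi> n (m \<oplus>\<^bsub>M\<^esub> m') \<ominus> \<phi> n m \<ominus> \<phi> n m' \<in> H"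
    and smult: "\<And>r n m. r \<in> carrier R \<Longrightarrow> n \<in> carrier N \<Longrightarrow> m \<in> carrier M \<Longrightarrow>
      \<phi> (r \<odot>\<^bsub>N\<^esub> n) m \<ominus> \<phi> n (r \<odot>\<^bsub>M\<^esub> m) \<in> H"
  shows "\<exists>h. (\<forall>z. Poly_Mapping.keys z \<subseteq> carrier N \<times> carrier M \<longrightarrow> h z \<in> carrier G) \<and>
    (\<forall>n\<in>carrier N. \<forall>m\<in>carrier M. h (frag_of (n, m)) = \<phi> n m) \<and> h 0 = \<zero> \<and>
    (\<forall>x y. Poly_Mapping.keys x \<subseteq> carrier N \<times> carrier M \<longrightarrow>
      Poly_Mapping.keys y \<subseteq> carrier N \<times> carrier M \<longrightarrow>
      h (x + y) = h x \<oplus> h y \<and> h (x - y) = h x \<ominus> h y) \<and>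
    (\<forall>z\<in>tensor_rels R N M. h z \<in> H)"
proof -
  let ?S = "carrier N \<times> carrier M"
  interpret N: module R N by fact
  interpret M: module R M by fact
  interpret G: abelian_group G by fact
  interpret H: subgroup H "add_monoid G" by fact
  have "(\<lambda>(n, m). \<phi> n m) ` ?S \<subseteq> carrier (add_monoid G)" using \<phi> by auto
  then obtain h where h: "h \<in> hom (free_Abelian_group ?S) (add_monoid G)"
    and of: "\<And>p. p \<in> ?S \<Longrightarrow> h (frag_of p) = (\<lambda>(n, m). \<phi> n m) p"
    using comm_group.free_Abelian_group_universal[OF G.a_comm_group, of "\<lambda>(n, m). \<phi> n m" ?S] by blast
  have carr: "h z \<in> carrier G" if "Poly_Mapping.keys z \<subseteq> ?S" for z
    using hom_in_carrier[OF h, of z] that by simp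
  have add: "h (x + y) = h x \<oplus> h y" if "Poly_Mapping.keys x \<subseteq> ?S" "Poly_Mapping.keys y \<subseteq> ?S" for x y
    using hom_mult[OF h, of x y] that by simp
  have zero: "h 0 = \<zero>" using add[of 0 0] carr[of 0] by simp
  have minus: "h (- x) = \<ominus> h x" if "Poly_Mapping.keys x \<subseteq> ?S" for x
    using add[of "- x" x] carr[of x] carr[of "- x"] that zero
    by (intro G.minus_equality[symmetric]) (simp_all add: keys_minus)
  have diff: "h (x - y) = h x \<ominus> h y" if "Poly_Mapping.keys x \<subseteq> ?S" "Poly_Mapping.keys y \<subseteq> ?S" for x y
    using add[of x "- y"] minus[of y] that by (simp add: keys_minus G.minus_eq)
  have key: "Poly_Mapping.keys (frag_of p) \<subseteq> ?S" "Poly_Mapping.keys (frag_of p - frag_of q) \<subseteq> ?S"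
    if "p \<in> ?S" "q \<in> ?S" for p q
    using that keys_diff[of "frag_of p" "frag_of q"] by (auto simp: keys_frag_of)
  have rels: "h z \<in> H" if "z \<in> tensor_rels R N M" for z
    using assms(1,2) that
  proof (induction rule: tensor_rels_induct)
    case (add_left n n' m)
    then show ?case using assms(6)[of n n' m]
      by (simp add: diff key of)
  next
    case (add_right n m m')
    then show ?case using assms(7)[of n m m']
      by (simp add: diff key of)
  next
    case (smult r n m)
    then show ?case using assms(8)[of r n m]
      by (simp add: diff key of)
  next
    case zero
    then show ?case using H.one_closed by (simp add: \<open>h 0 = \<zero>\<close>)
  next
    case (add x y)
    then show ?case using H.m_closed[of "h x" "h y"] tensor_rels_closed(1)[OF assms(1,2)]
      by (simp add: \<open>\<And>x y. Poly_Mapping.keys x \<subseteq> ?S \<Longrightarrow> Poly_Mapping.keys y \<subseteq> ?S \<Longrightarrow> h (x + y) = h x \<oplus> h y\<close>)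
  next
    case (minus x)
    then show ?case using H.m_inv_closed[of "h x"] tensor_rels_closed(1)[OF assms(1,2)]
      by (simp add: \<open>\<And>x. Poly_Mapping.keys x \<subseteq> ?S \<Longrightarrow> h (- x) = \<ominus> h x\<close> a_inv_def)
  qed
  show ?thesis by (intro exI[of _ h]) (use carr of zero add diff rels in auto)
qed

section \<open>Locally principal ideals are flat\<close>

lemmas free_Abelian_group_cases_induct = free_Abelian_group_induct [consumes 1, case_names zero diff of]

lemma as_module_simps [simp]:
  "carrier (as_module S X) = X" "add (as_module S X) = add S" "ring.zero (as_module S X) = ring.zero S"
  "smult (as_module S X) = monoid.mult S"
  by (simp_all add: as_module_def)

lemma (in cring) module_as_module:
  assumes "ideal V R"
  shows "module R (as_module R V)"
proof -
  interpret V: ideal V R by fact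
  have [simp]: "x \<in> carrier R" if "x \<in> V" for x using that V.Icarr by blast
  show ?thesis
  proof (rule moduleI[OF is_cring])
    show "abelian_group (as_module R V)"
    proof (rule abelian_groupI)
      fix x assume x: "x \<in> carrier (as_module R V)"
      show "\<exists>y\<in>carrier (as_module R V). y \<oplus>\<^bsub>as_module R V\<^esub> x = \<zero>\<^bsub>as_module R V\<^esub>"
        using x by (intro bexI[of _ "\<ominus> x"]) (simp_all add: l_neg)
    qed (simp_all add: a_ac)
  qed (simp_all add: l_distr r_distr m_assoc V.I_l_closed)
qed

lemma (in cring) flat_as_moduleI:
  assumes "ideal V R"
    and "\<And>(N :: ('a, (nat \<Rightarrow> 'a) set) module) (N' :: ('a, (nat \<Rightarrow> 'a) set) module) f z.
      module R N \<Longrightarrow> module R N' \<Longrightarrow> f \<in> module_hom R N N' \<Longrightarrow> inj_on f (carrier N) \<Longrightarrow>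
      Poly_Mapping.keys z \<subseteq> carrier N \<times> V \<Longrightarrow>
      tensor_frag_map f id z \<in> tensor_rels R N' (as_module R V) \<Longrightarrow> z \<in> tensor_rels R N (as_module R V)"
  shows "flat_module R (as_module R V)"
  unfolding flat_module_def
proof (intro conjI allI impI)
  show M: "module R (as_module R V)" by (rule module_as_module[OF assms(1)])
  fix N N' :: "('a, (nat \<Rightarrow> 'a) set) module" and f
  assume *: "module R N \<and> module R N' \<and> f \<in> module_hom R N N' \<and> inj_on f (carrier N)"
  then show "inj_on (tensor_map R N' (as_module R V) f) (carrier (tensor R N (as_module R V)))"
    using assms(2)[of N N' f] inj_on_tensor_map_iff[of R N N' "as_module R V" f] M by simp
qed

lemma (in cring) flat_as_moduleD:
  fixes N N' :: "('a, (nat \<Rightarrow> 'a) set) module"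
  assumes "ideal V R" "flat_module R (as_module R V)"
    "module R N" "module R N'" "f \<in> module_hom R N N'" "inj_on f (carrier N)"
    "Poly_Mapping.keys z \<subseteq> carrier N \<times> V"
    "tensor_frag_map f id z \<in> tensor_rels R N' (as_module R V)"
  shows "z \<in> tensor_rels R N (as_module R V)"
  using assms inj_on_tensor_map_iff[OF assms(3,4) module_as_module[OF assms(1)] assms(5)]
  unfolding flat_module_def by simp

lemma (in cring) elementwise_ppE:
  assumes "elementwise_pp R" "a \<in> carrier R"
  obtains x where "x \<in> carrier R" "x \<otimes> a = \<zero>" "(\<one> \<ominus> x) \<otimes> a = a"
    "\<And>z. z \<in> carrier R \<Longrightarrow> z \<otimes> a = \<zero> \<Longrightarrow> (\<one> \<ominus> x) \<otimes> z = \<zero>"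
proof -
  obtain x where x: "x \<in> carrier R" "x \<otimes> a = \<zero>"
    and ann: "\<And>z. z \<in> carrier R \<Longrightarrow> z \<otimes> a = \<zero> \<Longrightarrow> z \<otimes> x = z"
    using assms unfolding elementwise_pp_def by meson
  have "(\<one> \<ominus> x) \<otimes> a = a \<ominus> x \<otimes> a" using assms(2) x(1) by algebra
  then have 1: "(\<one> \<ominus> x) \<otimes> a = a" using x assms(2) by (simp add: minus_eq)
  have "(\<one> \<ominus> x) \<otimes> z = \<zero>" if "z \<in> carrier R" "z \<otimes> a = \<zero>" for z
  proof -
    have "(\<one> \<ominus> x) \<otimes> z = z \<ominus> z \<otimes> x" using that(1) x(1) by algebra
    then show ?thesis using ann[OF that] that(1) by (simp add: minus_eq r_neg)
  qed
  then show thesis using that x 1 by blast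
qed

text \<open>A quotient \<open>k\<close> with e y = x k is determined only up to the annihilator of
  \<open>x\<close>, so an arbitrary choice is not linear. If \<open>t\<close> generates that
  annihilator, the factor s = 1 - t kills the ambiguity and fixes \<open>x\<close>; hence s times
  the chosen quotient is linear in y and still a quotient.\<close>

lemma (in cring) elementwise_pp_quotient:
  assumes "elementwise_pp R" "x \<in> carrier R" "ideal V R" "e \<in> carrier R"
    and div: "\<And>y. y \<in> V \<Longrightarrow> \<exists>k\<in>carrier R. e \<otimes> y = x \<otimes> k"
  obtains \<kappa> where "\<kappa> \<in> V \<rightarrow> carrier R" "\<And>y. y \<in> V \<Longrightarrow> e \<otimes> y = \<kappa> y \<otimes> x"
    "\<And>y z. y \<in> V \<Longrightarrow> z \<in> V \<Longrightarrow> \<kappa> (y \<oplus> z) = \<kappa> y \<oplus> \<kappa> z"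
    "\<And>r y. r \<in> carrier R \<Longrightarrow> y \<in> V \<Longrightarrow> \<kappa> (r \<otimes> y) = r \<otimes> \<kappa> y"
proof -
  interpret V: ideal V R by fact
  have Vc: "y \<in> carrier R" if "y \<in> V" for y using that V.Icarr by blast
  obtain t where t: "t \<in> carrier R" "t \<otimes> x = \<zero>" "(\<one> \<ominus> t) \<otimes> x = x"
    and ann: "\<And>z. z \<in> carrier R \<Longrightarrow> z \<otimes> x = \<zero> \<Longrightarrow> (\<one> \<ominus> t) \<otimes> z = \<zero>"
    using elementwise_ppE[OF assms(1,2)] by metis
  define s where "s = \<one> \<ominus> t"
  have s: "s \<in> carrier R" "s \<otimes> x = x" using t by (auto simp: s_def)
  define q where "q y = (SOME k. k \<in> carrier R \<and> e \<otimes> y = x \<otimes> k)" for y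
  have q: "q y \<in> carrier R" "e \<otimes> y = x \<otimes> q y" if "y \<in> V" for y
    using someI_ex[of "\<lambda>k. k \<in> carrier R \<and> e \<otimes> y = x \<otimes> k"] div[OF that] by (auto simp: q_def)
  have uniq: "s \<otimes> k = s \<otimes> l" if "k \<in> carrier R" "l \<in> carrier R" "x \<otimes> k = x \<otimes> l" for k l
  proof -
    have "(k \<ominus> l) \<otimes> x = x \<otimes> k \<ominus> x \<otimes> l" using that(1,2) assms(2) by algebra
    then have "(k \<ominus> l) \<otimes> x = \<zero>" using that assms(2) by (simp add: minus_eq r_neg)
    then have 0: "s \<otimes> (k \<ominus> l) = \<zero>" using ann that by (simp add: s_def)
    have "s \<otimes> k \<ominus> s \<otimes> l = s \<otimes> (k \<ominus> l)" using that(1,2) s(1) by algebra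
    also note 0
    finally show ?thesis by (rule minus_zero_imp_eq) (use that(1,2) s(1) in simp_all)
  qed
  show thesis
  proof (rule that[of "\<lambda>y. s \<otimes> q y"])
    show "(\<lambda>y. s \<otimes> q y) \<in> V \<rightarrow> carrier R" using s q by auto
    fix y assume y: "y \<in> V"
    have "(s \<otimes> q y) \<otimes> x = (s \<otimes> x) \<otimes> q y" using s(1) assms(2) q(1)[OF y] by algebra
    then show "e \<otimes> y = (s \<otimes> q y) \<otimes> x" using s(2) q(2)[OF y] by simp
    {
      fix z assume z: "z \<in> V"
      have "x \<otimes> q (y \<oplus> z) = e \<otimes> (y \<oplus> z)" using q(2) y z by simp
      also have "\<dots> = e \<otimes> y \<oplus> e \<otimes> z" using Vc y z assms(4) by (simp add: r_distr)
      also have "\<dots> = x \<otimes> (q y \<oplus> q z)" using q y z assms(2) by (simp add: r_distr)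
      finally have "s \<otimes> q (y \<oplus> z) = s \<otimes> (q y \<oplus> q z)" using uniq q y z by simp
      then show "s \<otimes> q (y \<oplus> z) = s \<otimes> q y \<oplus> s \<otimes> q z" using q y z s by (simp add: r_distr)
    }
    {
      fix r assume r: "r \<in> carrier R"
      have ry: "r \<otimes> y \<in> V" using r y V.I_l_closed by blast
      have "x \<otimes> q (r \<otimes> y) = e \<otimes> (r \<otimes> y)" using q(2) ry by simp
      also have "\<dots> = r \<otimes> (e \<otimes> y)" using Vc y r assms(4) by (simp add: m_lcomm)
      also have "\<dots> = x \<otimes> (r \<otimes> q y)" using q y r assms(2) by (simp add: m_lcomm)
      finally have "s \<otimes> q (r \<otimes> y) = s \<otimes> (r \<otimes> q y)" using uniq q y r ry by simp
      then show "s \<otimes> q (r \<otimes> y) = r \<otimes> (s \<otimes> q y)" using q y s r by (simp add: m_lcomm)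
    }
  qed
qed

text \<open>At a prime, e y = \<kappa>(y) x with \<kappa> linear. Then n \<otimes> m \<mapsto>
  \<kappa>(m) n maps N \<otimes> V to N, is natural in N, and determines every tensor up to the
  factor e. Injectivity of f on N itself therefore shows that e kills a kernel element, and the
  scalars that kill it make up the unit ideal.\<close>

lemma (in cring) locally_principal_imp_flat:
  assumes pp: "elementwise_pp R" and V: "ideal V R" and lp: "locally_principal R V"
  shows "flat_module R (as_module R V)"
proof (rule flat_as_moduleI[OF V])
  fix N N' :: "('a, (nat \<Rightarrow> 'a) set) module" and f and z :: "(nat \<Rightarrow> 'a) set \<times> 'a \<Rightarrow>\<^sub>0 int"
  assume N: "module R N" and N': "module R N'" and f: "f \<in> module_hom R N N'"
    and inj: "inj_on f (carrier N)" and z: "Poly_Mapping.keys z \<subseteq> carrier N \<times> V"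
  let ?M = "as_module R V"
  assume Fz: "tensor_frag_map f id z \<in> tensor_rels R N' ?M"
  interpret N: module R N by fact
  interpret N': module R N' by fact
  interpret V: ideal V R by fact
  have Vc: "y \<in> carrier R" if "y \<in> V" for y using that V.Icarr by blast
  note M = module_as_module[OF V]
  note K = tensor_rels_closed[OF N M]
  \<comment> \<open>Multiplication by \<open>e\<close> on N \<otimes> V, acting through the second
    factor. The next facts are the module axioms modulo the relations.\<close>
  let ?act = "\<lambda>e. tensor_frag_map id (\<lambda>y. e \<otimes> y) :: (_ \<times> 'a \<Rightarrow>\<^sub>0 int) \<Rightarrow> _"
  have act_keys: "Poly_Mapping.keys (?act e x) \<subseteq> carrier N \<times> V"
    if "e \<in> carrier R" "Poly_Mapping.keys x \<subseteq> carrier N \<times> V" for e x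
    using that by (intro keys_tensor_frag_map) (auto simp: V.I_l_closed)
  have act_add: "?act (a \<oplus> b) x - ?act a x - ?act b x \<in> tensor_rels R N ?M"
    if ab: "a \<in> carrier R" "b \<in> carrier R" and x: "Poly_Mapping.keys x \<subseteq> carrier N \<times> V" for a b x
    using x
  proof (induction x rule: free_Abelian_group_cases_induct)
    case (diff x y)
    have "?act (a \<oplus> b) (x - y) - ?act a (x - y) - ?act b (x - y) =
      (?act (a \<oplus> b) x - ?act a x - ?act b x) - (?act (a \<oplus> b) y - ?act a y - ?act b y)" by simp
    then show ?case using K(5)[OF diff(3,4)] by (simp only:)
  next
    case (of p)
    then obtain n m where p: "p = (n, m)" "n \<in> carrier N" "m \<in> V" by auto
    then show ?case using tensor_rels_add_right[of n N "a \<otimes> m" ?M "b \<otimes> m" R] ab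
      by (simp add: V.I_l_closed l_distr Vc)
  qed (simp add: K)
  have act_mult: "?act (a \<otimes> b) x = ?act a (?act b x)"
    if ab: "a \<in> carrier R" "b \<in> carrier R" and x: "Poly_Mapping.keys x \<subseteq> carrier N \<times> V" for a b x
    using x by (induction x rule: free_Abelian_group_cases_induct) (use ab in \<open>auto simp: m_assoc Vc\<close>)
  have act_rels: "?act a x \<in> tensor_rels R N ?M" if "a \<in> carrier R" "x \<in> tensor_rels R N ?M" for a x
    by (rule tensor_frag_map_rels[OF N M N M]) (use that in \<open>auto simp: module_hom_def V.I_l_closed r_distr m_lcomm Vc\<close>)
  have act_zero: "?act \<zero> x \<in> tensor_rels R N ?M" if "Poly_Mapping.keys x \<subseteq> carrier N \<times> V" for x
    using act_add[OF zero_closed zero_closed that] K(4)[of "- ?act \<zero> x"] by simp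
  have act_one: "?act \<one> x = x" if "Poly_Mapping.keys x \<subseteq> carrier N \<times> V" for x
    using that by (induction x rule: free_Abelian_group_cases_induct) (auto simp: Vc)
  define Z where "Z = {e \<in> carrier R. ?act e z \<in> tensor_rels R N ?M}"
  have "\<one> \<in> Z"
  proof (rule ideal_one_closedI)
    show "ideal Z R"
    proof (rule idealI')
      show "\<zero> \<in> Z" using act_zero[OF z] by (simp add: Z_def)
      fix a b assume "a \<in> Z" "b \<in> Z"
      then show "a \<oplus> b \<in> Z"
        using act_add[OF _ _ z, of a b] K(3)[of "?act (a \<oplus> b) z - ?act a z - ?act b z" "?act a z + ?act b z"]
          K(3)[of "?act a z" "?act b z"] by (auto simp: Z_def)
    next
      fix a x assume a: "a \<in> Z" and x: "x \<in> carrier R"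
      show "x \<otimes> a \<in> Z" using act_mult[OF x _ z, of a] act_rels[OF x] a x by (auto simp: Z_def)
      then show "a \<otimes> x \<in> Z" using a x m_comm by (auto simp: Z_def)
    qed (auto simp: Z_def)
    fix P assume P: "primeideal P R"
    obtain e x where e: "e \<in> carrier R - P" and x: "x \<in> V"
      and div: "\<And>y. y \<in> V \<Longrightarrow> \<exists>k\<in>carrier R. e \<otimes> y = x \<otimes> k"
      using lp P unfolding locally_principal_def by meson
    have ec: "e \<in> carrier R" using e by blast
    obtain \<kappa> where \<kappa>: "\<kappa> \<in> V \<rightarrow> carrier R" "\<And>y. y \<in> V \<Longrightarrow> e \<otimes> y = \<kappa> y \<otimes> x"
      and \<kappa>_add: "\<And>y z. y \<in> V \<Longrightarrow> z \<in> V \<Longrightarrow> \<kappa> (y \<oplus> z) = \<kappa> y \<oplus> \<kappa> z"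
      and \<kappa>_mult: "\<And>r y. r \<in> carrier R \<Longrightarrow> y \<in> V \<Longrightarrow> \<kappa> (r \<otimes> y) = r \<otimes> \<kappa> y"
      using elementwise_pp_quotient[OF pp Vc[OF x] V ec div] by metis
    have \<kappa>c: "\<kappa> y \<in> carrier R" if "y \<in> V" for y using \<kappa>(1) that by auto
    \<comment> \<open>\<open>h\<close> represents the map n \<otimes> m \<mapsto> \<kappa>(m) n from
      L \<otimes> V to L. It is needed for L = N and for L = N', where the two versions form a
      commuting square with \<open>f\<close>.\<close>
    define good where "good L h \<longleftrightarrow>
        (\<forall>z. Poly_Mapping.keys z \<subseteq> carrier L \<times> V \<longrightarrow> h z \<in> carrier L) \<and>
        (\<forall>n\<in>carrier L. \<forall>m\<in>V. h (frag_of (n, m)) = \<kappa> m \<odot>\<^bsub>L\<^esub> n) \<and> h 0 = \<zero>\<^bsub>L\<^esub> \<and>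
        (\<forall>x y. Poly_Mapping.keys x \<subseteq> carrier L \<times> V \<longrightarrow> Poly_Mapping.keys y \<subseteq> carrier L \<times> V \<longrightarrow>
          h (x + y) = h x \<oplus>\<^bsub>L\<^esub> h y \<and> h (x - y) = h x \<ominus>\<^bsub>L\<^esub> h y) \<and>
        (\<forall>z\<in>tensor_rels R L ?M. h z = \<zero>\<^bsub>L\<^esub>)"
      for L :: "('a, (nat \<Rightarrow> 'a) set) module" and h
    have ev: "\<exists>h. good L h" if L: "module R L" for L
    proof -
      interpret L: module R L by fact
      have H: "subgroup {\<zero>\<^bsub>L\<^esub>} (add_monoid L)"
        using group.triv_subgroup[OF L.M.a_group] by simp
      let ?S = "carrier L \<times> carrier ?M"
      have cancel: "a \<oplus>\<^bsub>L\<^esub> b \<ominus>\<^bsub>L\<^esub> a \<ominus>\<^bsub>L\<^esub> b = \<zero>\<^bsub>L\<^esub>" if "a \<in> carrier L" "b \<in> carrier L" for a b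
      proof -
        have "a \<oplus>\<^bsub>L\<^esub> b \<ominus>\<^bsub>L\<^esub> a \<ominus>\<^bsub>L\<^esub> b = (a \<oplus>\<^bsub>L\<^esub> b) \<oplus>\<^bsub>L\<^esub> \<ominus>\<^bsub>L\<^esub> (a \<oplus>\<^bsub>L\<^esub> b)"
          using that by (simp add: L.M.minus_eq L.M.minus_add L.M.a_assoc)
        then show ?thesis using that by (simp add: L.M.r_neg)
      qed
      have c: "\<kappa> m \<odot>\<^bsub>L\<^esub> n \<in> carrier L" if "n \<in> carrier L" "m \<in> carrier ?M" for n m
        using that \<kappa>c by simp
      have al: "\<kappa> m \<odot>\<^bsub>L\<^esub> (n \<oplus>\<^bsub>L\<^esub> n') \<ominus>\<^bsub>L\<^esub> \<kappa> m \<odot>\<^bsub>L\<^esub> n \<ominus>\<^bsub>L\<^esub> \<kappa> m \<odot>\<^bsub>L\<^esub> n' \<in> {\<zero>\<^bsub>L\<^esub>}"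
        if "n \<in> carrier L" "n' \<in> carrier L" "m \<in> carrier ?M" for n n' m
        using that \<kappa>c by (simp add: L.smult_r_distr cancel)
      have ar: "\<kappa> (m \<oplus>\<^bsub>?M\<^esub> m') \<odot>\<^bsub>L\<^esub> n \<ominus>\<^bsub>L\<^esub> \<kappa> m \<odot>\<^bsub>L\<^esub> n \<ominus>\<^bsub>L\<^esub> \<kappa> m' \<odot>\<^bsub>L\<^esub> n \<in> {\<zero>\<^bsub>L\<^esub>}"
        if "n \<in> carrier L" "m \<in> carrier ?M" "m' \<in> carrier ?M" for n m m'
        using that \<kappa>c by (simp add: L.smult_l_distr \<kappa>_add cancel)
      have sm: "\<kappa> m \<odot>\<^bsub>L\<^esub> (r \<odot>\<^bsub>L\<^esub> n) \<ominus>\<^bsub>L\<^esub> \<kappa> (r \<odot>\<^bsub>?M\<^esub> m) \<odot>\<^bsub>L\<^esub> n \<in> {\<zero>\<^bsub>L\<^esub>}"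
        if "r \<in> carrier R" "n \<in> carrier L" "m \<in> carrier ?M" for r n m
        using that \<kappa>c by (simp add: \<kappa>_mult L.smult_assoc1[symmetric] m_comm[of "\<kappa> m" r] L.M.minus_eq L.M.r_neg)
      show ?thesis
        using tensor_eval[OF L M L.M.abelian_group_axioms H c al ar sm] by (simp add: good_def)
    qed
    obtain \<Phi> where "good N \<Phi>" using ev[OF N] by blast
    then have \<Phi>: "\<And>z. Poly_Mapping.keys z \<subseteq> carrier N \<times> V \<Longrightarrow> \<Phi> z \<in> carrier N"
      "\<And>n m. n \<in> carrier N \<Longrightarrow> m \<in> V \<Longrightarrow> \<Phi> (frag_of (n, m)) = \<kappa> m \<odot>\<^bsub>N\<^esub> n" "\<Phi> 0 = \<zero>\<^bsub>N\<^esub>"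
      "\<And>x y. Poly_Mapping.keys x \<subseteq> carrier N \<times> V \<Longrightarrow> Poly_Mapping.keys y \<subseteq> carrier N \<times> V \<Longrightarrow>
          \<Phi> (x - y) = \<Phi> x \<ominus>\<^bsub>N\<^esub> \<Phi> y"
      by (simp_all add: good_def)
    obtain \<Psi> where "good N' \<Psi>" using ev[OF N'] by blast
    then have \<Psi>: "\<And>n m. n \<in> carrier N' \<Longrightarrow> m \<in> V \<Longrightarrow> \<Psi> (frag_of (n, m)) = \<kappa> m \<odot>\<^bsub>N'\<^esub> n" "\<Psi> 0 = \<zero>\<^bsub>N'\<^esub>"
      "\<And>x y. Poly_Mapping.keys x \<subseteq> carrier N' \<times> V \<Longrightarrow> Poly_Mapping.keys y \<subseteq> carrier N' \<times> V \<Longrightarrow>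
          \<Psi> (x - y) = \<Psi> x \<ominus>\<^bsub>N'\<^esub> \<Psi> y"
      "\<And>z. z \<in> tensor_rels R N' ?M \<Longrightarrow> \<Psi> z = \<zero>\<^bsub>N'\<^esub>"
      by (simp_all add: good_def)
    have f0: "f \<zero>\<^bsub>N\<^esub> = \<zero>\<^bsub>N'\<^esub>" by (rule module_hom_zero[OF N N' f])
    have f_diff: "f (a \<ominus>\<^bsub>N\<^esub> b) = f a \<ominus>\<^bsub>N'\<^esub> f b" if "a \<in> carrier N" "b \<in> carrier N" for a b
    proof -
      have "f a = f (a \<ominus>\<^bsub>N\<^esub> b) \<oplus>\<^bsub>N'\<^esub> f b"
        using module_homD(2)[OF f, of "a \<ominus>\<^bsub>N\<^esub> b" b] that
        by (simp add: N.M.minus_eq N.M.a_assoc N.M.l_neg)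
      then show ?thesis using that module_homD(4)[OF f]
        by (simp add: N'.M.minus_eq N'.M.a_assoc N'.M.r_neg)
    qed
    have comm: "\<Psi> (tensor_frag_map f id x) = f (\<Phi> x)" if "Poly_Mapping.keys x \<subseteq> carrier N \<times> V" for x
      using that
    proof (induction x rule: free_Abelian_group_cases_induct)
      case (diff x y)
      have k: "Poly_Mapping.keys (tensor_frag_map f id w) \<subseteq> carrier N' \<times> V"
        if "Poly_Mapping.keys w \<subseteq> carrier N \<times> V" for w
        using that module_homD(4)[OF f] by (intro keys_tensor_frag_map) auto
      show ?case using diff k[OF diff(1), unfolded id_def] k[OF diff(2), unfolded id_def] by (simp add: \<Psi>(3) \<Phi>(4,1) f_diff)
    next
      case (of p)
      then show ?case using module_homD[OF f] \<kappa>c by (auto simp: \<Psi> \<Phi>)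
    qed (simp add: \<Psi> \<Phi> f0)
    \<comment> \<open>Injectivity of \<open>f\<close> enters here, on the modules themselves and no
      longer on tensor products.\<close>
    have "f (\<Phi> z) = f \<zero>\<^bsub>N\<^esub>" using comm[OF z] \<Psi>(4)[OF Fz] f0 by simp
    then have \<Phi>z: "\<Phi> z = \<zero>\<^bsub>N\<^esub>" using inj \<Phi>(1)[OF z] by (auto dest: inj_onD)
    have frag_diff: "frag_of (a, x) - frag_of (b, x) - frag_of (a \<ominus>\<^bsub>N\<^esub> b, x) \<in> tensor_rels R N ?M"
      if "a \<in> carrier N" "b \<in> carrier N" for a b
    proof -
      have "(a \<ominus>\<^bsub>N\<^esub> b) \<oplus>\<^bsub>N\<^esub> b = a" using that by (simp add: N.M.minus_eq N.M.a_assoc N.M.l_neg)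
      then show ?thesis using tensor_rels_add_left[of "a \<ominus>\<^bsub>N\<^esub> b" N b x ?M R] that x
        by (simp add: algebra_simps)
    qed
    have frag_zero: "frag_of (\<zero>\<^bsub>N\<^esub>, x) \<in> tensor_rels R N ?M"
      using tensor_rels_add_left[of "\<zero>\<^bsub>N\<^esub>" N "\<zero>\<^bsub>N\<^esub>" x ?M R] K(4)[of "- frag_of (\<zero>\<^bsub>N\<^esub>, x)"] x by simp
    \<comment> \<open>e(n \<otimes> m) = n \<otimes> \<kappa>(m) x = \<kappa>(m) n \<otimes> x, so
      multiplication by \<open>e\<close> collapses every tensor w to the single term \<Phi>(w)
      \<otimes> x.\<close>
    have act: "?act e w - frag_of (\<Phi> w, x) \<in> tensor_rels R N ?M" if "Poly_Mapping.keys w \<subseteq> carrier N \<times> V" for w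
      using that
    proof (induction w rule: free_Abelian_group_cases_induct)
      case zero
      then show ?case using K(4)[OF frag_zero] by (simp add: \<Phi>)
    next
      case (diff u w)
      have "?act e (u - w) - frag_of (\<Phi> (u - w), x) =
          (?act e u - frag_of (\<Phi> u, x)) - (?act e w - frag_of (\<Phi> w, x)) +
          (frag_of (\<Phi> u, x) - frag_of (\<Phi> w, x) - frag_of (\<Phi> u \<ominus>\<^bsub>N\<^esub> \<Phi> w, x))"
        using \<Phi>(4)[OF diff(1,2)] by simp
      also have "\<dots> \<in> tensor_rels R N ?M"
        by (rule K(3)[OF K(5)[OF diff(3,4)] frag_diff[OF \<Phi>(1)[OF diff(1)] \<Phi>(1)[OF diff(2)]]])
      finally show ?case .
    next
      case (of p)
      then obtain n m where p: "p = (n, m)" "n \<in> carrier N" "m \<in> V" by auto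
      then have "- (frag_of (\<kappa> m \<odot>\<^bsub>N\<^esub> n, x) - frag_of (n, \<kappa> m \<otimes> x)) \<in> tensor_rels R N ?M"
        using tensor_rels_smult[of "\<kappa> m" R n N x ?M] \<kappa>c x by (intro K(4)) simp
      then show ?case using p by (simp add: \<Phi>(2) \<kappa>(2))
    qed
    have "?act e z \<in> tensor_rels R N ?M"
      using K(3)[OF act[OF z] frag_zero] by (simp add: \<Phi>z)
    then show "\<exists>e\<in>Z. e \<notin> P" using e by (auto simp: Z_def)
  qed
  then show "z \<in> tensor_rels R N ?M" using act_one[OF z] by (simp add: Z_def)
qed

text \<open>A compactness argument. The scalars \<open>e\<close> for which e V lies in the ideal
  generated by some finite subset of \<open>V\<close> form an ideal, since two finite sets can be
  united; a local generator puts a scalar outside each prime into it.\<close>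

lemma (in cring) locally_principal_imp_fg:
  assumes V: "ideal V R" and lp: "locally_principal R V"
  shows "fg_ideal V R"
proof -
  interpret V: ideal V R by fact
  have Vc: "V \<subseteq> carrier R" using V.Icarr by blast
  define Z where "Z = {e \<in> carrier R. \<exists>F. finite F \<and> F \<subseteq> V \<and> (\<forall>y\<in>V. e \<otimes> y \<in> Idl F)}"
  have "\<one> \<in> Z"
  proof (rule ideal_one_closedI)
    have Fc: "F \<subseteq> carrier R" if "F \<subseteq> V" for F using that Vc by blast
    show "ideal Z R"
    proof (rule idealI')
      show "\<zero> \<in> Z"
        using additive_subgroup.zero_closed[OF ideal.axioms(1)[OF genideal_ideal[of "{}"]]] Vc
        by (auto simp: Z_def intro!: exI[of _ "{}"])
      fix a b assume "a \<in> Z" "b \<in> Z"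
      then obtain F G where F: "a \<in> carrier R" "finite F" "F \<subseteq> V" "\<forall>y\<in>V. a \<otimes> y \<in> Idl F"
        and G: "b \<in> carrier R" "finite G" "G \<subseteq> V" "\<forall>y\<in>V. b \<otimes> y \<in> Idl G"
        by (auto simp: Z_def)
      have FG: "ideal (Idl (F \<union> G)) R" "Idl F \<subseteq> Idl (F \<union> G)" "Idl G \<subseteq> Idl (F \<union> G)"
        using F(3) G(3) Fc[of "F \<union> G"] by (simp_all add: genideal_ideal subset_Idl_subset)
      have "(a \<oplus> b) \<otimes> y \<in> Idl (F \<union> G)" if "y \<in> V" for y
        using F(1,4) G(1,4) FG that Vc additive_subgroup.a_closed[OF ideal.axioms(1)[OF FG(1)]]
        by (auto simp: l_distr subset_iff)
      then show "a \<oplus> b \<in> Z" using F G by (auto simp: Z_def intro!: exI[of _ "F \<union> G"])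
    next
      fix a x assume a: "a \<in> Z" and x: "x \<in> carrier R"
      then obtain F where F: "a \<in> carrier R" "finite F" "F \<subseteq> V" "\<forall>y\<in>V. a \<otimes> y \<in> Idl F"
        unfolding Z_def by blast
      have "(x \<otimes> a) \<otimes> y \<in> Idl F" if "y \<in> V" for y
        using F x that Vc ideal.I_l_closed[OF genideal_ideal[OF Fc[OF F(3)]] F(4)[rule_format, OF that] x]
        by (auto simp: m_assoc subset_iff)
      then show "x \<otimes> a \<in> Z" using F x by (auto simp: Z_def)
      then show "a \<otimes> x \<in> Z" using F x m_comm by simp
    qed (auto simp: Z_def)
    fix P assume P: "primeideal P R"
    obtain e x where e: "e \<in> carrier R - P" and x: "x \<in> V"
      and div: "\<And>y. y \<in> V \<Longrightarrow> \<exists>k\<in>carrier R. e \<otimes> y = x \<otimes> k"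
      using lp P unfolding locally_principal_def by meson
    have "e \<otimes> y \<in> Idl {x}" if y: "y \<in> V" for y
    proof -
      obtain k where "k \<in> carrier R" "e \<otimes> y = x \<otimes> k" using div y by blast
      then show ?thesis
        using ideal.I_r_closed[OF genideal_ideal[of "{x}"] genideal_self'[of x]] x Vc by auto
    qed
    then have "e \<in> Z" using e x by (auto simp: Z_def intro!: exI[of _ "{x}"])
    then show "\<exists>e\<in>Z. e \<notin> P" using e by blast
  qed
  then obtain F where F: "finite F" "F \<subseteq> V" "\<forall>y\<in>V. \<one> \<otimes> y \<in> Idl F"
    unfolding Z_def by blast
  have "V = Idl F" using F Vc genideal_minimal[OF V F(2)] by (auto simp: subset_iff)
  then show ?thesis using F Vc by (auto simp: fg_ideal_def)
qed

section \<open>Finitely generated flat ideals are locally principal\<close>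

text \<open>A copy of \<open>J / L\<close> on the type of the test modules: the coset of \<open>x\<close> is represented by the set
  of constant functions with value in it.\<close>

definition const_coset :: "('a, 'r) ring_scheme \<Rightarrow> 'a set \<Rightarrow> 'a \<Rightarrow> (nat \<Rightarrow> 'a) set"
  where "const_coset R L x = (\<lambda>y _. y) ` (L +>\<^bsub>R\<^esub> x)"

definition coset_rep :: "('a, 'r) ring_scheme \<Rightarrow> 'a set \<Rightarrow> (nat \<Rightarrow> 'a) set \<Rightarrow> 'a"
  where "coset_rep R L X = (SOME x. x \<in> carrier R \<and> const_coset R L x = X)"

text \<open>The fields \<open>monoid.mult\<close> and \<open>one\<close> hold dummy values. The
  operations go through chosen representatives and agree with those of cosets once \<open>L\<close>
  is an ideal.\<close>

definition quot_module :: "('a, 'r) ring_scheme \<Rightarrow> 'a set \<Rightarrow> 'a set \<Rightarrow> ('a, (nat \<Rightarrow> 'a) set) module"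
  where "quot_module R J L = \<lparr>carrier = const_coset R L ` J, monoid.mult = (\<lambda>X Y. X), one = {},
    ring.zero = const_coset R L \<zero>\<^bsub>R\<^esub>,
    add = (\<lambda>X Y. const_coset R L (coset_rep R L X \<oplus>\<^bsub>R\<^esub> coset_rep R L Y)),
    smult = (\<lambda>r X. const_coset R L (r \<otimes>\<^bsub>R\<^esub> coset_rep R L X))\<rparr>"

section \<open>Quotient modules as test modules for flatness\<close>

context cring
begin

context
  fixes L
  assumes L: "ideal L R"
begin

lemma const_coset_eq_iff:
  assumes "x \<in> carrier R" "y \<in> carrier R"
  shows "const_coset R L x = const_coset R L y \<longleftrightarrow> x \<ominus> y \<in> L"
proof -
  have "inj (\<lambda>y (_ :: nat). y :: 'a)" by (auto simp: inj_def fun_eq_iff)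
  then have "const_coset R L x = const_coset R L y \<longleftrightarrow> L +> x = L +> y"
    unfolding const_coset_def by (rule inj_image_eq_iff)
  then show ?thesis using quotient_eq_iff_same_a_r_cos[OF L assms] by simp
qed

lemma coset_rep:
  assumes "x \<in> carrier R"
  shows "coset_rep R L (const_coset R L x) \<in> carrier R"
    and "coset_rep R L (const_coset R L x) \<ominus> x \<in> L"
proof -
  let ?x = "coset_rep R L (const_coset R L x)"
  have *: "?x \<in> carrier R \<and> const_coset R L ?x = const_coset R L x"
    unfolding coset_rep_def by (rule someI[of _ x]) (use assms in simp)
  then show "?x \<in> carrier R" by simp
  then show "?x \<ominus> x \<in> L" using * const_coset_eq_iff[of ?x x] assms by simp
qed

lemma const_coset_add:
  assumes "x \<in> carrier R" "y \<in> carrier R"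
  shows "add (quot_module R J L) (const_coset R L x) (const_coset R L y) = const_coset R L (x \<oplus> y)"
proof -
  let ?x = "coset_rep R L (const_coset R L x)" and ?y = "coset_rep R L (const_coset R L y)"
  note x = coset_rep[OF assms(1)] and y = coset_rep[OF assms(2)]
  have "(?x \<oplus> ?y) \<ominus> (x \<oplus> y) = (?x \<ominus> x) \<oplus> (?y \<ominus> y)"
    using x(1) y(1) assms by algebra
  moreover have "(?x \<ominus> x) \<oplus> (?y \<ominus> y) \<in> L"
    using x(2) y(2) additive_subgroup.a_closed[OF ideal.axioms(1)[OF L]] by blast
  ultimately show ?thesis
    using const_coset_eq_iff[of "?x \<oplus> ?y" "x \<oplus> y"] x(1) y(1) assms by (simp add: quot_module_def)
qed

lemma const_coset_smult:
  assumes "r \<in> carrier R" "x \<in> carrier R"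
  shows "r \<odot>\<^bsub>quot_module R J L\<^esub> const_coset R L x = const_coset R L (r \<otimes> x)"
proof -
  let ?x = "coset_rep R L (const_coset R L x)"
  note x = coset_rep[OF assms(2)]
  have "r \<otimes> ?x \<ominus> r \<otimes> x = r \<otimes> (?x \<ominus> x)" using x(1) assms by algebra
  moreover have "r \<otimes> (?x \<ominus> x) \<in> L" using x(2) assms(1) ideal.I_l_closed[OF L] by blast
  ultimately show ?thesis
    using const_coset_eq_iff[of "r \<otimes> ?x" "r \<otimes> x"] x(1) assms by (simp add: quot_module_def)
qed

lemma quot_module_simps:
  "carrier (quot_module R J L) = const_coset R L ` J"
  "\<zero>\<^bsub>quot_module R J L\<^esub> = const_coset R L \<zero>"
  by (simp_all add: quot_module_def)

lemma module_quot_module: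
  assumes J: "ideal J R"
  shows "module R (quot_module R J L)"
proof -
  interpret J: ideal J R by fact
  have [simp]: "x \<in> carrier R" if "x \<in> J" for x using that J.Icarr by blast
  note [simp] = const_coset_add const_coset_smult quot_module_simps
  show ?thesis
  proof (rule moduleI[OF is_cring])
    show "abelian_group (quot_module R J L)"
    proof (rule abelian_groupI)
      fix X assume "X \<in> carrier (quot_module R J L)"
      then obtain x where x: "x \<in> J" "X = const_coset R L x" by auto
      then show "\<exists>Y\<in>carrier (quot_module R J L). Y \<oplus>\<^bsub>quot_module R J L\<^esub> X = \<zero>\<^bsub>quot_module R J L\<^esub>"
        by (auto simp: l_neg intro!: bexI[of _ "\<ominus> x"])
    qed (auto simp: a_ac)
  qed (auto simp: l_distr r_distr m_assoc J.I_l_closed)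
qed

end

text \<open>By the choice of \<open>L\<close>, multiplication by \<open>a\<close> induces an
  injection J/L \<rightarrow> R/vR, which flatness preserves after tensoring with \<open>V\<close>.
  If y is a sum of products j n, the tensor that is the sum of [j] \<otimes> n goes to [1] \<otimes>
  ay = [1] \<otimes> vm = [v] \<otimes> m = 0. Hence that tensor vanishes already in J/L \<otimes>
  V, and multiplying it out in R modulo LV shows that y lies in LV. A general \<open>J\<close> in
  place of \<open>R\<close> permits iteration over several colon conditions.\<close>

lemma flat_imp_mem_colon_prod:
  assumes V: "ideal V R" and flat: "flat_module R (as_module R V)" and J: "ideal J R"
    and a: "a \<in> carrier R" and v: "v \<in> carrier R"
    and y: "y \<in> ideal_prod R J V" and m: "m \<in> V" and ay: "a \<otimes> y = v \<otimes> m"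
  defines "L \<equiv> {x \<in> J. x \<otimes> a \<in> PIdl v}"
  shows "ideal L R" "y \<in> ideal_prod R L V"
proof -
  interpret V: ideal V R by fact
  interpret J: ideal J R by fact
  have Vc: "x \<in> carrier R" if "x \<in> V" for x using that V.Icarr by blast
  have Jc: "x \<in> carrier R" if "x \<in> J" for x using that J.Icarr by blast
  note PI = cgenideal_ideal[OF v]
  interpret PI: ideal "PIdl v" R by (rule PI)
  show L: "ideal L R"
  proof (rule idealI')
    show "L \<subseteq> carrier R" "\<zero> \<in> L" using a Jc by (auto simp: L_def)
    show "b \<oplus> c \<in> L" if "b \<in> L" "c \<in> L" for b c
      using that a Jc by (auto simp: L_def l_distr)
    show 1: "x \<otimes> b \<in> L" if "b \<in> L" "x \<in> carrier R" for b x
      using that a Jc by (auto simp: L_def m_assoc J.I_l_closed PI.I_l_closed)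
    show "b \<otimes> x \<in> L" if "b \<in> L" "x \<in> carrier R" for b x
      using 1[OF that] that m_comm[of b x] Jc by (auto simp: L_def)
  qed
  interpret L: ideal L R by (rule L)
  have Lc: "x \<in> carrier R" if "x \<in> L" for x using that L.Icarr by blast
  let ?M = "as_module R V" and ?N = "quot_module R J L" and ?N' = "quot_module R (carrier R) (PIdl v)"
  let ?q = "const_coset R L" and ?q' = "const_coset R (PIdl v)" and ?rep = "coset_rep R L"
  note M = module_as_module[OF V]
  note N = module_quot_module[OF L J] and N' = module_quot_module[OF PI oneideal]
  interpret LV: ideal "ideal_prod R L V" R by (rule ideal_prod_is_ideal[OF L V])
  define f where "f X = ?q' (?rep X \<otimes> a)" for X
  have f_q: "f (?q x) = ?q' (x \<otimes> a)" if "x \<in> carrier R" for x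
  proof -
    have "?rep (?q x) \<otimes> a \<ominus> x \<otimes> a = (?rep (?q x) \<ominus> x) \<otimes> a"
      using that a coset_rep(1)[OF L that] by algebra
    then show ?thesis
      using coset_rep[OF L that] that a unfolding f_def
      by (subst const_coset_eq_iff[OF PI]) (auto simp: L_def)
  qed
  have f: "f \<in> module_hom R ?N ?N'"
    using a Jc by (auto simp: module_hom_def quot_module_simps[OF L] quot_module_simps[OF PI] f_q
        const_coset_add[OF L] const_coset_add[OF PI] const_coset_smult[OF L] const_coset_smult[OF PI]
        l_distr m_assoc)
  have inj: "inj_on f (carrier ?N)"
  proof (rule inj_onI)
    fix X Y assume "X \<in> carrier ?N" "Y \<in> carrier ?N" and eq: "f X = f Y"
    then obtain x z where x: "x \<in> J" "X = ?q x" and z: "z \<in> J" "Y = ?q z"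
      by (auto simp: quot_module_simps[OF L])
    have "x \<otimes> a \<ominus> z \<otimes> a \<in> PIdl v"
      using eq x z a Jc const_coset_eq_iff[OF PI, of "x \<otimes> a" "z \<otimes> a"] by (simp add: f_q)
    moreover have "x \<otimes> a \<ominus> z \<otimes> a = (x \<ominus> z) \<otimes> a" using Jc[OF x(1)] Jc[OF z(1)] a by algebra
    moreover have "x \<ominus> z \<in> J" using x z by (simp add: minus_eq)
    ultimately show "X = Y"
      using x z Jc const_coset_eq_iff[OF L, of x z] by (simp add: L_def)
  qed
  have repc: "?rep X \<in> carrier R" if "X \<in> carrier ?N" for X
    using that coset_rep(1)[OF L] Jc by (auto simp: quot_module_simps[OF L])
  \<comment> \<open>The evaluation [j] \<otimes> n \<mapsto> j n depends on representatives that are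
    fixed only modulo \<open>L\<close>; hence it is bilinear only modulo LV, which is all that
    \<open>tensor_eval\<close> asks for.\<close>
  have prodL: "b \<otimes> n \<in> ideal_prod R L V" if "b \<in> L" "n \<in> V" for b n
    using that by (rule ideal_prod.prod)
  have c: "?rep X \<otimes> n \<in> carrier R" if "X \<in> carrier ?N" "n \<in> carrier ?M" for X n
    using that repc Vc by simp
  have al: "?rep (X \<oplus>\<^bsub>?N\<^esub> Y) \<otimes> n \<ominus> ?rep X \<otimes> n \<ominus> ?rep Y \<otimes> n \<in> ideal_prod R L V"
    if X: "X \<in> carrier ?N" and Y: "Y \<in> carrier ?N" and n: "n \<in> carrier ?M" for X Y n
  proof -
    have XY: "X \<oplus>\<^bsub>?N\<^esub> Y = ?q (?rep X \<oplus> ?rep Y)" by (simp add: quot_module_def)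
    have s: "?rep X \<oplus> ?rep Y \<in> carrier R" using repc X Y by simp
    have "?rep (X \<oplus>\<^bsub>?N\<^esub> Y) \<ominus> (?rep X \<oplus> ?rep Y) \<in> L" unfolding XY by (rule coset_rep(2)[OF L s])
    moreover have "?rep (X \<oplus>\<^bsub>?N\<^esub> Y) \<in> carrier R" unfolding XY by (rule coset_rep(1)[OF L s])
    then have "?rep (X \<oplus>\<^bsub>?N\<^esub> Y) \<otimes> n \<ominus> ?rep X \<otimes> n \<ominus> ?rep Y \<otimes> n =
        (?rep (X \<oplus>\<^bsub>?N\<^esub> Y) \<ominus> (?rep X \<oplus> ?rep Y)) \<otimes> n"
      using repc[OF X] repc[OF Y] Vc[of n] n[simplified] by algebra
    ultimately show ?thesis using prodL n by simp
  qed
  have ar: "?rep X \<otimes> (n \<oplus>\<^bsub>?M\<^esub> n') \<ominus> ?rep X \<otimes> n \<ominus> ?rep X \<otimes> n' \<in> ideal_prod R L V"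
    if "X \<in> carrier ?N" "n \<in> carrier ?M" "n' \<in> carrier ?M" for X n n'
  proof -
    have "?rep X \<otimes> (n \<oplus> n') \<ominus> ?rep X \<otimes> n \<ominus> ?rep X \<otimes> n' = \<zero>"
      using repc[OF that(1)] Vc[of n] Vc[of n'] that(2,3)[simplified] by algebra
    then show ?thesis by simp
  qed
  have sm: "?rep (r \<odot>\<^bsub>?N\<^esub> X) \<otimes> n \<ominus> ?rep X \<otimes> (r \<odot>\<^bsub>?M\<^esub> n) \<in> ideal_prod R L V"
    if r: "r \<in> carrier R" and X: "X \<in> carrier ?N" and n: "n \<in> carrier ?M" for r X n
  proof -
    have rX: "r \<odot>\<^bsub>?N\<^esub> X = ?q (r \<otimes> ?rep X)" by (simp add: quot_module_def)
    have s: "r \<otimes> ?rep X \<in> carrier R" using repc X r by simp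
    have "?rep (r \<odot>\<^bsub>?N\<^esub> X) \<ominus> r \<otimes> ?rep X \<in> L" unfolding rX by (rule coset_rep(2)[OF L s])
    moreover have "?rep (r \<odot>\<^bsub>?N\<^esub> X) \<in> carrier R" unfolding rX by (rule coset_rep(1)[OF L s])
    then have "?rep (r \<odot>\<^bsub>?N\<^esub> X) \<otimes> n \<ominus> ?rep X \<otimes> (r \<otimes> n) = (?rep (r \<odot>\<^bsub>?N\<^esub> X) \<ominus> r \<otimes> ?rep X) \<otimes> n"
      using repc[OF X] Vc[of n] n[simplified] r by algebra
    ultimately show ?thesis using prodL n by simp
  qed
  obtain h where h: "(\<forall>z. Poly_Mapping.keys z \<subseteq> carrier ?N \<times> carrier ?M \<longrightarrow> h z \<in> carrier R) \<and>
    (\<forall>X\<in>carrier ?N. \<forall>n\<in>carrier ?M. h (frag_of (X, n)) = ?rep X \<otimes> n) \<and> h 0 = \<zero> \<and>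
    (\<forall>x y. Poly_Mapping.keys x \<subseteq> carrier ?N \<times> carrier ?M \<longrightarrow>
      Poly_Mapping.keys y \<subseteq> carrier ?N \<times> carrier ?M \<longrightarrow>
      h (x + y) = h x \<oplus> h y \<and> h (x - y) = h x \<ominus> h y) \<and>
    (\<forall>z\<in>tensor_rels R ?N ?M. h z \<in> ideal_prod R L V)"
    using tensor_eval[where \<phi> = "\<lambda>X n. ?rep X \<otimes> n", OF N M abelian_group_axioms LV.a_subgroup c al ar sm] ..
  note K' = tensor_rels_closed[OF N' M]
  let ?S = "carrier ?N \<times> V"
  have q'1: "?q' \<one> \<in> carrier ?N'" by (simp add: quot_module_simps[OF PI])
  \<comment> \<open>Every w in JV is, modulo LV, the value of a tensor \<open>z\<close>, and the
    image of \<open>z\<close> in R/vR \<otimes> V is [1] \<otimes> aw. Both are tracked together by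
    induction on the sum of products that represents w.\<close>
  have "\<exists>z. Poly_Mapping.keys z \<subseteq> ?S \<and> h z \<ominus> w \<in> ideal_prod R L V \<and>
      tensor_frag_map f id z - frag_of (?q' \<one>, a \<otimes> w) \<in> tensor_rels R ?N' ?M" if "w \<in> ideal_prod R J V" for w
    using that
  proof induction
    case (prod j n)
    have j: "?q j \<in> carrier ?N" using prod by (simp add: quot_module_simps[OF L])
    have "h (frag_of (?q j, n)) \<ominus> j \<otimes> n = (?rep (?q j) \<ominus> j) \<otimes> n"
    proof -
      have "h (frag_of (?q j, n)) = ?rep (?q j) \<otimes> n" using h j prod by simp
      then show ?thesis using Jc[OF prod(1)] Vc[OF prod(2)] repc[OF j] by (simp add: minus_eq l_distr l_minus)
    qed
    also have "\<dots> \<in> ideal_prod R L V" using prodL coset_rep(2)[OF L Jc[OF prod(1)]] prod(2) by blast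
    finally have 1: "h (frag_of (?q j, n)) \<ominus> j \<otimes> n \<in> ideal_prod R L V" .
    have ja: "j \<otimes> a \<in> carrier R" using Jc prod a by simp
    have "f (?q j) = (j \<otimes> a) \<odot>\<^bsub>?N'\<^esub> ?q' \<one>"
      using ja Jc[OF prod(1)] by (simp add: f_q const_coset_smult[OF PI])
    moreover have "a \<otimes> (j \<otimes> n) = (j \<otimes> a) \<otimes> n" using Jc[OF prod(1)] Vc[OF prod(2)] a by algebra
    ultimately have 2: "tensor_frag_map f id (frag_of (?q j, n)) - frag_of (?q' \<one>, a \<otimes> (j \<otimes> n)) \<in> tensor_rels R ?N' ?M"
      using tensor_rels_smult[OF ja q'1, of n ?M] prod(2) by simp
    show ?case using 1 2 j prod(2) by (intro exI[of _ "frag_of (?q j, n)"]) (simp add: keys_frag_of)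
  next
    case (sum s1 s2)
    then obtain z1 z2 where z1: "Poly_Mapping.keys z1 \<subseteq> ?S" "h z1 \<ominus> s1 \<in> ideal_prod R L V"
        "tensor_frag_map f id z1 - frag_of (?q' \<one>, a \<otimes> s1) \<in> tensor_rels R ?N' ?M"
      and z2: "Poly_Mapping.keys z2 \<subseteq> ?S" "h z2 \<ominus> s2 \<in> ideal_prod R L V"
        "tensor_frag_map f id z2 - frag_of (?q' \<one>, a \<otimes> s2) \<in> tensor_rels R ?N' ?M" by blast
    have s: "s1 \<in> V" "s2 \<in> V" using sum ideal_prod_inter[OF J V] by auto
    have keys: "Poly_Mapping.keys (z1 + z2) \<subseteq> ?S" using z1 z2 keys_add[of z1 z2] by blast
    have hc: "h z1 \<in> carrier R" "h z2 \<in> carrier R" using h z1(1) z2(1) by simp_all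
    have "h (z1 + z2) = h z1 \<oplus> h z2" using h z1(1) z2(1) by simp
    then have "h (z1 + z2) \<ominus> (s1 \<oplus> s2) = (h z1 \<ominus> s1) \<oplus> (h z2 \<ominus> s2)"
      using hc Vc[OF s(1)] Vc[OF s(2)] by (simp add: minus_eq minus_add a_ac)
    then have 1: "h (z1 + z2) \<ominus> (s1 \<oplus> s2) \<in> ideal_prod R L V" using z1(2) z2(2) by simp
    have as: "a \<otimes> s1 \<in> V" "a \<otimes> s2 \<in> V" using s a V.I_l_closed by auto
    have "tensor_frag_map f id (z1 + z2) - frag_of (?q' \<one>, a \<otimes> (s1 \<oplus> s2)) =
      (tensor_frag_map f id z1 - frag_of (?q' \<one>, a \<otimes> s1)) + (tensor_frag_map f id z2 - frag_of (?q' \<one>, a \<otimes> s2))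
      - (frag_of (?q' \<one>, a \<otimes> s1 \<oplus> a \<otimes> s2) - frag_of (?q' \<one>, a \<otimes> s1) - frag_of (?q' \<one>, a \<otimes> s2))"
      using Vc s a by (simp add: r_distr)
    also have "\<dots> \<in> tensor_rels R ?N' ?M"
      using K'(5)[OF K'(3)[OF z1(3) z2(3)] tensor_rels_add_right[OF q'1, of "a \<otimes> s1" ?M "a \<otimes> s2" R]] as
      by simp
    finally show ?case using 1 keys by blast
  qed
  then obtain z where z: "Poly_Mapping.keys z \<subseteq> ?S" "h z \<ominus> y \<in> ideal_prod R L V"
      "tensor_frag_map f id z - frag_of (?q' \<one>, a \<otimes> y) \<in> tensor_rels R ?N' ?M"
    using y by blast
  \<comment> \<open>The coset of \<open>v\<close> is zero in R/vR, so [1] \<otimes> vm = [v]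
    \<otimes> m is of the form [0] \<otimes> m, and that is a relation because 0 + 0 = 0.\<close>
  have "?q' v = ?q' \<zero>" using v cgenideal_self[OF v] by (subst const_coset_eq_iff[OF PI]) (simp_all add: minus_eq)
  then have v1: "v \<odot>\<^bsub>?N'\<^esub> ?q' \<one> = ?q' \<zero>" using v by (simp add: const_coset_smult[OF PI])
  have z0: "?q' \<zero> \<in> carrier ?N'" by (simp add: quot_module_simps[OF PI])
  have "?q' \<zero> \<oplus>\<^bsub>?N'\<^esub> ?q' \<zero> = ?q' \<zero>" by (simp add: const_coset_add[OF PI])
  then have "- frag_of (?q' \<zero>, m) \<in> tensor_rels R ?N' ?M"
    using tensor_rels_add_left[OF z0 z0, of m ?M R] m by simp
  moreover have "frag_of (?q' \<zero>, m) - frag_of (?q' \<one>, a \<otimes> y) \<in> tensor_rels R ?N' ?M"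
    using tensor_rels_smult[OF v q'1, of m ?M] m by (simp add: v1 ay)
  ultimately have "- frag_of (?q' \<zero>, m) - (- frag_of (?q' \<zero>, m) - frag_of (?q' \<zero>, m)
      + (frag_of (?q' \<zero>, m) - frag_of (?q' \<one>, a \<otimes> y))) \<in> tensor_rels R ?N' ?M"
    by (metis K'(3) K'(4) K'(5) diff_conv_add_uminus minus_minus)
  then have 1: "frag_of (?q' \<one>, a \<otimes> y) \<in> tensor_rels R ?N' ?M" by simp
  have "tensor_frag_map f id z \<in> tensor_rels R ?N' ?M"
    using K'(3)[OF z(3) 1] by simp
  then have "z \<in> tensor_rels R ?N ?M"
    using flat_as_moduleD[OF V flat N N' f inj z(1)] by blast
  then have hz: "h z \<in> ideal_prod R L V" using h by blast
  have yc: "y \<in> carrier R" using y ideal_prod_in_carrier[OF J V] by blast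
  have "h z \<ominus> (h z \<ominus> y) \<in> ideal_prod R L V" using hz z(2) by (simp add: minus_eq)
  moreover have "h z \<ominus> (h z \<ominus> y) = y" using LV.Icarr[OF hz] yc by algebra
  ultimately show "y \<in> ideal_prod R L V" by simp
qed

end

section \<open>Local generators from flatness and the criterion for generalized GCD rings\<close>

context cring
begin

text \<open>Start with J = R and impose one colon condition per element of \<open>F\<close>. For
  each g the trivial relation g a = a g is the input, so that a stays in the product with
  \<open>V\<close> while J shrinks to the x with xg in aR.\<close>

lemma flat_imp_mem_colon_prod_finite:
  assumes V: "ideal V R" and flat: "flat_module R (as_module R V)" and a: "a \<in> V"
    and F: "finite F" "F \<subseteq> V"
  shows "\<exists>J. ideal J R \<and> (\<forall>x\<in>J. \<forall>g\<in>F. x \<otimes> g \<in> PIdl a) \<and> a \<in> ideal_prod R J V"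
  using F
proof (induction F)
  case empty
  have "\<one> \<otimes> a \<in> ideal_prod R (carrier R) V" using a by (intro ideal_prod.prod) auto
  then show ?case using oneideal a ideal.Icarr[OF V a] by auto
next
  case (insert g F)
  then obtain J where J: "ideal J R" "\<forall>x\<in>J. \<forall>g\<in>F. x \<otimes> g \<in> PIdl a" "a \<in> ideal_prod R J V" by blast
  have c: "a \<in> carrier R" "g \<in> carrier R" "g \<in> V" using ideal.Icarr[OF V] insert a by auto
  note L = flat_imp_mem_colon_prod[OF V flat J(1) c(2,1) J(3) c(3) m_comm[OF c(2,1)]]
  show ?case using L J(2) by blast
qed

text \<open>For each a in \<open>V\<close> there is an ideal J with a in JV and JV \<subseteq> aR. A
  summand j w = c a of a makes w a local generator of \<open>V\<close>, provided c, cut down by the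
  idempotent of a, lies outside \<open>P\<close>. If no local generator exists, all these
  coefficients lie in \<open>P\<close>, which forces a to be killed by a scalar outside
  \<open>P\<close>. Then finitely many generators, hence all of \<open>V\<close>, are killed by one
  such scalar, and 0 is a local generator after all.\<close>

lemma fg_flat_imp_locally_principal:
  assumes pp: "elementwise_pp R" and fg: "fg_ideal V R" and flat: "flat_module R (as_module R V)"
  shows "locally_principal R V"
  unfolding locally_principal_def
proof (intro allI impI)
  fix P assume P: "primeideal P R"
  interpret P: primeideal P R by fact
  obtain F where F: "finite F" "F \<subseteq> carrier R" "V = Idl F" using fg by (auto simp: fg_ideal_def)
  have V: "ideal V R" using F genideal_ideal by blast
  interpret V: ideal V R by fact
  have Vc: "x \<in> carrier R" if "x \<in> V" for x using that V.Icarr by blast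
  have FV: "F \<subseteq> V" using F genideal_self by blast
  let ?good = "\<lambda>e x. \<forall>y\<in>V. \<exists>k\<in>carrier R. e \<otimes> y = x \<otimes> k"
  show "\<exists>e\<in>carrier R - P. \<exists>x\<in>V. ?good e x"
  proof (rule ccontr)
    assume "\<not> ?thesis"
    then have good: "e \<in> P" if "e \<in> carrier R" "x \<in> V" "?good e x" for e x
      using that by blast
    have kill: "\<exists>z\<in>carrier R - P. z \<otimes> a = \<zero>" if aV: "a \<in> V" for a
    proof -
      note ac = Vc[OF aV]
      obtain t where t: "t \<in> carrier R" "t \<otimes> a = \<zero>"
        and ann: "\<And>z. z \<in> carrier R \<Longrightarrow> z \<otimes> a = \<zero> \<Longrightarrow> (\<one> \<ominus> t) \<otimes> z = \<zero>"
        using elementwise_ppE[OF pp ac] by metis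
      define s where "s = \<one> \<ominus> t"
      have s: "s \<in> carrier R" using t by (simp add: s_def)
      have ann: "s \<otimes> z = \<zero>" if "z \<in> carrier R" "z \<otimes> a = \<zero>" for z using ann that by (simp add: s_def)
      obtain J where J: "ideal J R" "\<forall>x\<in>J. \<forall>g\<in>F. x \<otimes> g \<in> PIdl a" "a \<in> ideal_prod R J V"
        using flat_imp_mem_colon_prod_finite[OF V flat aV F(1) FV] by blast
      have Jc: "x \<in> carrier R" if "x \<in> J" for x using that ideal.Icarr[OF J(1)] by blast
      interpret PI: ideal "PIdl a" R by (rule cgenideal_ideal[OF ac])
      have JV: "x \<otimes> y \<in> PIdl a" if x: "x \<in> J" and y: "y \<in> V" for x y
      proof -
        have "ideal {y \<in> carrier R. x \<otimes> y \<in> PIdl a} R"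
        proof (rule idealI')
          fix b c assume b: "b \<in> {y \<in> carrier R. x \<otimes> y \<in> PIdl a}" and c: "c \<in> carrier R"
          have "x \<otimes> (c \<otimes> b) = c \<otimes> (x \<otimes> b)" using b c Jc[OF x] by (simp add: m_lcomm)
          then show "c \<otimes> b \<in> {y \<in> carrier R. x \<otimes> y \<in> PIdl a}" using b c PI.I_l_closed by simp
          then show "b \<otimes> c \<in> {y \<in> carrier R. x \<otimes> y \<in> PIdl a}" using b c by (simp add: m_comm[of b c])
        qed (use Jc[OF x] in \<open>auto simp: r_distr\<close>)
        moreover have "F \<subseteq> {y \<in> carrier R. x \<otimes> y \<in> PIdl a}" using J(2) x F(2) by blast
        ultimately have "V \<subseteq> {y \<in> carrier R. x \<otimes> y \<in> PIdl a}" unfolding F(3) by (rule genideal_minimal)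
        then show ?thesis using y by blast
      qed
      have "\<exists>c\<in>carrier R. y = a \<otimes> c \<and> s \<otimes> c \<in> P" if "y \<in> ideal_prod R J V" for y
        using that
      proof induction
        case (prod j w)
        note jc = Jc[OF prod(1)] and wc = Vc[OF prod(2)]
        obtain c where c: "c \<in> carrier R" "j \<otimes> w = c \<otimes> a"
          using JV[OF prod] unfolding mem_cgenideal by blast
        \<comment> \<open>From j w = c a and j y = k a follows (cy - kw)a = 0; the factor
          \<open>s\<close> kills annihilators of \<open>a\<close>, so scy = w(sk).\<close>
        have "?good (s \<otimes> c) w"
        proof
          fix y assume y: "y \<in> V"
          note yc = Vc[OF y]
          obtain k where k: "k \<in> carrier R" "j \<otimes> y = k \<otimes> a"
            using JV[OF prod(1) y] unfolding mem_cgenideal by blast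
          have "(c \<otimes> y \<ominus> k \<otimes> w) \<otimes> a = (c \<otimes> a) \<otimes> y \<ominus> (k \<otimes> a) \<otimes> w"
            using c(1) k(1) yc wc ac by algebra
          also have "\<dots> = (j \<otimes> w) \<otimes> y \<ominus> (j \<otimes> y) \<otimes> w" using c k by simp
          also have "\<dots> = \<zero>" using jc wc yc by algebra
          finally have 0: "s \<otimes> (c \<otimes> y \<ominus> k \<otimes> w) = \<zero>" using ann c(1) k(1) yc wc by simp
          have "(s \<otimes> c) \<otimes> y \<ominus> w \<otimes> (s \<otimes> k) = s \<otimes> (c \<otimes> y \<ominus> k \<otimes> w)"
            using c(1) k(1) yc wc s by algebra
          also note 0
          finally have "(s \<otimes> c) \<otimes> y = w \<otimes> (s \<otimes> k)"
            by (rule minus_zero_imp_eq) (use c(1) k(1) yc wc s in simp_all)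
          then show "\<exists>k\<in>carrier R. (s \<otimes> c) \<otimes> y = w \<otimes> k" using s k by blast
        qed
        then have "s \<otimes> c \<in> P" using good[of "s \<otimes> c" w] prod(2) s c(1) by simp
        then show ?case using c ac m_comm by auto
      next
        case (sum y1 y2)
        then obtain c d where c: "c \<in> carrier R" "y1 = a \<otimes> c" "s \<otimes> c \<in> P"
          and d: "d \<in> carrier R" "y2 = a \<otimes> d" "s \<otimes> d \<in> P" by blast
        then have "y1 \<oplus> y2 = a \<otimes> (c \<oplus> d)" "s \<otimes> (c \<oplus> d) \<in> P" using ac s by (simp_all add: r_distr)
        then show ?case using c d by blast
      qed
      \<comment> \<open>Summing the expressions for the products gives a = a c with a total
        coefficient satisfying sc \<in> P. Since s(1 - c) = 0, this puts \<open>s\<close> into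
        \<open>P\<close>, and the complement t = 1 - s, which kills \<open>a\<close>, lies
        outside.\<close>
      then obtain c where c: "c \<in> carrier R" "a = a \<otimes> c" "s \<otimes> c \<in> P" using J(3) by blast
      have "(\<one> \<ominus> c) \<otimes> a = a \<ominus> a \<otimes> c" using c(1) ac by algebra
      also have "\<dots> = \<zero>" using c(2) ac by (simp add: minus_eq r_neg)
      finally have 0: "s \<otimes> (\<one> \<ominus> c) = \<zero>" using ann c(1) by simp
      have "s \<ominus> s \<otimes> c = s \<otimes> (\<one> \<ominus> c)" using s c(1) by algebra
      also note 0
      finally have "s = s \<otimes> c" by (rule minus_zero_imp_eq) (use s c(1) in simp_all)
      then have sP: "s \<in> P" using c by simp
      have "t \<notin> P"
      proof
        assume "t \<in> P"
        then have "s \<oplus> t \<in> P" using sP by simp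
        moreover have "s \<oplus> t = \<one>" using t(1) unfolding s_def by algebra
        ultimately show False using P.one_imp_carrier P.I_notcarr by auto
      qed
      then show ?thesis using t by blast
    qed
    have "\<exists>z\<in>carrier R - P. \<forall>g\<in>G. z \<otimes> g = \<zero>" if "finite G" "G \<subseteq> V" for G
      using that
    proof (induction G)
      case empty
      then show ?case using P.one_imp_carrier P.I_notcarr by auto
    next
      case (insert g G)
      then obtain z where z: "z \<in> carrier R - P" "\<And>g. g \<in> G \<Longrightarrow> z \<otimes> g = \<zero>" by blast
      obtain w where w: "w \<in> carrier R - P" "w \<otimes> g = \<zero>" using kill insert by blast
      have "(z \<otimes> w) \<otimes> h = \<zero>" if h: "h \<in> insert g G" for h
      proof -
        have hc: "h \<in> carrier R" using h insert Vc by blast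
        have "(z \<otimes> w) \<otimes> h = z \<otimes> (w \<otimes> h)" "(z \<otimes> w) \<otimes> h = w \<otimes> (z \<otimes> h)"
          using z(1) w(1) hc by (simp_all add: m_ac)
        then show ?thesis using h z w by auto
      qed
      then show ?case using primeideal_not_mult[OF P z(1) w(1)] by blast
    qed
    then obtain z where z: "z \<in> carrier R - P" "\<forall>g\<in>F. z \<otimes> g = \<zero>" using F(1) FV by blast
    have "ideal {y \<in> carrier R. z \<otimes> y = \<zero>} R"
    proof (rule idealI')
      fix b c assume b: "b \<in> {y \<in> carrier R. z \<otimes> y = \<zero>}" and c: "c \<in> carrier R"
      have "z \<otimes> (c \<otimes> b) = c \<otimes> (z \<otimes> b)" using b c z by (simp add: m_lcomm)
      then show "c \<otimes> b \<in> {y \<in> carrier R. z \<otimes> y = \<zero>}" using b c by simp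
      then show "b \<otimes> c \<in> {y \<in> carrier R. z \<otimes> y = \<zero>}" using b c by (simp add: m_comm[of b c])
    qed (use z in \<open>auto simp: r_distr\<close>)
    moreover have "F \<subseteq> {y \<in> carrier R. z \<otimes> y = \<zero>}" using z F by blast
    ultimately have "V \<subseteq> {y \<in> carrier R. z \<otimes> y = \<zero>}" unfolding F(3) by (rule genideal_minimal)
    then have "?good z \<zero>" by (auto intro!: bexI[of _ \<zero>])
    then show False using good[of z \<zero>] z by simp
  qed
qed

text \<open>The linear quotient by the generator \<open>a\<close> splits the surjection R
  \<rightarrow> aR. A lift of \<open>h\<close> is therefore fixed by a preimage n of h(a): send y to
  \<kappa>(y) n.\<close>

lemma elementwise_pp_imp_projective:
  assumes pp: "elementwise_pp R" and I: "principalideal I R"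
  shows "projective_module R (as_module R I)"
  unfolding projective_module_def
proof (intro conjI allI impI)
  obtain a where a: "a \<in> carrier R" "I = Idl {a}" using principalideal.generate[OF I] by blast
  have I': "ideal I R" using I by (simp add: principalideal_def)
  have aI: "a \<in> I" using a genideal_self'[of a] by simp
  show M: "module R (as_module R I)" by (rule module_as_module[OF I'])
  have "\<exists>k\<in>carrier R. \<one> \<otimes> y = a \<otimes> k" if "y \<in> I" for y
  proof -
    have "y \<in> PIdl a" using that a cgenideal_eq_genideal by simp
    then obtain g where "g \<in> carrier R" "y = g \<otimes> a" unfolding mem_cgenideal by blast
    then show ?thesis using a m_comm by auto
  qed
  then obtain \<kappa> where \<kappa>: "\<kappa> \<in> I \<rightarrow> carrier R" "\<And>y. y \<in> I \<Longrightarrow> \<one> \<otimes> y = \<kappa> y \<otimes> a"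
    "\<And>y z. y \<in> I \<Longrightarrow> z \<in> I \<Longrightarrow> \<kappa> (y \<oplus> z) = \<kappa> y \<oplus> \<kappa> z"
    "\<And>r y. r \<in> carrier R \<Longrightarrow> y \<in> I \<Longrightarrow> \<kappa> (r \<otimes> y) = r \<otimes> \<kappa> y"
    using elementwise_pp_quotient[OF pp a(1) I' one_closed] by metis
  fix N N' :: "('a, ('a \<Rightarrow> 'a) set) module" and g h
  assume *: "module R N \<and> module R N' \<and> g \<in> module_hom R N N' \<and> g ` carrier N = carrier N' \<and>
    h \<in> module_hom R (as_module R I) N'"
  then interpret N: module R N by blast
  have g: "g \<in> module_hom R N N'" and h: "h \<in> module_hom R (as_module R I) N'" using * by auto
  have "h a \<in> g ` carrier N" using * module_homD(4)[OF h] aI by simp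
  then obtain n where n: "n \<in> carrier N" "g n = h a" by force
  define k where "k y = \<kappa> y \<odot>\<^bsub>N\<^esub> n" for y
  have \<kappa>c: "\<kappa> y \<in> carrier R" if "y \<in> I" for y using \<kappa>(1) that by auto
  have "k \<in> module_hom R (as_module R I) N"
    using n \<kappa>c \<kappa>(3,4) by (auto simp: module_hom_def k_def N.smult_l_distr N.smult_assoc1)
  moreover have "g (k x) = h x" if x: "x \<in> I" for x
  proof -
    have "g (k x) = \<kappa> x \<odot>\<^bsub>N'\<^esub> h a" using module_homD(3)[OF g] \<kappa>c[OF x] n by (simp add: k_def)
    also have "\<dots> = h (\<kappa> x \<otimes> a)" using module_homD(3)[OF h] \<kappa>c[OF x] aI by simp
    also have "\<dots> = h x" using \<kappa>(2)[OF x] ideal.Icarr[OF I' x] by simp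
    finally show ?thesis .
  qed
  ultimately show "\<exists>k\<in>module_hom R (as_module R I) N. \<forall>x\<in>carrier (as_module R I). g (k x) = h x"
    by auto
qed

theorem generalized_GCD_ring_iff_locally_principal:
  assumes pp: "elementwise_pp R"
  shows "generalized_GCD_ring R \<longleftrightarrow>
    (\<forall>a\<in>carrier R. \<forall>b\<in>carrier R. locally_principal R (PIdl a \<inter> PIdl b))"
proof
  assume R: "generalized_GCD_ring R"
  have P: "fg_ideal (PIdl a) R \<and> flat_module R (as_module R (PIdl a))" if "a \<in> carrier R" for a
    using that cgenideal_ideal locally_principal_cgenideal locally_principal_imp_fg
      locally_principal_imp_flat[OF pp] by blast
  show "\<forall>a\<in>carrier R. \<forall>b\<in>carrier R. locally_principal R (PIdl a \<inter> PIdl b)"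
    using R P fg_flat_imp_locally_principal[OF pp] unfolding generalized_GCD_ring_def by blast
next
  assume *: "\<forall>a\<in>carrier R. \<forall>b\<in>carrier R. locally_principal R (PIdl a \<inter> PIdl b)"
  have fg: "ideal I R" if "fg_ideal I R" for I using that genideal_ideal by (auto simp: fg_ideal_def)
  have "fg_ideal (I \<inter> J) R \<and> flat_module R (as_module R (I \<inter> J))"
    if I: "fg_ideal I R" "flat_module R (as_module R I)" and J: "fg_ideal J R" "flat_module R (as_module R J)" for I J
  proof -
    have "locally_principal R (I \<inter> J)"
      using locally_principal_Int * fg I J fg_flat_imp_locally_principal[OF pp] by blast
    moreover have "ideal (I \<inter> J) R" using i_intersect fg I J by blast
    ultimately show ?thesis using locally_principal_imp_fg locally_principal_imp_flat[OF pp] by blast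
  qed
  then show "generalized_GCD_ring R"
    unfolding generalized_GCD_ring_def using elementwise_pp_imp_projective[OF pp] is_cring by blast
qed

end

section \<open>Rings that are locally domains\<close>

lemma (in domain) elementwise_pp_domain: "elementwise_pp R"
  unfolding elementwise_pp_def
proof
  fix a assume a: "a \<in> carrier R"
  show "\<exists>x\<in>carrier R. x \<otimes> a = \<zero> \<and> (\<forall>z\<in>carrier R. z \<otimes> a = \<zero> \<longrightarrow> z \<otimes> x = z)"
  proof (cases "a = \<zero>")
    case True
    then show ?thesis by (auto intro!: bexI[of _ \<one>])
  next
    case False
    then have "z = \<zero>" if "z \<in> carrier R" "z \<otimes> a = \<zero>" for z using a integral that by blast
    then show ?thesis using a by (intro bexI[of _ \<zero>]) auto
  qed
qed

text \<open>In the domain obtained by localizing at \<open>P\<close> one of a/1, b/1 is zero, and a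
  fraction x/1 is zero only if some scalar outside \<open>P\<close> kills x.\<close>

lemma (in cring) locally_domain_annihilator:
  assumes loc: "locally_domain R" and a: "a \<in> carrier R" and b: "b \<in> carrier R" and ab: "a \<otimes> b = \<zero>"
    and P: "primeideal P R"
  shows "\<exists>e\<in>carrier R - P. e \<otimes> a = \<zero> \<or> e \<otimes> b = \<zero>"
proof -
  interpret P: primeideal P R by fact
  let ?S = "carrier R - P"
  let ?L = "localization R ?S"
  let ?cl = "\<lambda>x s. frac_rel R ?S `` {(x, s)}"
  interpret L: "domain" ?L using loc P unfolding locally_domain_def by blast
  have 1: "\<one> \<in> ?S" using P.one_imp_carrier P.I_notcarr by auto
  have S: "s \<otimes> t \<in> ?S" if "s \<in> ?S" "t \<in> ?S" for s t using primeideal_not_mult[OF P that] .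
  \<comment> \<open>A numerator killed by a scalar outside \<open>P\<close> gives the zero fraction.
    The two classes are compared member by member, multiplying the witness of one relation by
    \<open>u\<close> to obtain a witness of the other.\<close>
  have zero: "?cl z s = ?cl \<zero> \<one>" if z: "z \<in> carrier R" "s \<in> ?S" and u: "u \<in> ?S" "u \<otimes> z = \<zero>" for z s u
  proof -
    have "((z, s), (y, t)) \<in> frac_rel R ?S \<longleftrightarrow> ((\<zero>, \<one>), (y, t)) \<in> frac_rel R ?S" for y t
    proof
      assume "((z, s), (y, t)) \<in> frac_rel R ?S"
      then obtain w where y: "y \<in> carrier R" "t \<in> ?S" and w: "w \<in> ?S" "w \<otimes> (t \<otimes> z \<ominus> s \<otimes> y) = \<zero>"
        by (auto simp: frac_rel_def)
      have cr: "w \<in> carrier R" "u \<in> carrier R" "t \<in> carrier R" "s \<in> carrier R" using w u y z by auto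
      have "(u \<otimes> w \<otimes> s) \<otimes> (t \<otimes> \<zero> \<ominus> \<one> \<otimes> y) = u \<otimes> (w \<otimes> (t \<otimes> z \<ominus> s \<otimes> y)) \<ominus> w \<otimes> t \<otimes> (u \<otimes> z)"
        using cr y(1) z(1) by algebra
      also have "\<dots> = \<zero>" using w u cr by (simp add: minus_eq)
      finally show "((\<zero>, \<one>), (y, t)) \<in> frac_rel R ?S"
        using S[OF S[OF u(1) w(1)] z(2)] y 1 unfolding frac_rel_def by blast
    next
      assume "((\<zero>, \<one>), (y, t)) \<in> frac_rel R ?S"
      then obtain w where y: "y \<in> carrier R" "t \<in> ?S" and w: "w \<in> ?S" "w \<otimes> (t \<otimes> \<zero> \<ominus> \<one> \<otimes> y) = \<zero>"
        by (auto simp: frac_rel_def)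
      have cr: "w \<in> carrier R" "u \<in> carrier R" "t \<in> carrier R" "s \<in> carrier R" using w u y z by auto
      have "(u \<otimes> w) \<otimes> (t \<otimes> z \<ominus> s \<otimes> y) = u \<otimes> s \<otimes> (w \<otimes> (t \<otimes> \<zero> \<ominus> \<one> \<otimes> y)) \<oplus> w \<otimes> t \<otimes> (u \<otimes> z)"
        using cr y(1) z(1) by algebra
      also have "\<dots> = \<zero>" using w u cr by simp
      finally show "((z, s), (y, t)) \<in> frac_rel R ?S"
        using S[OF u(1) w(1)] y z unfolding frac_rel_def by blast
    qed
    then show ?thesis by auto
  qed
  have "((\<zero>, \<one>), (\<zero>, \<one>)) \<in> frac_rel R ?S"
    unfolding frac_rel_def using 1 by (auto intro!: bexI[of _ \<one>] simp: minus_eq)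
  then have zcl: "(\<zero>, \<one>) \<in> ?cl \<zero> \<one>" by simp
  have frac_self: "((x, \<one>), (x, \<one>)) \<in> frac_rel R ?S" if "x \<in> carrier R" for x
    unfolding frac_rel_def using 1 that by (auto intro!: bexI[of _ \<one>] simp: minus_eq r_neg)
  \<comment> \<open>The product of two classes is a union over all representatives, so the vanishing
    is needed for every choice of them and not just for a/1 and b/1.\<close>
  have prod_zero: "?cl (x \<otimes> y) (s \<otimes> t) = ?cl \<zero> \<one>"
    if x: "((a, \<one>), (x, s)) \<in> frac_rel R ?S" and y: "((b, \<one>), (y, t)) \<in> frac_rel R ?S" for x y s t
  proof -
    obtain w where w: "w \<in> ?S" "w \<otimes> (s \<otimes> a \<ominus> \<one> \<otimes> x) = \<zero>" and xs: "x \<in> carrier R" "s \<in> ?S"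
      using x by (auto simp: frac_rel_def)
    obtain v where v: "v \<in> ?S" "v \<otimes> (t \<otimes> b \<ominus> \<one> \<otimes> y) = \<zero>" and yt: "y \<in> carrier R" "t \<in> ?S"
      using y by (auto simp: frac_rel_def)
    have cr: "w \<in> carrier R" "v \<in> carrier R" "t \<in> carrier R" "s \<in> carrier R" using w v xs yt by auto
    have "(w \<otimes> v) \<otimes> (x \<otimes> y) = w \<otimes> v \<otimes> s \<otimes> t \<otimes> (a \<otimes> b) \<ominus> v \<otimes> y \<otimes> (w \<otimes> (s \<otimes> a \<ominus> \<one> \<otimes> x))
        \<ominus> w \<otimes> s \<otimes> a \<otimes> (v \<otimes> (t \<otimes> b \<ominus> \<one> \<otimes> y))"
      using cr xs(1) yt(1) a b by algebra
    also have "\<dots> = \<zero>" using w v ab cr xs yt a by (simp add: minus_eq)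
    finally show ?thesis using zero[of "x \<otimes> y" "s \<otimes> t" "w \<otimes> v"] S w v xs yt by simp
  qed
  have "(a, \<one>) \<in> ?cl a \<one>" "(b, \<one>) \<in> ?cl b \<one>" using frac_self a b by simp_all
  then have "?cl a \<one> \<otimes>\<^bsub>?L\<^esub> ?cl b \<one> = ?cl \<zero> \<one>"
    unfolding localization_def using prod_zero by (auto simp: split_beta)
  moreover have "\<zero>\<^bsub>?L\<^esub> = ?cl \<zero> \<one>" "?cl a \<one> \<in> carrier ?L" "?cl b \<one> \<in> carrier ?L"
    using a b 1 by (auto simp: localization_def quotient_def)
  ultimately have "?cl a \<one> = ?cl \<zero> \<one> \<or> ?cl b \<one> = ?cl \<zero> \<one>" using L.integral by simp
  moreover have "\<exists>e\<in>?S. e \<otimes> x = \<zero>" if "?cl x \<one> = ?cl \<zero> \<one>" "x \<in> carrier R" for x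
  proof -
    have "((x, \<one>), (\<zero>, \<one>)) \<in> frac_rel R ?S" using zcl that(1) by auto
    then show ?thesis using that(2) by (auto simp: frac_rel_def minus_eq)
  qed
  ultimately show ?thesis using a b by blast
qed

text \<open>Ann(a) + Ann(b) is contained in no prime, hence contains 1; the two summands of 1 are e
  and 1 - e.\<close>

lemma (in cring) locally_domain_split:
  assumes "locally_domain R" and a: "a \<in> carrier R" and b: "b \<in> carrier R" and "a \<otimes> b = \<zero>"
  obtains e where "e \<in> carrier R" "e \<otimes> a = \<zero>" "(\<one> \<ominus> e) \<otimes> b = \<zero>"
proof -
  define Z where "Z = {z \<in> carrier R. \<exists>e f. e \<in> carrier R \<and> f \<in> carrier R \<and> z = e \<oplus> f \<and> e \<otimes> a = \<zero> \<and> f \<otimes> b = \<zero>}"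
  have ZI: "e \<oplus> f \<in> Z" if "e \<in> carrier R" "f \<in> carrier R" "e \<otimes> a = \<zero>" "f \<otimes> b = \<zero>" for e f
    using that unfolding Z_def by blast
  have "\<one> \<in> Z"
  proof (rule ideal_one_closedI)
    show "ideal Z R"
    proof (rule idealI')
      show "\<zero> \<in> Z" using a b by (auto simp: Z_def intro!: exI[of _ \<zero>])
      fix x y assume x: "x \<in> Z"
      then obtain e f where e: "e \<in> carrier R" "f \<in> carrier R" "x = e \<oplus> f" "e \<otimes> a = \<zero>" "f \<otimes> b = \<zero>"
        by (auto simp: Z_def)
      {
        assume y: "y \<in> Z"
        then obtain g h where g: "g \<in> carrier R" "h \<in> carrier R" "y = g \<oplus> h" "g \<otimes> a = \<zero>" "h \<otimes> b = \<zero>"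
          by (auto simp: Z_def)
        have "x \<oplus> y = (e \<oplus> g) \<oplus> (f \<oplus> h)" using e g by (simp add: a_ac)
        then show "x \<oplus> y \<in> Z" using ZI[of "e \<oplus> g" "f \<oplus> h"] e g a b by (simp add: l_distr)
      }
      assume y: "y \<in> carrier R"
      have "y \<otimes> x = y \<otimes> e \<oplus> y \<otimes> f" using e y by (simp add: r_distr)
      then show "y \<otimes> x \<in> Z" using ZI[of "y \<otimes> e" "y \<otimes> f"] e y a b by (simp add: m_assoc)
      then show "x \<otimes> y \<in> Z" using e y by (simp add: m_comm)
    qed (auto simp: Z_def)
    fix P assume "primeideal P R"
    then obtain e where e: "e \<in> carrier R - P" "e \<otimes> a = \<zero> \<or> e \<otimes> b = \<zero>"
      using locally_domain_annihilator[OF assms] by blast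
    then have "e \<in> Z" using ZI[of e \<zero>] ZI[of \<zero> e] a b by auto
    then show "\<exists>e\<in>Z. e \<notin> P" using e by blast
  qed
  then obtain e f where e: "e \<in> carrier R" "f \<in> carrier R" "\<one> = e \<oplus> f" "e \<otimes> a = \<zero>" "f \<otimes> b = \<zero>"
    by (auto simp: Z_def)
  have "(e \<oplus> f) \<ominus> e = f" using e(1,2) by algebra
  then show thesis using that[of e] e by simp
qed

section \<open>Bezout pullbacks\<close>

text \<open>What survives of the square: \<open>R\<close> is a subset \<open>S\<close> of the domain
  \<open>T\<close>, and \<pi> is any surjection onto \<open>A\<close> with kernel cT, so nothing
  depends on the construction of the quotient. The assumption \<open>bezout\<close> is the extension
  condition for the ideal (a, b) in terms of elements: \<open>r\<close> is a unit of
  \<open>T\<close>, and u, v are the generators of U, with uT + vT = T.\<close>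

locale bezout_pullback = T?: "domain" T + A: cring A for T (structure) and A (structure) +
  fixes S :: "'a set" and c :: 'a and \<pi> :: "'a \<Rightarrow> 'c"
  assumes subring: "subring S T" and c: "c \<in> carrier T" "c \<noteq> \<zero>" and C_sub: "PIdl c \<subseteq> S"
    and bezout: "\<And>a b. a \<in> S \<Longrightarrow> b \<in> S \<Longrightarrow> \<exists>r\<in>S. \<exists>s\<in>S. \<exists>u\<in>S. \<exists>v\<in>S.
      \<exists>p\<in>carrier T. \<exists>q\<in>carrier T. \<exists>r'\<in>carrier T.
      r \<otimes> r' = \<one> \<and> r \<otimes> a = s \<otimes> u \<and> r \<otimes> b = s \<otimes> v \<and> u \<otimes> p \<oplus> v \<otimes> q = \<one>"
    and hom: "\<pi> \<in> ring_hom (T\<lparr>carrier := S\<rparr>) A" and surj: "\<pi> ` S = carrier A"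
    and ker: "\<And>x y. x \<in> S \<Longrightarrow> y \<in> S \<Longrightarrow> \<pi> x = \<pi> y \<longleftrightarrow> x \<ominus> y \<in> PIdl c"
begin

section \<open>Arithmetic of the subring and of its ideal C\<close>

abbreviation R where "R \<equiv> T\<lparr>carrier := S\<rparr>"
abbreviation C where "C \<equiv> PIdl c"

sublocale R: "domain" R
  by (rule subring_is_domain[OF subring])

lemma S_closed [simp, intro]:
  "x \<in> S \<Longrightarrow> x \<in> carrier T" "x \<in> S \<Longrightarrow> y \<in> S \<Longrightarrow> x \<oplus> y \<in> S" "x \<in> S \<Longrightarrow> y \<in> S \<Longrightarrow> x \<otimes> y \<in> S"
  "x \<in> S \<Longrightarrow> \<ominus> x \<in> S" "x \<in> S \<Longrightarrow> y \<in> S \<Longrightarrow> x \<ominus> y \<in> S" "\<zero> \<in> S" "\<one> \<in> S"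
  using subringE[OF subring] by (auto simp: minus_eq)

lemma C_closed [simp, intro]:
  "x \<in> C \<Longrightarrow> x \<in> S" "x \<in> C \<Longrightarrow> y \<in> C \<Longrightarrow> x \<oplus> y \<in> C" "x \<in> C \<Longrightarrow> t \<in> carrier T \<Longrightarrow> x \<otimes> t \<in> C"
  "x \<in> C \<Longrightarrow> t \<in> carrier T \<Longrightarrow> t \<otimes> x \<in> C" "x \<in> C \<Longrightarrow> \<ominus> x \<in> C" "x \<in> C \<Longrightarrow> y \<in> C \<Longrightarrow> x \<ominus> y \<in> C"
  "\<zero> \<in> C" "x \<in> C \<Longrightarrow> x \<in> carrier T"
proof -
  interpret C: ideal C T by (rule cgenideal_ideal[OF c(1)])
  show "x \<in> C \<Longrightarrow> x \<in> S" using C_sub by blast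
  show "x \<in> C \<Longrightarrow> y \<in> C \<Longrightarrow> x \<oplus> y \<in> C" "x \<in> C \<Longrightarrow> t \<in> carrier T \<Longrightarrow> x \<otimes> t \<in> C"
    "x \<in> C \<Longrightarrow> t \<in> carrier T \<Longrightarrow> t \<otimes> x \<in> C" "x \<in> C \<Longrightarrow> \<ominus> x \<in> C" "x \<in> C \<Longrightarrow> y \<in> C \<Longrightarrow> x \<ominus> y \<in> C"
    "\<zero> \<in> C" "x \<in> C \<Longrightarrow> x \<in> carrier T"
    by (auto simp: C.I_r_closed C.I_l_closed minus_eq)
qed

lemma pi [simp]:
  "x \<in> S \<Longrightarrow> \<pi> x \<in> carrier A" "x \<in> S \<Longrightarrow> y \<in> S \<Longrightarrow> \<pi> (x \<oplus> y) = \<pi> x \<oplus>\<^bsub>A\<^esub> \<pi> y"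
  "x \<in> S \<Longrightarrow> y \<in> S \<Longrightarrow> \<pi> (x \<otimes> y) = \<pi> x \<otimes>\<^bsub>A\<^esub> \<pi> y" "\<pi> \<one> = \<one>\<^bsub>A\<^esub>"
  using ring_hom_closed[OF hom, of x] ring_hom_add[OF hom, of x y] ring_hom_mult[OF hom, of x y]
    ring_hom_one[OF hom] by auto

lemma pi_zero [simp]: "\<pi> \<zero> = \<zero>\<^bsub>A\<^esub>"
  using pi(2)[of \<zero> \<zero>] pi(1)[of \<zero>] A.add.r_cancel_one by simp

lemma pi_eq_zero_iff: "x \<in> S \<Longrightarrow> \<pi> x = \<zero>\<^bsub>A\<^esub> \<longleftrightarrow> x \<in> C"
  using ker[of x \<zero>] by (simp add: minus_eq)

lemma pi_minus [simp]: "x \<in> S \<Longrightarrow> y \<in> S \<Longrightarrow> \<pi> (x \<ominus> y) = \<pi> x \<ominus>\<^bsub>A\<^esub> \<pi> y"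
proof -
  assume x: "x \<in> S" and y: "y \<in> S"
  have "\<pi> (x \<ominus> y) \<oplus>\<^bsub>A\<^esub> \<pi> y = \<pi> x"
    using pi(2)[of "x \<ominus> y" y] x y by (simp add: minus_eq a_assoc l_neg del: pi)
  then show ?thesis using pi(1)[of "x \<ominus> y"] pi(1)[OF x] pi(1)[OF y] x y
    by (metis A.add.inv_solve_right A.minus_eq S_closed(5))
qed

lemma pi_surj: "X \<in> carrier A \<Longrightarrow> \<exists>x\<in>S. X = \<pi> x"
  using surj by blast

lemma mult_cancel:
  "x \<noteq> \<zero> \<Longrightarrow> x \<otimes> y = x \<otimes> z \<Longrightarrow> x \<in> carrier T \<Longrightarrow> y \<in> carrier T \<Longrightarrow> z \<in> carrier T \<Longrightarrow> y = z"
  using m_lcancel by blast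

lemma c_in: "c \<in> C" "c \<in> S" "t \<in> carrier T \<Longrightarrow> c \<otimes> t \<in> S"
  using cgenideal_self[OF c(1)] by auto

text \<open>For the pair ct, c the relations rct = su and rc = sv force u = vt, and the Bezout
  identity becomes v(tp + q) = 1. So t = (vt)/v with \<open>v\<close> in \<open>S\<close> a unit of
  \<open>T\<close>.\<close>

lemma fraction:
  assumes t: "t \<in> carrier T"
  obtains v v' where "v \<in> S" "v' \<in> carrier T" "v \<otimes> v' = \<one>" "v \<otimes> t \<in> S"
proof -
  obtain r s u v p q r' where *: "r \<in> S" "s \<in> S" "u \<in> S" "v \<in> S" "p \<in> carrier T" "q \<in> carrier T" "r' \<in> carrier T"
    and r: "r \<otimes> r' = \<one>" and ra: "r \<otimes> (c \<otimes> t) = s \<otimes> u" and rb: "r \<otimes> c = s \<otimes> v" and pq: "u \<otimes> p \<oplus> v \<otimes> q = \<one>"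
    using bezout[of "c \<otimes> t" c] c_in t by blast
  have r0: "r \<noteq> \<zero>" using r *(7) by auto
  then have rc0: "r \<otimes> c \<noteq> \<zero>" using c integral *(1) S_closed(1) by blast
  then have s0: "s \<noteq> \<zero>" using rb *(4) by auto
  have "s \<otimes> u = s \<otimes> (v \<otimes> t)"
  proof -
    have "s \<otimes> (v \<otimes> t) = (s \<otimes> v) \<otimes> t" using * t by (simp add: m_assoc)
    also have "\<dots> = r \<otimes> (c \<otimes> t)" using * t c by (simp add: rb[symmetric] m_assoc)
    finally show ?thesis using ra by simp
  qed
  then have u: "u = v \<otimes> t" using mult_cancel[OF s0] * t by simp
  have "v \<otimes> (t \<otimes> p \<oplus> q) = u \<otimes> p \<oplus> v \<otimes> q" using * t by (simp add: u r_distr m_assoc)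
  then have "v \<otimes> (t \<otimes> p \<oplus> q) = \<one>" using pq by simp
  then show thesis using that[of v "t \<otimes> p \<oplus> q"] * t u by simp
qed

text \<open>For the pair a, c cancelling in ra = su and rc = sv gives va = cu, which lies in C. If
  za = tc, then likewise zu = vt, and z = z(up + vq) is a multiple of v in \<open>T\<close>.\<close>

lemma annihilator_mod_C:
  assumes a: "a \<in> S"
  obtains v where "v \<in> S" "v \<otimes> a \<in> C" "\<And>z. z \<in> carrier T \<Longrightarrow> z \<otimes> a \<in> C \<Longrightarrow> \<exists>t\<in>carrier T. z = v \<otimes> t"
proof -
  obtain r s u v p q r' where *: "r \<in> S" "s \<in> S" "u \<in> S" "v \<in> S" "p \<in> carrier T" "q \<in> carrier T" "r' \<in> carrier T"
    and r: "r \<otimes> r' = \<one>" and ra: "r \<otimes> a = s \<otimes> u" and rb: "r \<otimes> c = s \<otimes> v" and pq: "u \<otimes> p \<oplus> v \<otimes> q = \<one>"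
    using bezout[of a c] c_in a by blast
  have r0: "r \<noteq> \<zero>" using r *(7) by auto
  then have rc0: "r \<otimes> c \<noteq> \<zero>" using c integral *(1) S_closed(1) by blast
  then have s0: "s \<noteq> \<zero>" using rb *(4) by auto
  have "r \<otimes> (v \<otimes> a) = v \<otimes> (r \<otimes> a)" using * a by (simp add: m_lcomm)
  also have "\<dots> = (s \<otimes> v) \<otimes> u" using * by (simp add: ra m_ac)
  also have "\<dots> = r \<otimes> (c \<otimes> u)" using * c by (simp add: rb[symmetric] m_assoc)
  finally have "v \<otimes> a = c \<otimes> u" using mult_cancel[OF r0] * c a by simp
  then have va: "v \<otimes> a \<in> C" using c_in *(3) by simp
  have "\<exists>t\<in>carrier T. z = v \<otimes> t" if z: "z \<in> carrier T" "z \<otimes> a \<in> C" for z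
  proof -
    obtain t where t: "t \<in> carrier T" "z \<otimes> a = t \<otimes> c" using z(2) unfolding mem_cgenideal by blast
    have "s \<otimes> (z \<otimes> u) = z \<otimes> (r \<otimes> a)" using * z by (simp add: ra m_lcomm)
    also have "\<dots> = r \<otimes> (t \<otimes> c)" using * z(1) a by (simp add: t(2)[symmetric] m_lcomm)
    also have "\<dots> = (r \<otimes> c) \<otimes> t" using * t(1) c by (simp add: m_ac)
    also have "\<dots> = s \<otimes> (v \<otimes> t)" using * t(1) by (simp add: rb m_assoc)
    finally have zu: "z \<otimes> u = v \<otimes> t" using mult_cancel[OF s0] * z(1) t(1) by simp
    have "z = z \<otimes> (u \<otimes> p \<oplus> v \<otimes> q)" using pq z by simp
    also have "\<dots> = (z \<otimes> u) \<otimes> p \<oplus> v \<otimes> (z \<otimes> q)" using * z(1) by (simp add: r_distr m_ac)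
    also have "\<dots> = v \<otimes> (t \<otimes> p \<oplus> z \<otimes> q)" using * z(1) t(1) by (simp add: zu r_distr m_assoc)
    finally show ?thesis using * z(1) t(1) by blast
  qed
  then show thesis using that[of v] *(4) va by blast
qed

text \<open>The annihilator of a modulo C is generated by \<open>v\<close> only over
  \<open>T\<close>. As the images of a and v multiply to zero, \<open>locally_domain_split\<close>
  gives x in \<open>S\<close> with xa and (1 - x)v in C. The latter suffices for every z = vt,
  because C is an ideal of \<open>T\<close>.\<close>

lemma annihilator_generator:
  assumes loc: "locally_domain A" and a: "a \<in> S"
  obtains x where "x \<in> S" "x \<otimes> a \<in> C" "\<And>z. z \<in> S \<Longrightarrow> z \<otimes> a \<in> C \<Longrightarrow> z \<ominus> z \<otimes> x \<in> C"
proof -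
  obtain v where v: "v \<in> S" "v \<otimes> a \<in> C" and ann: "\<And>z. z \<in> carrier T \<Longrightarrow> z \<otimes> a \<in> C \<Longrightarrow> \<exists>t\<in>carrier T. z = v \<otimes> t"
    using annihilator_mod_C[OF a] by metis
  have "\<pi> a \<otimes>\<^bsub>A\<^esub> \<pi> v = \<zero>\<^bsub>A\<^esub>" using pi_eq_zero_iff[of "v \<otimes> a"] v a A.m_comm by simp
  then obtain e where e: "e \<in> carrier A" "e \<otimes>\<^bsub>A\<^esub> \<pi> a = \<zero>\<^bsub>A\<^esub>" "(\<one>\<^bsub>A\<^esub> \<ominus>\<^bsub>A\<^esub> e) \<otimes>\<^bsub>A\<^esub> \<pi> v = \<zero>\<^bsub>A\<^esub>"
    using A.locally_domain_split[OF loc] v a by (metis pi(1))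
  obtain x where x: "x \<in> S" "e = \<pi> x" using pi_surj e by blast
  have xa: "x \<otimes> a \<in> C" using pi_eq_zero_iff[of "x \<otimes> a"] x a e by simp
  have xv: "(\<one> \<ominus> x) \<otimes> v \<in> C" using pi_eq_zero_iff[of "(\<one> \<ominus> x) \<otimes> v"] x v e by simp
  have "z \<ominus> z \<otimes> x \<in> C" if z: "z \<in> S" "z \<otimes> a \<in> C" for z
  proof -
    obtain t where t: "t \<in> carrier T" "z = v \<otimes> t" using ann z by blast
    have "z \<ominus> z \<otimes> x = ((\<one> \<ominus> x) \<otimes> v) \<otimes> t"
      using S_closed(1)[OF x(1)] S_closed(1)[OF v(1)] t(1) unfolding t(2) by algebra
    then show ?thesis using xv t by simp
  qed
  then show thesis using that[of x] x xa by blast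
qed

lemma elementwise_pp_A:
  assumes loc: "locally_domain A"
  shows "elementwise_pp A"
  unfolding elementwise_pp_def
proof
  fix X assume "X \<in> carrier A"
  then obtain a where a: "a \<in> S" "X = \<pi> a" using pi_surj by blast
  obtain x where x: "x \<in> S" "x \<otimes> a \<in> C" "\<And>z. z \<in> S \<Longrightarrow> z \<otimes> a \<in> C \<Longrightarrow> z \<ominus> z \<otimes> x \<in> C"
    using annihilator_generator[OF loc a(1)] by metis
  have "\<pi> x \<otimes>\<^bsub>A\<^esub> X = \<zero>\<^bsub>A\<^esub>" using x a pi_eq_zero_iff[of "x \<otimes> a"] by simp
  moreover have "Z \<otimes>\<^bsub>A\<^esub> \<pi> x = Z" if Z: "Z \<in> carrier A" "Z \<otimes>\<^bsub>A\<^esub> X = \<zero>\<^bsub>A\<^esub>" for Z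
  proof -
    obtain z where z: "z \<in> S" "Z = \<pi> z" using pi_surj Z by blast
    have "z \<otimes> a \<in> C" using pi_eq_zero_iff[of "z \<otimes> a"] z a Z by simp
    then have "\<pi> z = \<pi> (z \<otimes> x)" using x(3)[OF z(1)] ker[of z "z \<otimes> x"] z x by blast
    then show ?thesis using z x by simp
  qed
  ultimately show "\<exists>Y\<in>carrier A. Y \<otimes>\<^bsub>A\<^esub> X = \<zero>\<^bsub>A\<^esub> \<and> (\<forall>Z\<in>carrier A. Z \<otimes>\<^bsub>A\<^esub> X = \<zero>\<^bsub>A\<^esub> \<longrightarrow> Z \<otimes>\<^bsub>A\<^esub> Y = Z)"
    using x pi(1) by blast
qed

end

lemma (in domain) locally_principal_Int_comaximal:
  assumes c: "u \<in> carrier R" "v \<in> carrier R" "p \<in> carrier R" "q \<in> carrier R" and pq: "u \<otimes> p \<oplus> v \<otimes> q = \<one>"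
  shows "locally_principal R (PIdl u \<inter> PIdl v)"
proof -
  have "PIdl u \<inter> PIdl v = PIdl (u \<otimes> v)"
  proof
    show "PIdl u \<inter> PIdl v \<subseteq> PIdl (u \<otimes> v)"
    proof
      fix y assume "y \<in> PIdl u \<inter> PIdl v"
      then have "y \<in> PIdl u" "y \<in> PIdl v" by auto
      then obtain g h where g: "g \<in> carrier R" "y = g \<otimes> u" and h: "h \<in> carrier R" "y = h \<otimes> v"
        unfolding mem_cgenideal by metis
      have "y = y \<otimes> (u \<otimes> p \<oplus> v \<otimes> q)" using pq g c by simp
      also have "\<dots> = (y \<otimes> u) \<otimes> p \<oplus> (y \<otimes> v) \<otimes> q" using g(1) c by (simp add: g(2) r_distr m_assoc)
      also have "\<dots> = (h \<otimes> v \<otimes> u) \<otimes> p \<oplus> (g \<otimes> u \<otimes> v) \<otimes> q" using g(2) h(2) by simp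
      also have "\<dots> = (h \<otimes> p \<oplus> g \<otimes> q) \<otimes> (u \<otimes> v)" using g(1) h(1) c by algebra
      finally show "y \<in> PIdl (u \<otimes> v)" unfolding mem_cgenideal using g h c by blast
    qed
    show "PIdl (u \<otimes> v) \<subseteq> PIdl u \<inter> PIdl v"
    proof
      fix y assume "y \<in> PIdl (u \<otimes> v)"
      then obtain g where g: "g \<in> carrier R" "y = g \<otimes> (u \<otimes> v)" unfolding mem_cgenideal by blast
      then have "y = (g \<otimes> v) \<otimes> u" "y = (g \<otimes> u) \<otimes> v" using c by (simp_all add: m_ac)
      then show "y \<in> PIdl u \<inter> PIdl v" unfolding Int_iff mem_cgenideal using g c by blast
    qed
  qed
  then show ?thesis using locally_principal_cgenideal c by simp
qed

section \<open>Transfer of the generalized GCD property to T, to A and back to R\<close>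

context bezout_pullback
begin

lemma mem_PIdl_R: "y \<in> PIdl\<^bsub>R\<^esub> a \<longleftrightarrow> (\<exists>g\<in>S. y = g \<otimes> a)"
  unfolding mem_cgenideal by simp

lemma generalized_GCD_ring_T: "generalized_GCD_ring T"
  unfolding T.generalized_GCD_ring_iff_locally_principal[OF T.elementwise_pp_domain]
proof (intro ballI)
  fix a b assume ab: "a \<in> carrier T" "b \<in> carrier T"
  \<comment> \<open>Elements of \<open>T\<close> enter \<open>S\<close> after multiplication by
    \<open>c\<close>; in the domain \<open>T\<close> the combined factor rc can be cancelled
    again.\<close>
  obtain r s u v p q r' where *: "r \<in> S" "s \<in> S" "u \<in> S" "v \<in> S" "p \<in> carrier T" "q \<in> carrier T" "r' \<in> carrier T"
    and r: "r \<otimes> r' = \<one>" and ra: "r \<otimes> (c \<otimes> a) = s \<otimes> u" and rb: "r \<otimes> (c \<otimes> b) = s \<otimes> v" and pq: "u \<otimes> p \<oplus> v \<otimes> q = \<one>"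
    using bezout[of "c \<otimes> a" "c \<otimes> b"] c_in ab by blast
  have r0: "r \<noteq> \<zero>" using r *(7) by auto
  have rc: "z = \<zero>" if "z \<in> carrier T" "(r \<otimes> c) \<otimes> z = \<zero>" for z
    using that r0 c *(1) integral by (metis S_closed(1) m_closed)
  show "locally_principal T (PIdl a \<inter> PIdl b)"
  proof (rule T.locally_principal_Int_cancel[OF T.elementwise_pp_domain _ _ ab _ _ rc])
    show "(r \<otimes> c) \<otimes> a = s \<otimes> u" "(r \<otimes> c) \<otimes> b = s \<otimes> v" using * c ab ra rb by (simp_all add: m_assoc)
    show "locally_principal T (PIdl u \<inter> PIdl v)" using * pq T.locally_principal_Int_comaximal by blast
  qed (use * c in auto)
qed

text \<open>Surjectivity of \<open>uR \<inter> vR \<rightarrow> uA \<inter> vA\<close> for \<open>uT + vT = T\<close>; the point is that \<open>C = uC + vC\<close>.\<close>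

lemma lift_common_multiple:
  assumes uv: "u \<in> S" "v \<in> S" and p: "p \<in> carrier T" "q \<in> carrier T" and pq: "u \<otimes> p \<oplus> v \<otimes> q = \<one>"
    and gh: "g \<in> S" "h \<in> S" "\<pi> g \<otimes>\<^bsub>A\<^esub> \<pi> u = \<pi> h \<otimes>\<^bsub>A\<^esub> \<pi> v"
  obtains g' h' where "g' \<in> S" "h' \<in> S" "g' \<otimes> u = h' \<otimes> v" "\<pi> g' = \<pi> g"
proof -
  define d where "d = g \<otimes> u \<ominus> h \<otimes> v"
  have d: "d \<in> C" using ker[of "g \<otimes> u" "h \<otimes> v"] uv gh by (simp add: d_def)
  have dc: "d \<in> carrier T" using d by blast
  have gc: "g \<in> carrier T" "h \<in> carrier T" "u \<in> carrier T" "v \<in> carrier T" using gh uv by auto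
  have e: "p \<otimes> d \<in> C" "q \<otimes> d \<in> C" using d p by auto
  show thesis
  \<comment> \<open>Since d = u(pd) + v(qd), the defect disappears when pd is taken from g and qd is
    added to h, and both corrections lie in C.\<close>
  proof (rule that[of "g \<ominus> p \<otimes> d" "h \<oplus> q \<otimes> d"])
    show "g \<ominus> p \<otimes> d \<in> S" "h \<oplus> q \<otimes> d \<in> S" using gh e by (meson C_closed(1) S_closed)+
    have "(g \<ominus> p \<otimes> d) \<otimes> u \<ominus> (h \<oplus> q \<otimes> d) \<otimes> v = (g \<otimes> u \<ominus> h \<otimes> v) \<ominus> (u \<otimes> p \<oplus> v \<otimes> q) \<otimes> d"
      using gc p dc by algebra
    also have "\<dots> = d \<ominus> \<one> \<otimes> d" by (simp only: d_def[symmetric] pq)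
    also have "\<dots> = \<zero>" using dc by (simp add: minus_eq r_neg)
    finally show "(g \<ominus> p \<otimes> d) \<otimes> u = (h \<oplus> q \<otimes> d) \<otimes> v"
      by (rule T.minus_zero_imp_eq) (use gc p dc in auto)
    have "(g \<ominus> p \<otimes> d) \<ominus> g = \<ominus> (p \<otimes> d)" using gc(1) p dc by algebra
    then show "\<pi> (g \<ominus> p \<otimes> d) = \<pi> g"
      using ker[of "g \<ominus> p \<otimes> d" g] e gh by (simp add: C_closed(1,5))
  qed
qed

lemma ring_hom_ring_pi: "ring_hom_ring R A \<pi>"
  by (intro ring_hom_ringI2 R.ring_axioms A.ring_axioms hom)

lemma generalized_GCD_ring_imp_A:
  assumes loc: "locally_domain A" and R: "generalized_GCD_ring R"
  shows "generalized_GCD_ring A"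
  unfolding A.generalized_GCD_ring_iff_locally_principal[OF elementwise_pp_A[OF loc]]
proof (intro ballI)
  fix X Y assume "X \<in> carrier A" "Y \<in> carrier A"
  then obtain a b where ab: "a \<in> S" "X = \<pi> a" "b \<in> S" "Y = \<pi> b" using pi_surj by metis
  obtain r s u v p q r' where *: "r \<in> S" "s \<in> S" "u \<in> S" "v \<in> S" "p \<in> carrier T" "q \<in> carrier T" "r' \<in> carrier T"
    and r: "r \<otimes> r' = \<one>" and ra: "r \<otimes> a = s \<otimes> u" and rb: "r \<otimes> b = s \<otimes> v" and pq: "u \<otimes> p \<oplus> v \<otimes> q = \<one>"
    using bezout[OF ab(1,3)] by blast
  have uv: "locally_principal R (PIdl\<^bsub>R\<^esub> u \<inter> PIdl\<^bsub>R\<^esub> v)"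
    using R *(3,4) unfolding R.generalized_GCD_ring_iff_locally_principal[OF R.elementwise_pp_domain] by simp
  have "locally_principal A (PIdl\<^bsub>A\<^esub> \<pi> u \<inter> PIdl\<^bsub>A\<^esub> \<pi> v)"
    unfolding locally_principal_def
  proof (intro allI impI)
    fix P assume P: "primeideal P A"
    \<comment> \<open>A local generator of uR \<inter> vR at the preimage of \<open>P\<close> is
      mapped to one of uA \<inter> vA at \<open>P\<close>, as every common multiple in
      \<open>A\<close> lifts.\<close>
    have P': "primeideal {x \<in> S. \<pi> x \<in> P} R"
      using ring_hom_ring.primeideal_vimage[OF ring_hom_ring_pi R.is_cring P] by simp
    obtain e x where e: "e \<in> carrier R - {x \<in> S. \<pi> x \<in> P}" and x: "x \<in> PIdl\<^bsub>R\<^esub> u \<inter> PIdl\<^bsub>R\<^esub> v"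
      and div: "\<And>y. y \<in> PIdl\<^bsub>R\<^esub> u \<inter> PIdl\<^bsub>R\<^esub> v \<Longrightarrow> \<exists>k\<in>carrier R. e \<otimes>\<^bsub>R\<^esub> y = x \<otimes>\<^bsub>R\<^esub> k"
      using uv P' unfolding locally_principal_def by meson
    have xu: "x \<in> PIdl\<^bsub>R\<^esub> u" "x \<in> PIdl\<^bsub>R\<^esub> v" using x by auto
    obtain g0 where g0: "g0 \<in> S" "x = g0 \<otimes> u" using xu(1) unfolding mem_PIdl_R by blast
    obtain h0 where h0: "h0 \<in> S" "x = h0 \<otimes> v" using xu(2) unfolding mem_PIdl_R by blast
    have xS: "x \<in> S" using g0 * by simp
    have "\<pi> x = \<pi> g0 \<otimes>\<^bsub>A\<^esub> \<pi> u" using g0 * by simp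
    moreover have "\<pi> x = \<pi> h0 \<otimes>\<^bsub>A\<^esub> \<pi> v" using h0 * by simp
    ultimately have xA: "\<pi> x \<in> PIdl\<^bsub>A\<^esub> \<pi> u \<inter> PIdl\<^bsub>A\<^esub> \<pi> v"
      unfolding Int_iff mem_cgenideal using g0(1) h0(1) pi(1) by blast
    have eS: "e \<in> S" "\<pi> e \<in> carrier A - P" using e by auto
    have "\<exists>k\<in>carrier A. \<pi> e \<otimes>\<^bsub>A\<^esub> Z = \<pi> x \<otimes>\<^bsub>A\<^esub> k" if Z: "Z \<in> PIdl\<^bsub>A\<^esub> \<pi> u \<inter> PIdl\<^bsub>A\<^esub> \<pi> v" for Z
    proof -
      have Z12: "Z \<in> PIdl\<^bsub>A\<^esub> \<pi> u" "Z \<in> PIdl\<^bsub>A\<^esub> \<pi> v" using Z by auto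
      obtain g1 where g1: "g1 \<in> carrier A" "Z = g1 \<otimes>\<^bsub>A\<^esub> \<pi> u" using Z12(1) unfolding mem_cgenideal by blast
      obtain h1 where h1: "h1 \<in> carrier A" "Z = h1 \<otimes>\<^bsub>A\<^esub> \<pi> v" using Z12(2) unfolding mem_cgenideal by blast
      obtain g where g: "g \<in> S" "g1 = \<pi> g" using pi_surj[OF g1(1)] by blast
      obtain h where h: "h \<in> S" "h1 = \<pi> h" using pi_surj[OF h1(1)] by blast
      obtain g' h' where g': "g' \<in> S" "h' \<in> S" "g' \<otimes> u = h' \<otimes> v" "\<pi> g' = \<pi> g"
        using lift_common_multiple[OF *(3-6) pq g(1) h(1)] g1 h1 g h by metis
      have "g' \<otimes> u \<in> PIdl\<^bsub>R\<^esub> u \<inter> PIdl\<^bsub>R\<^esub> v" unfolding Int_iff mem_PIdl_R using g' by blast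
      then obtain k where k: "k \<in> S" "e \<otimes> (g' \<otimes> u) = x \<otimes> k" using div by auto
      have "\<pi> (g' \<otimes> u) = Z" using pi(3)[OF g'(1) *(3)] g'(4) g(2) g1(2) by simp
      then have "\<pi> e \<otimes>\<^bsub>A\<^esub> Z = \<pi> (e \<otimes> (g' \<otimes> u))" using pi(3)[OF eS(1), of "g' \<otimes> u"] g'(1) *(3) by simp
      also have "\<dots> = \<pi> x \<otimes>\<^bsub>A\<^esub> \<pi> k" using k xS by simp
      finally show ?thesis using pi(1)[OF k(1)] by blast
    qed
    then show "\<exists>e\<in>carrier A - P. \<exists>x\<in>PIdl\<^bsub>A\<^esub> \<pi> u \<inter> PIdl\<^bsub>A\<^esub> \<pi> v. \<forall>y\<in>PIdl\<^bsub>A\<^esub> \<pi> u \<inter> PIdl\<^bsub>A\<^esub> \<pi> v.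
        \<exists>k\<in>carrier A. e \<otimes>\<^bsub>A\<^esub> y = x \<otimes>\<^bsub>A\<^esub> k"
      using eS xA by blast
  qed
  note uvA = this
  \<comment> \<open>The image of \<open>r\<close> is regular in \<open>A\<close> although its
    inverse r' lies only in \<open>T\<close>: if rz is in C, then so is r'(rz) = z, because C is an
    ideal of \<open>T\<close>.\<close>
  have reg: "Z = \<zero>\<^bsub>A\<^esub>" if Z: "Z \<in> carrier A" "\<pi> r \<otimes>\<^bsub>A\<^esub> Z = \<zero>\<^bsub>A\<^esub>" for Z
  proof -
    obtain z where z: "z \<in> S" "Z = \<pi> z" using pi_surj[OF Z(1)] by blast
    have "r \<otimes> z \<in> C" using pi_eq_zero_iff[of "r \<otimes> z"] z Z *(1) by simp
    then have "r' \<otimes> (r \<otimes> z) \<in> C" using *(7) by blast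
    moreover have "r' \<otimes> (r \<otimes> z) = z" using * z r by (metis S_closed(1) l_one m_assoc m_comm)
    ultimately show ?thesis using pi_eq_zero_iff z by simp
  qed
  have rX: "\<pi> r \<otimes>\<^bsub>A\<^esub> X = \<pi> s \<otimes>\<^bsub>A\<^esub> \<pi> u"
    unfolding ab(2) pi(3)[OF *(1) ab(1), symmetric] pi(3)[OF *(2,3), symmetric] ra ..
  have rY: "\<pi> r \<otimes>\<^bsub>A\<^esub> Y = \<pi> s \<otimes>\<^bsub>A\<^esub> \<pi> v"
    unfolding ab(4) pi(3)[OF *(1) ab(3), symmetric] pi(3)[OF *(2,4), symmetric] rb ..
  have cA: "\<pi> r \<in> carrier A" "\<pi> s \<in> carrier A" "X \<in> carrier A" "Y \<in> carrier A"
    "\<pi> u \<in> carrier A" "\<pi> v \<in> carrier A" using * ab by simp_all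
  show "locally_principal A (PIdl\<^bsub>A\<^esub> X \<inter> PIdl\<^bsub>A\<^esub> Y)"
    by (rule A.locally_principal_Int_cancel[OF elementwise_pp_A[OF loc] cA reg rX rY uvA])
qed

text \<open>Modulo C the element x is the idempotent that generates the annihilator of u, so u and
  xv live on complementary factors. If z kills their sum, it kills both u and, on the factor where u
  vanishes, v; then z = (zu)p + (zv)q is zero modulo C.\<close>

lemma regular_mod_C:
  assumes loc: "locally_domain A" and uv: "u \<in> S" "v \<in> S" and p: "p \<in> carrier T" "q \<in> carrier T"
    and pq: "u \<otimes> p \<oplus> v \<otimes> q = \<one>"
  obtains x where "x \<in> S" "(u \<oplus> x \<otimes> v) \<otimes> p \<oplus> v \<otimes> (q \<ominus> x \<otimes> p) = \<one>"
    "\<And>z. z \<in> carrier T \<Longrightarrow> z \<otimes> (u \<oplus> x \<otimes> v) \<in> C \<Longrightarrow> z \<in> C"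
proof -
  obtain x where x: "x \<in> S" "x \<otimes> u \<in> C" and ann: "\<And>z. z \<in> S \<Longrightarrow> z \<otimes> u \<in> C \<Longrightarrow> z \<ominus> z \<otimes> x \<in> C"
    using annihilator_generator[OF loc uv(1)] by metis
  have cl: "u \<in> carrier T" "v \<in> carrier T" "x \<in> carrier T" using uv x by auto
  have "(u \<oplus> x \<otimes> v) \<otimes> p \<oplus> v \<otimes> (q \<ominus> x \<otimes> p) = u \<otimes> p \<oplus> v \<otimes> q"
    using cl p by algebra
  then have 1: "(u \<oplus> x \<otimes> v) \<otimes> p \<oplus> v \<otimes> (q \<ominus> x \<otimes> p) = \<one>" using pq by simp
  have S: "z \<in> C" if z: "z \<in> S" "z \<otimes> (u \<oplus> x \<otimes> v) \<in> C" for z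
  proof -
    have zc: "z \<in> carrier T" using z by auto
    have x2: "x \<ominus> x \<otimes> x \<in> C" using ann[OF x] .
    have "z \<otimes> u = (\<one> \<ominus> x) \<otimes> (z \<otimes> (u \<oplus> x \<otimes> v)) \<oplus> z \<otimes> (x \<otimes> u) \<ominus> (z \<otimes> v) \<otimes> (x \<ominus> x \<otimes> x)"
      using zc cl by algebra
    also have "\<dots> \<in> C" using z(2) x(2) x2 zc cl by auto
    finally have zu: "z \<otimes> u \<in> C" .
    have "z \<otimes> v = (z \<ominus> z \<otimes> x) \<otimes> v \<oplus> (z \<otimes> (u \<oplus> x \<otimes> v) \<ominus> z \<otimes> u)"
      using zc cl by algebra
    also have "\<dots> \<in> C" using zu z(2) ann[OF z(1) zu] cl by auto
    finally have zv: "z \<otimes> v \<in> C" .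
    have "z = z \<otimes> (u \<otimes> p \<oplus> v \<otimes> q)" using pq zc by simp
    also have "\<dots> = (z \<otimes> u) \<otimes> p \<oplus> (z \<otimes> v) \<otimes> q" using zc cl p by algebra
    also have "\<dots> \<in> C" using zu zv p by auto
    finally show ?thesis .
  qed
  \<comment> \<open>Clearing the denominator of z by a unit of \<open>T\<close> taken from
    \<open>S\<close> extends the regularity from \<open>S\<close> to \<open>T\<close>.\<close>
  have "z \<in> C" if z: "z \<in> carrier T" "z \<otimes> (u \<oplus> x \<otimes> v) \<in> C" for z
  proof -
    obtain w w' where w: "w \<in> S" "w' \<in> carrier T" "w \<otimes> w' = \<one>" "w \<otimes> z \<in> S" using fraction[OF z(1)] by metis
    have wc: "w \<in> carrier T" using w by auto
    have "w \<otimes> (z \<otimes> (u \<oplus> x \<otimes> v)) \<in> C" using z(2) wc by blast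
    then have "(w \<otimes> z) \<otimes> (u \<oplus> x \<otimes> v) \<in> C" using z(1) wc cl by (simp add: m_assoc)
    then have "w' \<otimes> (w \<otimes> z) \<in> C" using S[OF w(4)] w(2) by blast
    moreover have "w' \<otimes> (w \<otimes> z) = (w \<otimes> w') \<otimes> z" using z(1) wc w(2) by algebra
    ultimately show ?thesis using w(3) z(1) by simp
  qed
  then show thesis using that[OF x(1) 1] by blast
qed

text \<open>If \<open>uT + vT = T\<close>, then \<open>uR \<inter> vR = uvW\<close> for the inverse \<open>W\<close> of \<open>uR + vR\<close>, which depends
  only on the ideal \<open>uR + vR\<close>. Choosing generators that are regular modulo \<open>C\<close> makes
  \<open>uA \<inter> vA\<close> isomorphic to the image of \<open>W\<close> in \<open>T / C\<close>.\<close>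

definition inverse_pair :: "'a \<Rightarrow> 'a \<Rightarrow> 'a set"
  where "inverse_pair u v = {t \<in> carrier T. t \<otimes> u \<in> S \<and> t \<otimes> v \<in> S}"

lemma inverse_pair_step:
  assumes "u \<in> S" "v \<in> S" "x \<in> S"
  shows "inverse_pair (u \<oplus> x \<otimes> v) v = inverse_pair u v"
proof -
  have "t \<otimes> (u \<oplus> x \<otimes> v) \<in> S \<longleftrightarrow> t \<otimes> u \<in> S" if t: "t \<in> carrier T" "t \<otimes> v \<in> S" for t
  proof -
    have cl: "u \<in> carrier T" "v \<in> carrier T" "x \<in> carrier T" using assms by auto
    have 1: "t \<otimes> (u \<oplus> x \<otimes> v) = t \<otimes> u \<oplus> x \<otimes> (t \<otimes> v)" using t(1) cl by algebra
    have 2: "t \<otimes> u = t \<otimes> (u \<oplus> x \<otimes> v) \<ominus> x \<otimes> (t \<otimes> v)" using t(1) cl by algebra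
    show ?thesis
    proof
      assume "t \<otimes> (u \<oplus> x \<otimes> v) \<in> S"
      then show "t \<otimes> u \<in> S" unfolding 2 using t(2) assms(3) by blast
    next
      assume "t \<otimes> u \<in> S"
      then show "t \<otimes> (u \<oplus> x \<otimes> v) \<in> S" unfolding 1 using t(2) assms(3) by blast
    qed
  qed
  then show ?thesis unfolding inverse_pair_def by blast
qed

lemma inverse_pair_commute: "inverse_pair u v = inverse_pair v u"
  by (auto simp: inverse_pair_def)

text \<open>The element sought is g/v = h/u. Multiplying g/v by up + vq = 1 and using gu = hv turns
  it into hp + gq, without any division.\<close>

lemma inverse_pairE:
  assumes uv: "u \<in> S" "v \<in> S" and p: "p \<in> carrier T" "q \<in> carrier T" and pq: "u \<otimes> p \<oplus> v \<otimes> q = \<one>"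
    and gh: "g \<in> S" "h \<in> S" "g \<otimes> u = h \<otimes> v"
  obtains w where "w \<in> inverse_pair u v" "g \<otimes> u = (u \<otimes> v) \<otimes> w"
proof -
  define w where "w = h \<otimes> p \<oplus> g \<otimes> q"
  have cl: "u \<in> carrier T" "v \<in> carrier T" "g \<in> carrier T" "h \<in> carrier T" using uv gh by auto
  have w: "w \<in> carrier T" using cl p by (simp add: w_def)
  have "v \<otimes> w = (h \<otimes> v) \<otimes> p \<oplus> v \<otimes> g \<otimes> q" using cl p unfolding w_def by algebra
  also have "\<dots> = g \<otimes> (u \<otimes> p \<oplus> v \<otimes> q)" using cl p unfolding gh(3)[symmetric] by algebra
  finally have vw: "v \<otimes> w = g" using pq cl by simp
  have "u \<otimes> w = u \<otimes> h \<otimes> p \<oplus> (g \<otimes> u) \<otimes> q" using cl p unfolding w_def by algebra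
  also have "\<dots> = h \<otimes> (u \<otimes> p \<oplus> v \<otimes> q)" using cl p unfolding gh(3) by algebra
  finally have uw: "u \<otimes> w = h" using pq cl by simp
  have "w \<in> inverse_pair u v" using w vw uw gh cl by (simp add: inverse_pair_def m_comm)
  moreover have "g \<otimes> u = (u \<otimes> v) \<otimes> w" using vw w cl by (simp add: m_ac)
  ultimately show thesis by (rule that)
qed

text \<open>A local generator of uA \<inter> vA lifts to uvx with x in W. Since u and v are regular
  modulo C, cancelling uv gives ew - xy \<in> C for each w in W with suitable y. The case w = 1
  makes xy0 a scalar of \<open>S\<close> outside \<open>P\<close>; it replaces e, and its square
  absorbs the errors in C.\<close>

lemma inverse_pair_local_regular:
  assumes A: "generalized_GCD_ring A" and loc: "locally_domain A"
    and uv: "u \<in> S" "v \<in> S" and p: "p \<in> carrier T" "q \<in> carrier T" and pq: "u \<otimes> p \<oplus> v \<otimes> q = \<one>"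
    and u_reg: "\<And>z. z \<in> carrier T \<Longrightarrow> z \<otimes> u \<in> C \<Longrightarrow> z \<in> C"
    and v_reg: "\<And>z. z \<in> carrier T \<Longrightarrow> z \<otimes> v \<in> C \<Longrightarrow> z \<in> C"
    and P: "primeideal P R" and CP: "C \<subseteq> P"
  shows "\<exists>e\<in>S - P. \<exists>x\<in>inverse_pair u v. \<forall>w\<in>inverse_pair u v. \<exists>k\<in>S. e \<otimes> w = x \<otimes> k"
proof -
  interpret P: primeideal P R by fact
  have PS: "x \<in> S" if "x \<in> P" for x using P.Icarr that by auto
  have cl: "u \<in> carrier T" "v \<in> carrier T" using uv by auto
  \<comment> \<open>Because \<open>P\<close> contains the kernel C, its image is a prime of
    \<open>A\<close> whose preimage is \<open>P\<close> again.\<close>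
  have pi_mem: "\<pi> x \<in> \<pi> ` P \<longleftrightarrow> x \<in> P" if x: "x \<in> S" for x
  proof
    assume "\<pi> x \<in> \<pi> ` P"
    then obtain y where y: "y \<in> P" "\<pi> x = \<pi> y" by blast
    then have "x \<ominus> y \<in> P" using ker[OF x PS[OF y(1)]] CP by blast
    then have "(x \<ominus> y) \<oplus> y \<in> P" using y(1) P.a_closed by simp
    moreover have "(x \<ominus> y) \<oplus> y = x" using S_closed(1)[OF x] S_closed(1)[OF PS[OF y(1)]] by algebra
    ultimately show "x \<in> P" by simp
  qed simp
  have prime: "primeideal (\<pi> ` P) A"
  proof (rule primeidealI)
    show "ideal (\<pi> ` P) A"
    proof (rule A.idealI')
      show "\<pi> ` P \<subseteq> carrier A" using PS by auto
      show "\<zero>\<^bsub>A\<^esub> \<in> \<pi> ` P" using pi_mem[of \<zero>] P.zero_closed by simp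
      show "a \<oplus>\<^bsub>A\<^esub> b \<in> \<pi> ` P" if ab: "a \<in> \<pi> ` P" "b \<in> \<pi> ` P" for a b
      proof -
        obtain x y where x: "x \<in> P" "a = \<pi> x" and y: "y \<in> P" "b = \<pi> y" using ab by blast
        have "x \<oplus> y \<in> P" using P.a_closed x y by simp
        then have "\<pi> (x \<oplus> y) \<in> \<pi> ` P" by blast
        then show ?thesis using x y PS by simp
      qed
      show 1: "x \<otimes>\<^bsub>A\<^esub> a \<in> \<pi> ` P" if ax: "a \<in> \<pi> ` P" "x \<in> carrier A" for a x
      proof -
        obtain y z where y: "y \<in> P" "a = \<pi> y" and z: "z \<in> S" "x = \<pi> z" using ax pi_surj by blast
        have "z \<otimes> y \<in> P" using P.I_l_closed[of y z] y z by simp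
        then have "\<pi> (z \<otimes> y) \<in> \<pi> ` P" by blast
        then show ?thesis using z y PS by simp
      qed
      show "a \<otimes>\<^bsub>A\<^esub> x \<in> \<pi> ` P" if ax: "a \<in> \<pi> ` P" "x \<in> carrier A" for a x
        using 1[OF ax] A.m_comm[of a x] ax PS by auto
    qed
    show "carrier A \<noteq> \<pi> ` P"
      using pi_mem[of \<one>] P.one_imp_carrier P.I_notcarr A.one_closed by auto
    show "a \<in> \<pi> ` P \<or> b \<in> \<pi> ` P" if ab: "a \<in> carrier A" "b \<in> carrier A" "a \<otimes>\<^bsub>A\<^esub> b \<in> \<pi> ` P" for a b
    proof -
      obtain x where x: "x \<in> S" "a = \<pi> x" using pi_surj ab by blast
      obtain y where y: "y \<in> S" "b = \<pi> y" using pi_surj ab by blast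
      have "x \<otimes> y \<in> P" using ab(3) pi_mem[of "x \<otimes> y"] x y by simp
      then show ?thesis using P.I_prime[of x y] x y by auto
    qed
  qed (rule A.is_cring)
  have "locally_principal A (PIdl\<^bsub>A\<^esub> \<pi> u \<inter> PIdl\<^bsub>A\<^esub> \<pi> v)"
    using A uv unfolding A.generalized_GCD_ring_iff_locally_principal[OF elementwise_pp_A[OF loc]] by simp
  then obtain E X where E: "E \<in> carrier A - \<pi> ` P" and X: "X \<in> PIdl\<^bsub>A\<^esub> \<pi> u \<inter> PIdl\<^bsub>A\<^esub> \<pi> v"
    and div: "\<And>Y. Y \<in> PIdl\<^bsub>A\<^esub> \<pi> u \<inter> PIdl\<^bsub>A\<^esub> \<pi> v \<Longrightarrow> \<exists>k\<in>carrier A. E \<otimes>\<^bsub>A\<^esub> Y = X \<otimes>\<^bsub>A\<^esub> k"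
    using prime unfolding locally_principal_def by meson
  have Ec: "E \<in> carrier A" using E by blast
  obtain e where e: "e \<in> S" "E = \<pi> e" using pi_surj[OF Ec] by blast
  have eP: "e \<notin> P" using E e by auto
  have X12: "X \<in> PIdl\<^bsub>A\<^esub> \<pi> u" "X \<in> PIdl\<^bsub>A\<^esub> \<pi> v" using X by auto
  obtain g1 where g1: "g1 \<in> carrier A" "X = g1 \<otimes>\<^bsub>A\<^esub> \<pi> u" using X12(1) unfolding mem_cgenideal by blast
  obtain h1 where h1: "h1 \<in> carrier A" "X = h1 \<otimes>\<^bsub>A\<^esub> \<pi> v" using X12(2) unfolding mem_cgenideal by blast
  obtain g0 where g0: "g0 \<in> S" "g1 = \<pi> g0" using pi_surj[OF g1(1)] by blast
  obtain h0 where h0: "h0 \<in> S" "h1 = \<pi> h0" using pi_surj[OF h1(1)] by blast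
  obtain g h where g: "g \<in> S" "h \<in> S" "g \<otimes> u = h \<otimes> v" "\<pi> g = \<pi> g0"
    using lift_common_multiple[OF uv p pq g0(1) h0(1)] g1 h1 g0 h0 by metis
  obtain x where x: "x \<in> inverse_pair u v" "g \<otimes> u = (u \<otimes> v) \<otimes> x"
    using inverse_pairE[OF uv p pq g(1-3)] by metis
  have xT: "x \<in> carrier T" using x by (simp add: inverse_pair_def)
  have "\<pi> (g \<otimes> u) = X" using pi(3)[OF g(1) uv(1)] g(4) g0(2) g1(2) by simp
  then have Xx: "X = \<pi> (u \<otimes> v \<otimes> x)" by (simp only: x(2))
  have xuvS: "u \<otimes> v \<otimes> x \<in> S" using g uv by (simp add: x(2)[symmetric])
  have mod: "\<exists>y\<in>S. e \<otimes> w \<ominus> x \<otimes> y \<in> C" if w: "w \<in> inverse_pair u v" for w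
  proof -
    have wT: "w \<in> carrier T" "w \<otimes> u \<in> S" "w \<otimes> v \<in> S" using w by (auto simp: inverse_pair_def)
    have uvw: "u \<otimes> v \<otimes> w = (w \<otimes> v) \<otimes> u" "u \<otimes> v \<otimes> w = (w \<otimes> u) \<otimes> v" using wT(1) cl by algebra+
    then have uvwS: "u \<otimes> v \<otimes> w \<in> S" using wT uv by simp
    have "\<pi> (u \<otimes> v \<otimes> w) = \<pi> (w \<otimes> v) \<otimes>\<^bsub>A\<^esub> \<pi> u" using wT uv by (simp add: uvw(1) del: pi(3)) (simp add: pi(3))
    moreover have "\<pi> (u \<otimes> v \<otimes> w) = \<pi> (w \<otimes> u) \<otimes>\<^bsub>A\<^esub> \<pi> v" using wT uv by (simp add: uvw(2) del: pi(3)) (simp add: pi(3))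
    ultimately have "\<pi> (u \<otimes> v \<otimes> w) \<in> PIdl\<^bsub>A\<^esub> \<pi> u \<inter> PIdl\<^bsub>A\<^esub> \<pi> v"
      unfolding Int_iff mem_cgenideal using wT pi(1) by blast
    then obtain k where k: "k \<in> carrier A" "E \<otimes>\<^bsub>A\<^esub> \<pi> (u \<otimes> v \<otimes> w) = X \<otimes>\<^bsub>A\<^esub> k" using div by blast
    obtain y where y: "y \<in> S" "k = \<pi> y" using pi_surj[OF k(1)] by blast
    have "\<pi> (e \<otimes> (u \<otimes> v \<otimes> w)) = E \<otimes>\<^bsub>A\<^esub> \<pi> (u \<otimes> v \<otimes> w)" using pi(3)[OF e(1) uvwS] e by simp
    also have "\<dots> = \<pi> ((u \<otimes> v \<otimes> x) \<otimes> y)" using pi(3)[OF xuvS y(1)] k y Xx by simp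
    finally have 1: "e \<otimes> (u \<otimes> v \<otimes> w) \<ominus> (u \<otimes> v \<otimes> x) \<otimes> y \<in> C"
      using ker[of "e \<otimes> (u \<otimes> v \<otimes> w)" "(u \<otimes> v \<otimes> x) \<otimes> y"] e xuvS y uvwS by simp
    have ey: "e \<in> carrier T" "y \<in> carrier T" using e y by auto
    have "((e \<otimes> w \<ominus> x \<otimes> y) \<otimes> u) \<otimes> v = e \<otimes> (u \<otimes> v \<otimes> w) \<ominus> (u \<otimes> v \<otimes> x) \<otimes> y"
      using ey cl wT(1) xT by algebra
    also note 1
    finally have "(e \<otimes> w \<ominus> x \<otimes> y) \<otimes> u \<in> C" by (rule v_reg[rotated]) (use ey cl wT xT in simp)
    then have "e \<otimes> w \<ominus> x \<otimes> y \<in> C" by (rule u_reg[rotated]) (use ey wT xT in simp)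
    then show ?thesis using y by blast
  qed
  \<comment> \<open>The element 1 of W produces y0 with e - xy0 in C. As C \<subseteq> P and e
    \<notin> P, the element xy0 of \<open>S\<close> lies outside \<open>P\<close> too.\<close>
  have one: "\<one> \<in> inverse_pair u v" using uv by (simp add: inverse_pair_def)
  obtain y0 where y0: "y0 \<in> S" "e \<otimes> \<one> \<ominus> x \<otimes> y0 \<in> C" using mod[OF one] by blast
  define d0 where "d0 = e \<ominus> x \<otimes> y0"
  have eT: "e \<in> carrier T" "y0 \<in> carrier T" using e y0 by auto
  have d0: "d0 \<in> C" using y0(2) eT by (simp add: d0_def)
  have d0T: "d0 \<in> carrier T" using d0 by blast
  have f: "x \<otimes> y0 = e \<ominus> d0" using eT xT unfolding d0_def by algebra
  have fS: "x \<otimes> y0 \<in> S" unfolding f using e d0 by blast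
  have fP: "x \<otimes> y0 \<notin> P"
  proof
    assume "x \<otimes> y0 \<in> P"
    then have "x \<otimes> y0 \<oplus> d0 \<in> P" using d0 CP P.a_closed by auto
    moreover have "x \<otimes> y0 \<oplus> d0 = e" using eT xT unfolding d0_def by algebra
    ultimately show False using eP by simp
  qed
  have ffP: "(x \<otimes> y0) \<otimes> (x \<otimes> y0) \<in> S - P"
    using R.primeideal_not_mult[OF P, of "x \<otimes> y0" "x \<otimes> y0"] fS fP by simp
  have "\<exists>k\<in>S. ((x \<otimes> y0) \<otimes> (x \<otimes> y0)) \<otimes> w = x \<otimes> k" if w: "w \<in> inverse_pair u v" for w
  proof -
    have wT: "w \<in> carrier T" using w by (simp add: inverse_pair_def)
    obtain y where y: "y \<in> S" "e \<otimes> w \<ominus> x \<otimes> y \<in> C" using mod[OF w] by blast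
    define d where "d = e \<otimes> w \<ominus> x \<otimes> y"
    have d: "d \<in> C" using y by (simp add: d_def)
    have yT: "y \<in> carrier T" "d \<in> carrier T" using y d by auto
    \<comment> \<open>Replacing xy0 by e - d0 and ew by xy + d leaves (xy0)y plus an error in C;
      both lie in \<open>S\<close> although w and x are only in \<open>T\<close>. So this element is
      the quotient of (xy0)(xy0)w by x.\<close>
    have "y0 \<otimes> ((x \<otimes> y0) \<otimes> w) = y0 \<otimes> ((e \<ominus> d0) \<otimes> w)" using f by simp
    also have "\<dots> = (x \<otimes> y0) \<otimes> y \<oplus> y0 \<otimes> (d \<ominus> d0 \<otimes> w)"
      using eT xT wT yT(1) d0T unfolding d_def by algebra
    also have "\<dots> \<in> S"
    proof -
      have "y0 \<otimes> (d \<ominus> d0 \<otimes> w) \<in> C" using d d0 wT eT by blast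
      then show ?thesis using fS y(1) by blast
    qed
    finally have "y0 \<otimes> ((x \<otimes> y0) \<otimes> w) \<in> S" .
    moreover have "((x \<otimes> y0) \<otimes> (x \<otimes> y0)) \<otimes> w = x \<otimes> (y0 \<otimes> ((x \<otimes> y0) \<otimes> w))"
      using xT eT(2) wT by algebra
    ultimately show ?thesis by blast
  qed
  then show ?thesis using ffP x(1) by blast
qed

lemma generalized_GCD_ring_imp_R:
  assumes loc: "locally_domain A" and A: "generalized_GCD_ring A"
  shows "generalized_GCD_ring R"
  unfolding R.generalized_GCD_ring_iff_locally_principal[OF R.elementwise_pp_domain]
proof (intro ballI)
  fix a b assume "a \<in> carrier R" "b \<in> carrier R"
  then have ab: "a \<in> S" "b \<in> S" by auto
  obtain r s u v p q r' where *: "r \<in> S" "s \<in> S" "u \<in> S" "v \<in> S" "p \<in> carrier T" "q \<in> carrier T" "r' \<in> carrier T"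
    and r: "r \<otimes> r' = \<one>" and ra: "r \<otimes> a = s \<otimes> u" and rb: "r \<otimes> b = s \<otimes> v" and pq: "u \<otimes> p \<oplus> v \<otimes> q = \<one>"
    using bezout[OF ab] by blast
  let ?W = "inverse_pair u v"
  have cl: "u \<in> carrier T" "v \<in> carrier T" using * by auto
  have local: "\<exists>e\<in>S - P. \<exists>x\<in>?W. \<forall>w\<in>?W. \<exists>k\<in>S. e \<otimes> w = x \<otimes> k" if P: "primeideal P R" for P
  proof (cases "C \<subseteq> P")
    case True
    \<comment> \<open>The regularization is applied twice with the roles exchanged: u becomes u' = u
      + xv, then v becomes v + x'u'. The second change leaves u' alone, so its regularity persists,
      and W is the same throughout.\<close>
    obtain x where x: "x \<in> S" and pq1: "(u \<oplus> x \<otimes> v) \<otimes> p \<oplus> v \<otimes> (q \<ominus> x \<otimes> p) = \<one>"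
      and reg1: "\<And>z. z \<in> carrier T \<Longrightarrow> z \<otimes> (u \<oplus> x \<otimes> v) \<in> C \<Longrightarrow> z \<in> C"
      using regular_mod_C[OF loc *(3-6) pq] by metis
    define u' q' where "u' = u \<oplus> x \<otimes> v" and "q' = q \<ominus> x \<otimes> p"
    have u': "u' \<in> S" "u' \<in> carrier T" and q': "q' \<in> carrier T" using * x by (auto simp: u'_def q'_def)
    have pq1': "u' \<otimes> p \<oplus> v \<otimes> q' = \<one>" using pq1 by (simp add: u'_def q'_def)
    then have pq2: "v \<otimes> q' \<oplus> u' \<otimes> p = \<one>" using u' q' cl *(5) by (simp add: a_comm)
    obtain x' where x': "x' \<in> S" and pq3: "(v \<oplus> x' \<otimes> u') \<otimes> q' \<oplus> u' \<otimes> (p \<ominus> x' \<otimes> q') = \<one>"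
      and reg2: "\<And>z. z \<in> carrier T \<Longrightarrow> z \<otimes> (v \<oplus> x' \<otimes> u') \<in> C \<Longrightarrow> z \<in> C"
      using regular_mod_C[OF loc *(4) u'(1) q' *(5) pq2] by metis
    have "inverse_pair (v \<oplus> x' \<otimes> u') u' = inverse_pair v u'" by (rule inverse_pair_step[OF *(4) u'(1) x'])
    also have "\<dots> = inverse_pair u' v" by (rule inverse_pair_commute)
    also have "\<dots> = ?W" unfolding u'_def by (rule inverse_pair_step[OF *(3,4) x])
    finally have W: "inverse_pair (v \<oplus> x' \<otimes> u') u' = ?W" .
    have v': "v \<oplus> x' \<otimes> u' \<in> S" using *(4) x' u'(1) by simp
    have "x' \<in> carrier T" using x' by simp
    then have p': "p \<ominus> x' \<otimes> q' \<in> carrier T" using *(5) q' by (intro minus_closed m_closed)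
    have reg1': "z \<in> C" if "z \<in> carrier T" "z \<otimes> u' \<in> C" for z using reg1[OF that(1)] that(2) unfolding u'_def .
    have "\<exists>e\<in>S - P. \<exists>x\<in>inverse_pair (v \<oplus> x' \<otimes> u') u'. \<forall>w\<in>inverse_pair (v \<oplus> x' \<otimes> u') u'.
        \<exists>k\<in>S. e \<otimes> w = x \<otimes> k"
      by (rule inverse_pair_local_regular[OF A loc v' u'(1) q' p' pq3 reg2 reg1' P True])
    then show ?thesis unfolding W .
  next
    case False
    \<comment> \<open>At a prime that does not contain C, an element d of C outside it carries all
      of W into C, hence into \<open>S\<close>; so 1 is a local generator.\<close>
    then obtain d where d: "d \<in> C" "d \<notin> P" by blast
    have "\<one> \<in> ?W" using * by (simp add: inverse_pair_def)
    moreover have "\<exists>k\<in>S. d \<otimes> w = \<one> \<otimes> k" if "w \<in> ?W" for w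
    proof -
      have "w \<in> carrier T" using that by (simp add: inverse_pair_def)
      then have "d \<otimes> w \<in> C" using d by blast
      then show ?thesis by auto
    qed
    ultimately show ?thesis using d by blast
  qed
  \<comment> \<open>Multiplication by uv is a bijection from W to uR \<inter> vR, so the local
    generator x of W becomes uvx.\<close>
  have uv: "locally_principal R (PIdl\<^bsub>R\<^esub> u \<inter> PIdl\<^bsub>R\<^esub> v)"
    unfolding locally_principal_def
  proof (intro allI impI)
    fix P assume P: "primeideal P R"
    obtain e x where e: "e \<in> S - P" and x: "x \<in> ?W" and div: "\<forall>w\<in>?W. \<exists>k\<in>S. e \<otimes> w = x \<otimes> k"
      using local[OF P] by blast
    have xT: "x \<in> carrier T" "x \<otimes> u \<in> S" "x \<otimes> v \<in> S" using x by (auto simp: inverse_pair_def)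
    have "u \<otimes> v \<otimes> x = (x \<otimes> v) \<otimes> u" "u \<otimes> v \<otimes> x = (x \<otimes> u) \<otimes> v" using cl xT(1) by algebra+
    then have "u \<otimes> v \<otimes> x \<in> PIdl\<^bsub>R\<^esub> u \<inter> PIdl\<^bsub>R\<^esub> v" unfolding Int_iff mem_PIdl_R using xT by blast
    moreover have "\<exists>k\<in>S. e \<otimes> y = (u \<otimes> v \<otimes> x) \<otimes> k" if y: "y \<in> PIdl\<^bsub>R\<^esub> u \<inter> PIdl\<^bsub>R\<^esub> v" for y
    proof -
      have y12: "y \<in> PIdl\<^bsub>R\<^esub> u" "y \<in> PIdl\<^bsub>R\<^esub> v" using y by auto
      obtain g where g: "g \<in> S" "y = g \<otimes> u" using y12(1) unfolding mem_PIdl_R by blast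
      obtain h where h: "h \<in> S" "y = h \<otimes> v" using y12(2) unfolding mem_PIdl_R by blast
      have gh: "g \<otimes> u = h \<otimes> v" using g h by simp
      obtain w where w: "w \<in> ?W" "g \<otimes> u = (u \<otimes> v) \<otimes> w"
        using inverse_pairE[OF *(3-6) pq g(1) h(1) gh] by metis
      have wT: "w \<in> carrier T" using w by (simp add: inverse_pair_def)
      obtain k where k: "k \<in> S" "e \<otimes> w = x \<otimes> k" using div w by blast
      have eT: "e \<in> carrier T" "k \<in> carrier T" using e k by auto
      have "e \<otimes> y = (u \<otimes> v) \<otimes> (e \<otimes> w)" using g w eT cl wT by (simp add: m_lcomm)
      also have "\<dots> = (u \<otimes> v \<otimes> x) \<otimes> k" using k eT cl xT by (simp add: m_assoc)
      finally show ?thesis using k by blast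
    qed
    ultimately show "\<exists>e\<in>carrier R - P. \<exists>x\<in>PIdl\<^bsub>R\<^esub> u \<inter> PIdl\<^bsub>R\<^esub> v. \<forall>y\<in>PIdl\<^bsub>R\<^esub> u \<inter> PIdl\<^bsub>R\<^esub> v.
        \<exists>k\<in>carrier R. e \<otimes>\<^bsub>R\<^esub> y = x \<otimes>\<^bsub>R\<^esub> k"
      using e by auto
  qed
  have r0: "r \<noteq> \<zero>" using r *(7) by auto
  have reg: "z = \<zero>\<^bsub>R\<^esub>" if "z \<in> carrier R" "r \<otimes>\<^bsub>R\<^esub> z = \<zero>\<^bsub>R\<^esub>" for z
    using R.integral[OF that(2) _ that(1)] r0 *(1) by simp
  have cR: "r \<in> carrier R" "s \<in> carrier R" "a \<in> carrier R" "b \<in> carrier R" "u \<in> carrier R" "v \<in> carrier R"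
    using * ab by simp_all
  have rR: "r \<otimes>\<^bsub>R\<^esub> a = s \<otimes>\<^bsub>R\<^esub> u" "r \<otimes>\<^bsub>R\<^esub> b = s \<otimes>\<^bsub>R\<^esub> v"
    using ra rb by simp_all
  show "locally_principal R (PIdl\<^bsub>R\<^esub> a \<inter> PIdl\<^bsub>R\<^esub> b)"
    by (rule R.locally_principal_Int_cancel[OF R.elementwise_pp_domain cR reg rR uv])
qed

end

section \<open>Regular conductor squares\<close>

text \<open>The preimages u, v of ra, rb under multiplication by \<open>s\<close> satisfy U
  \<subseteq> uT + vT: for w in U the element sw lies in r(aT + bT) = s(uT + vT), and s can be
  cancelled in \<open>T\<close>. Then UT = T gives the Bezout identity.\<close>

lemma extension_conditionE:
  fixes R T :: "'a ring"
  assumes T: "cring T" and sub: "subring (carrier R) T" and R: "R = T\<lparr>carrier := carrier R\<rparr>"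
    and d: "non_zero_divisor d T" "\<And>x. x \<in> carrier T \<Longrightarrow> d \<otimes>\<^bsub>T\<^esub> x \<in> carrier R"
    and ab: "a \<in> carrier R" "b \<in> carrier R" and ext: "extension_condition R T (Idl\<^bsub>R\<^esub> {a, b})"
  obtains r s u v p q r' where "r \<in> carrier R" "s \<in> carrier R" "u \<in> carrier R" "v \<in> carrier R"
    "p \<in> carrier T" "q \<in> carrier T" "r' \<in> carrier T" "r \<otimes>\<^bsub>T\<^esub> r' = \<one>\<^bsub>T\<^esub>"
    "r \<otimes>\<^bsub>T\<^esub> a = s \<otimes>\<^bsub>T\<^esub> u" "r \<otimes>\<^bsub>T\<^esub> b = s \<otimes>\<^bsub>T\<^esub> v"
    "u \<otimes>\<^bsub>T\<^esub> p \<oplus>\<^bsub>T\<^esub> v \<otimes>\<^bsub>T\<^esub> q = \<one>\<^bsub>T\<^esub>"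
    "\<And>x. x \<in> carrier T \<Longrightarrow> s \<otimes>\<^bsub>T\<^esub> x = \<zero>\<^bsub>T\<^esub> \<Longrightarrow> x = \<zero>\<^bsub>T\<^esub>"
proof -
  interpret T: cring T by fact
  have "subcring (carrier R) T" using T.subcringI' sub by blast
  then have "cring (T\<lparr>carrier := carrier R\<rparr>)" using T.subcring_iff sub subringE(1) by blast
  then interpret R: cring R using R by simp
  have R_simps: "mult R = mult T" "add R = add T" "\<zero>\<^bsub>R\<^esub> = \<zero>\<^bsub>T\<^esub>" "\<one>\<^bsub>R\<^esub> = \<one>\<^bsub>T\<^esub>"
    by (subst R, simp)+
  have RT: "x \<in> carrier T" if "x \<in> carrier R" for x using that subringE(1)[OF sub] by blast
  have dT: "d \<in> carrier T" using d by (simp add: non_zero_divisor_def)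
  have d_reg: "x = \<zero>\<^bsub>T\<^esub>" if "x \<in> carrier T" "d \<otimes>\<^bsub>T\<^esub> x = \<zero>\<^bsub>T\<^esub>" for x
    using d(1) that by (simp add: non_zero_divisor_def)
  let ?I = "Idl\<^bsub>R\<^esub> {a, b}"
  obtain r s U where r: "r \<in> carrier R" and s: "s \<in> carrier R" and U: "ideal U R"
    and UT: "Idl\<^bsub>T\<^esub> U = carrier T" and rT: "r <#\<^bsub>T\<^esub> carrier T = carrier T"
    and rI: "r <#\<^bsub>R\<^esub> ?I = s <#\<^bsub>R\<^esub> U"
    and iso: "(\<lambda>x. s \<otimes>\<^bsub>R\<^esub> x) \<in> module_iso R (as_module R U) (as_module R (s <#\<^bsub>R\<^esub> U))"
    using ext unfolding extension_condition_def by blast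
  have UR: "x \<in> carrier R" if "x \<in> U" for x using ideal.Icarr[OF U that] .
  have UT': "x \<in> carrier T" if "x \<in> U" for x using UR[OF that] RT by blast
  have "inj_on (\<lambda>x. s \<otimes>\<^bsub>R\<^esub> x) U" using iso unfolding module_iso_def bij_betw_def by simp
  then have inj: "x = y" if "x \<in> U" "y \<in> U" "s \<otimes>\<^bsub>T\<^esub> x = s \<otimes>\<^bsub>T\<^esub> y" for x y
    unfolding R_simps(1) using that(3) that(1,2) by (rule inj_onD)
  have "\<one>\<^bsub>T\<^esub> \<in> r <#\<^bsub>T\<^esub> carrier T" using rT by simp
  then obtain r' where r': "r' \<in> carrier T" "r \<otimes>\<^bsub>T\<^esub> r' = \<one>\<^bsub>T\<^esub>"
    unfolding l_coset_def by auto
  have kill: "x = \<zero>\<^bsub>T\<^esub>" if x: "x \<in> carrier T" and "\<And>u. u \<in> U \<Longrightarrow> u \<otimes>\<^bsub>T\<^esub> x = \<zero>\<^bsub>T\<^esub>" for x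
  proof -
    have "ideal {t \<in> carrier T. t \<otimes>\<^bsub>T\<^esub> x = \<zero>\<^bsub>T\<^esub>} T"
    proof (rule T.idealI')
      fix t y assume t: "t \<in> {t \<in> carrier T. t \<otimes>\<^bsub>T\<^esub> x = \<zero>\<^bsub>T\<^esub>}" and y: "y \<in> carrier T"
      show "y \<otimes>\<^bsub>T\<^esub> t \<in> {t \<in> carrier T. t \<otimes>\<^bsub>T\<^esub> x = \<zero>\<^bsub>T\<^esub>}" using t y x by (simp add: T.m_assoc)
      then show "t \<otimes>\<^bsub>T\<^esub> y \<in> {t \<in> carrier T. t \<otimes>\<^bsub>T\<^esub> x = \<zero>\<^bsub>T\<^esub>}" using t y by (simp add: T.m_comm[of t y])
    qed (use x in \<open>auto simp: T.l_distr\<close>)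
    moreover have "U \<subseteq> {t \<in> carrier T. t \<otimes>\<^bsub>T\<^esub> x = \<zero>\<^bsub>T\<^esub>}" using that UT' by blast
    ultimately have "carrier T \<subseteq> {t \<in> carrier T. t \<otimes>\<^bsub>T\<^esub> x = \<zero>\<^bsub>T\<^esub>}"
      using T.genideal_minimal UT by metis
    then have "\<one>\<^bsub>T\<^esub> \<otimes>\<^bsub>T\<^esub> x = \<zero>\<^bsub>T\<^esub>" by blast
    then show ?thesis using x by simp
  qed
  \<comment> \<open>Multiplication by \<open>s\<close> is known to be injective only on
    \<open>U\<close>. If sx = 0, then u(dx) lies in \<open>U\<close> for each u in \<open>U\<close>,
    since \<open>d\<close> carries x into \<open>R\<close>; injectivity gives u(dx) = 0. As UT = T,
    also dx = 0, and \<open>d\<close> is regular.\<close>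
  have s_reg: "x = \<zero>\<^bsub>T\<^esub>" if x: "x \<in> carrier T" "s \<otimes>\<^bsub>T\<^esub> x = \<zero>\<^bsub>T\<^esub>" for x
  proof -
    have "u \<otimes>\<^bsub>T\<^esub> (d \<otimes>\<^bsub>T\<^esub> x) = \<zero>\<^bsub>T\<^esub>" if u: "u \<in> U" for u
    proof (rule inj)
      show "u \<otimes>\<^bsub>T\<^esub> (d \<otimes>\<^bsub>T\<^esub> x) \<in> U" using ideal.I_r_closed[OF U u d(2)[OF x(1)]] R_simps by simp
      show "\<zero>\<^bsub>T\<^esub> \<in> U" using additive_subgroup.zero_closed[OF ideal.axioms(1)[OF U]] R_simps by simp
      have "s \<otimes>\<^bsub>T\<^esub> (u \<otimes>\<^bsub>T\<^esub> (d \<otimes>\<^bsub>T\<^esub> x)) = u \<otimes>\<^bsub>T\<^esub> d \<otimes>\<^bsub>T\<^esub> (s \<otimes>\<^bsub>T\<^esub> x)"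
        using RT[OF s] UT'[OF u] dT x(1) by (simp add: T.m_ac)
      then show "s \<otimes>\<^bsub>T\<^esub> (u \<otimes>\<^bsub>T\<^esub> (d \<otimes>\<^bsub>T\<^esub> x)) = s \<otimes>\<^bsub>T\<^esub> \<zero>\<^bsub>T\<^esub>"
        using x(2) RT[OF s] UT'[OF u] dT by simp
    qed
    then have "d \<otimes>\<^bsub>T\<^esub> x = \<zero>\<^bsub>T\<^esub>" using kill[of "d \<otimes>\<^bsub>T\<^esub> x"] dT x(1) by simp
    then show ?thesis using d_reg x(1) by blast
  qed
  have mem: "\<exists>u\<in>U. r \<otimes>\<^bsub>T\<^esub> x = s \<otimes>\<^bsub>T\<^esub> u" if "x \<in> ?I" for x
  proof -
    have "r \<otimes>\<^bsub>T\<^esub> x \<in> r <#\<^bsub>R\<^esub> ?I" using that R_simps unfolding l_coset_def by auto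
    then have "r \<otimes>\<^bsub>T\<^esub> x \<in> s <#\<^bsub>R\<^esub> U" unfolding rI .
    then show ?thesis unfolding l_coset_def R_simps by blast
  qed
  have abI: "a \<in> ?I" "b \<in> ?I" using R.genideal_self[of "{a, b}"] ab by auto
  obtain u where u: "u \<in> U" "r \<otimes>\<^bsub>T\<^esub> a = s \<otimes>\<^bsub>T\<^esub> u" using mem[OF abI(1)] by blast
  obtain v where v: "v \<in> U" "r \<otimes>\<^bsub>T\<^esub> b = s \<otimes>\<^bsub>T\<^esub> v" using mem[OF abI(2)] by blast
  note cl = RT[OF r] RT[OF s] UT'[OF u(1)] UT'[OF v(1)] RT[OF ab(1)] RT[OF ab(2)]
  let ?L = "\<lambda>x y. {t \<in> carrier T. \<exists>p\<in>carrier T. \<exists>q\<in>carrier T. t = x \<otimes>\<^bsub>T\<^esub> p \<oplus>\<^bsub>T\<^esub> y \<otimes>\<^bsub>T\<^esub> q}"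
  have L: "ideal (?L x y) T" if xy: "x \<in> carrier T" "y \<in> carrier T" for x y
  proof (rule T.idealI')
    show "\<zero>\<^bsub>T\<^esub> \<in> ?L x y" using xy by (auto intro!: bexI[of _ "\<zero>\<^bsub>T\<^esub>"])
    fix t t' assume t: "t \<in> ?L x y"
    then obtain p q where p: "p \<in> carrier T" "q \<in> carrier T" "t = x \<otimes>\<^bsub>T\<^esub> p \<oplus>\<^bsub>T\<^esub> y \<otimes>\<^bsub>T\<^esub> q" by blast
    {
      assume "t' \<in> ?L x y"
      then obtain p' q' where p': "p' \<in> carrier T" "q' \<in> carrier T" "t' = x \<otimes>\<^bsub>T\<^esub> p' \<oplus>\<^bsub>T\<^esub> y \<otimes>\<^bsub>T\<^esub> q'" by blast
      have "t \<oplus>\<^bsub>T\<^esub> t' = x \<otimes>\<^bsub>T\<^esub> (p \<oplus>\<^bsub>T\<^esub> p') \<oplus>\<^bsub>T\<^esub> y \<otimes>\<^bsub>T\<^esub> (q \<oplus>\<^bsub>T\<^esub> q')"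
        using p(1,2) p'(1,2) xy unfolding p(3) p'(3) by (simp add: T.r_distr T.a_ac)
      moreover have "t \<oplus>\<^bsub>T\<^esub> t' \<in> carrier T" using p p' xy by simp
      ultimately show "t \<oplus>\<^bsub>T\<^esub> t' \<in> ?L x y" using p(1,2) p'(1,2) by blast
    }
    assume t': "t' \<in> carrier T"
    have "t' \<otimes>\<^bsub>T\<^esub> t = x \<otimes>\<^bsub>T\<^esub> (t' \<otimes>\<^bsub>T\<^esub> p) \<oplus>\<^bsub>T\<^esub> y \<otimes>\<^bsub>T\<^esub> (t' \<otimes>\<^bsub>T\<^esub> q)"
      using p(1,2) t' xy unfolding p(3) by (simp add: T.r_distr T.m_lcomm)
    moreover have "t' \<otimes>\<^bsub>T\<^esub> t \<in> carrier T" using p t' xy by simp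
    ultimately show "t' \<otimes>\<^bsub>T\<^esub> t \<in> ?L x y" using p(1,2) t' by blast
    then show "t \<otimes>\<^bsub>T\<^esub> t' \<in> ?L x y" using t t' T.m_comm[of t t'] by simp
  qed auto
  have gens: "x \<in> ?L x y" "y \<in> ?L x y" if xy: "x \<in> carrier T" "y \<in> carrier T" for x y
  proof -
    have "x = x \<otimes>\<^bsub>T\<^esub> \<one>\<^bsub>T\<^esub> \<oplus>\<^bsub>T\<^esub> y \<otimes>\<^bsub>T\<^esub> \<zero>\<^bsub>T\<^esub>" "y = x \<otimes>\<^bsub>T\<^esub> \<zero>\<^bsub>T\<^esub> \<oplus>\<^bsub>T\<^esub> y \<otimes>\<^bsub>T\<^esub> \<one>\<^bsub>T\<^esub>" using xy by simp_all
    then show "x \<in> ?L x y" "y \<in> ?L x y" using xy by blast+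
  qed
  \<comment> \<open>Coefficients in \<open>T\<close> are all that is needed, so the ideal (a, b) of
    \<open>R\<close> is bounded by aT + bT.\<close>
  have "ideal (carrier R \<inter> ?L a b) R"
  proof (rule R.idealI')
    interpret L: ideal "?L a b" T using L ab RT by blast
    show "\<zero>\<^bsub>R\<^esub> \<in> carrier R \<inter> ?L a b" using R.zero_closed L.zero_closed unfolding R_simps by blast
    fix x y assume x: "x \<in> carrier R \<inter> ?L a b"
    show "x \<oplus>\<^bsub>R\<^esub> y \<in> carrier R \<inter> ?L a b" if "y \<in> carrier R \<inter> ?L a b"
      using x that R.a_closed[of x y] L.a_closed[of x y] unfolding R_simps by blast
    show "y \<otimes>\<^bsub>R\<^esub> x \<in> carrier R \<inter> ?L a b" if "y \<in> carrier R"
      using x RT[OF that] that R.m_closed[of y x] L.I_l_closed[of x y] unfolding R_simps by blast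
    show "x \<otimes>\<^bsub>R\<^esub> y \<in> carrier R \<inter> ?L a b" if "y \<in> carrier R"
      using x RT[OF that] that R.m_closed[of x y] L.I_r_closed[of x y] unfolding R_simps by blast
  qed auto
  moreover have "{a, b} \<subseteq> carrier R \<inter> ?L a b" using gens[OF cl(5,6)] ab by simp
  ultimately have I_sub: "?I \<subseteq> carrier R \<inter> ?L a b" by (rule R.genideal_minimal)
  have "U \<subseteq> ?L u v"
  proof
    fix w assume w: "w \<in> U"
    have "s \<otimes>\<^bsub>T\<^esub> w \<in> r <#\<^bsub>R\<^esub> ?I" unfolding rI using w unfolding l_coset_def R_simps by blast
    then obtain i where i: "i \<in> ?I" "s \<otimes>\<^bsub>T\<^esub> w = r \<otimes>\<^bsub>T\<^esub> i" unfolding l_coset_def R_simps by blast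
    obtain p q where p: "p \<in> carrier T" "q \<in> carrier T" "i = a \<otimes>\<^bsub>T\<^esub> p \<oplus>\<^bsub>T\<^esub> b \<otimes>\<^bsub>T\<^esub> q"
      using I_sub i by blast
    have "s \<otimes>\<^bsub>T\<^esub> w = (r \<otimes>\<^bsub>T\<^esub> a) \<otimes>\<^bsub>T\<^esub> p \<oplus>\<^bsub>T\<^esub> (r \<otimes>\<^bsub>T\<^esub> b) \<otimes>\<^bsub>T\<^esub> q"
      using p(1,2) cl unfolding i(2) p(3) by (simp add: T.r_distr T.m_assoc)
    also have "\<dots> = s \<otimes>\<^bsub>T\<^esub> (u \<otimes>\<^bsub>T\<^esub> p \<oplus>\<^bsub>T\<^esub> v \<otimes>\<^bsub>T\<^esub> q)"
      using p(1,2) cl unfolding u(2) v(2) by (simp add: T.r_distr T.m_assoc)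
    finally have sw: "s \<otimes>\<^bsub>T\<^esub> w = s \<otimes>\<^bsub>T\<^esub> (u \<otimes>\<^bsub>T\<^esub> p \<oplus>\<^bsub>T\<^esub> v \<otimes>\<^bsub>T\<^esub> q)" .
    have e: "u \<otimes>\<^bsub>T\<^esub> p \<oplus>\<^bsub>T\<^esub> v \<otimes>\<^bsub>T\<^esub> q \<in> carrier T" using p cl by simp
    have "s \<otimes>\<^bsub>T\<^esub> (w \<ominus>\<^bsub>T\<^esub> (u \<otimes>\<^bsub>T\<^esub> p \<oplus>\<^bsub>T\<^esub> v \<otimes>\<^bsub>T\<^esub> q)) = s \<otimes>\<^bsub>T\<^esub> w \<ominus>\<^bsub>T\<^esub> s \<otimes>\<^bsub>T\<^esub> (u \<otimes>\<^bsub>T\<^esub> p \<oplus>\<^bsub>T\<^esub> v \<otimes>\<^bsub>T\<^esub> q)"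
      using e cl(2) UT'[OF w] by (simp add: T.minus_eq T.r_distr T.r_minus)
    also have "\<dots> = \<zero>\<^bsub>T\<^esub>" unfolding sw using e cl(2) by (simp add: T.minus_eq T.r_neg)
    finally have "w \<ominus>\<^bsub>T\<^esub> (u \<otimes>\<^bsub>T\<^esub> p \<oplus>\<^bsub>T\<^esub> v \<otimes>\<^bsub>T\<^esub> q) = \<zero>\<^bsub>T\<^esub>"
      using s_reg e UT'[OF w] by blast
    then have "w = u \<otimes>\<^bsub>T\<^esub> p \<oplus>\<^bsub>T\<^esub> v \<otimes>\<^bsub>T\<^esub> q" by (rule T.minus_zero_imp_eq[OF _ UT'[OF w] e])
    then show "w \<in> ?L u v" using p(1,2) UT'[OF w] by blast
  qed
  then have "Idl\<^bsub>T\<^esub> U \<subseteq> ?L u v" by (rule T.genideal_minimal[OF L[OF cl(3,4)]])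
  then have "\<one>\<^bsub>T\<^esub> \<in> ?L u v" unfolding UT using T.one_closed by (rule subsetD)
  then obtain p q where p: "p \<in> carrier T" "q \<in> carrier T" "\<one>\<^bsub>T\<^esub> = u \<otimes>\<^bsub>T\<^esub> p \<oplus>\<^bsub>T\<^esub> v \<otimes>\<^bsub>T\<^esub> q"
    by blast
  show thesis
    by (rule that[OF r s UR[OF u(1)] UR[OF v(1)] p(1,2) r' u(2) v(2) p(3)[symmetric] s_reg])
qed

text \<open>The point is that \<open>T\<close> is a domain. A non-zero a in \<open>R\<close> is
  regular on \<open>T\<close> because (a) is isomorphic to an ideal that generates the unit ideal of
  \<open>T\<close>; a non-zero element of \<open>T\<close> is first moved into \<open>R\<close> by
  the regular element of C.\<close>

lemma regular_conductor_square_imp_bezout_pullback: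
  fixes R T :: "'a ring"
  assumes sq: "regular_conductor_square R T C A B" and C: "principalideal C T"
    and ext: "\<And>I. two_generated_ideal I R \<Longrightarrow> I \<noteq> {\<zero>\<^bsub>R\<^esub>} \<Longrightarrow> extension_condition R T I"
  obtains c where "bezout_pullback T A (carrier R) c ((+>\<^bsub>R\<^esub>) C)" "R = T\<lparr>carrier := carrier R\<rparr>"
proof -
  have T: "cring T" and sub: "subring (carrier R) T" and R: "R = T\<lparr>carrier := carrier R\<rparr>"
    and J: "\<exists>J. common_ideal J R T \<and> J \<noteq> {\<zero>\<^bsub>T\<^esub>}" and CR: "ideal C R" and CT: "ideal C T"
    and A: "A = R Quot C"
    using sq unfolding regular_conductor_square_def conductor_square_def common_ideal_def by auto
  interpret T: cring T by fact
  have "subcring (carrier R) T" using T.subcringI' sub by blast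
  then have "cring (T\<lparr>carrier := carrier R\<rparr>)" using T.subcring_iff sub subringE(1) by blast
  then interpret R: cring R using R by simp
  have R_simps: "mult R = mult T" "add R = add T" "\<zero>\<^bsub>R\<^esub> = \<zero>\<^bsub>T\<^esub>" "\<one>\<^bsub>R\<^esub> = \<one>\<^bsub>T\<^esub>"
    by (subst R, simp)+
  have RT: "x \<in> carrier T" if "x \<in> carrier R" for x using that subringE(1)[OF sub] by blast
  obtain d where dC: "d \<in> C" and d: "non_zero_divisor d T"
    using sq unfolding regular_conductor_square_def by blast
  have dT: "d \<in> carrier T" using d by (simp add: non_zero_divisor_def)
  have d_reg: "x = \<zero>\<^bsub>T\<^esub>" if "x \<in> carrier T" "d \<otimes>\<^bsub>T\<^esub> x = \<zero>\<^bsub>T\<^esub>" for x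
    using d(1) that by (simp add: non_zero_divisor_def)
  have dR: "d \<otimes>\<^bsub>T\<^esub> x \<in> carrier R" if "x \<in> carrier T" for x
    using ideal.I_r_closed[OF CT dC that] ideal.Icarr[OF CR] by blast
  have one: "\<one>\<^bsub>T\<^esub> \<noteq> \<zero>\<^bsub>T\<^esub>"
  proof
    assume "\<one>\<^bsub>T\<^esub> = \<zero>\<^bsub>T\<^esub>"
    then have "carrier T = {\<zero>\<^bsub>T\<^esub>}" using T.carrier_one_zero by simp
    moreover obtain J where "ideal J T" "J \<noteq> {\<zero>\<^bsub>T\<^esub>}" using J unfolding common_ideal_def by blast
    moreover have "\<zero>\<^bsub>T\<^esub> \<in> J" using additive_subgroup.zero_closed[OF ideal.axioms(1)] \<open>ideal J T\<close> by blast
    ultimately show False using ideal.Icarr[OF \<open>ideal J T\<close>] by blast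
  qed
  have ext': "extension_condition R T (Idl\<^bsub>R\<^esub> {a, b})"
    if ab: "a \<in> carrier R" "b \<in> carrier R" and nz: "a \<noteq> \<zero>\<^bsub>T\<^esub> \<or> b \<noteq> \<zero>\<^bsub>T\<^esub>" for a b
  proof (rule ext)
    show "two_generated_ideal (Idl\<^bsub>R\<^esub> {a, b}) R" using ab unfolding two_generated_ideal_def by blast
    have "a \<in> Idl\<^bsub>R\<^esub> {a, b}" "b \<in> Idl\<^bsub>R\<^esub> {a, b}" using R.genideal_self[of "{a, b}"] ab by auto
    then show "Idl\<^bsub>R\<^esub> {a, b} \<noteq> {\<zero>\<^bsub>R\<^esub>}" using nz R_simps by auto
  qed
  have reg: "x = \<zero>\<^bsub>T\<^esub>" if a: "a \<in> carrier R" "a \<noteq> \<zero>\<^bsub>T\<^esub>" and x: "x \<in> carrier T" "a \<otimes>\<^bsub>T\<^esub> x = \<zero>\<^bsub>T\<^esub>" for a x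
  proof -
    \<comment> \<open>The pair a, a represents the principal ideal. With ra = su = sv, the equation
      ax = 0 gives ux = vx = 0 since s is regular, and up + vq = 1 gives x = 0.\<close>
    obtain r s u v p q r' where *: "r \<in> carrier R" "s \<in> carrier R" "u \<in> carrier R" "v \<in> carrier R"
      "p \<in> carrier T" "q \<in> carrier T" "r' \<in> carrier T" "r \<otimes>\<^bsub>T\<^esub> r' = \<one>\<^bsub>T\<^esub>"
      "r \<otimes>\<^bsub>T\<^esub> a = s \<otimes>\<^bsub>T\<^esub> u" "r \<otimes>\<^bsub>T\<^esub> a = s \<otimes>\<^bsub>T\<^esub> v"
      "u \<otimes>\<^bsub>T\<^esub> p \<oplus>\<^bsub>T\<^esub> v \<otimes>\<^bsub>T\<^esub> q = \<one>\<^bsub>T\<^esub>"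
      and s_reg: "\<And>x. x \<in> carrier T \<Longrightarrow> s \<otimes>\<^bsub>T\<^esub> x = \<zero>\<^bsub>T\<^esub> \<Longrightarrow> x = \<zero>\<^bsub>T\<^esub>"
      by (rule extension_conditionE[OF T sub R d dR a(1) a(1) ext'[OF a(1) a(1)]]) (use a(2) in blast)+
    note cl = RT[OF *(1)] RT[OF *(2)] RT[OF *(3)] RT[OF *(4)] RT[OF a(1)] *(5,6)
    have z: "w \<otimes>\<^bsub>T\<^esub> x = \<zero>\<^bsub>T\<^esub>" if w: "w \<in> carrier T" "r \<otimes>\<^bsub>T\<^esub> a = s \<otimes>\<^bsub>T\<^esub> w" for w
    proof -
      have "s \<otimes>\<^bsub>T\<^esub> (w \<otimes>\<^bsub>T\<^esub> x) = r \<otimes>\<^bsub>T\<^esub> (a \<otimes>\<^bsub>T\<^esub> x)"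
        using w cl x(1) by (simp add: T.m_assoc[symmetric])
      then show ?thesis using s_reg[of "w \<otimes>\<^bsub>T\<^esub> x"] w(1) x cl(1) by simp
    qed
    have "x = (u \<otimes>\<^bsub>T\<^esub> p \<oplus>\<^bsub>T\<^esub> v \<otimes>\<^bsub>T\<^esub> q) \<otimes>\<^bsub>T\<^esub> x" using *(11) x by simp
    also have "\<dots> = p \<otimes>\<^bsub>T\<^esub> (u \<otimes>\<^bsub>T\<^esub> x) \<oplus>\<^bsub>T\<^esub> q \<otimes>\<^bsub>T\<^esub> (v \<otimes>\<^bsub>T\<^esub> x)"
      using cl x(1) by (simp add: T.l_distr T.r_distr T.m_ac)
    also have "\<dots> = \<zero>\<^bsub>T\<^esub>" using z[OF cl(3) *(9)] z[OF cl(4) *(10)] cl by simp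
    finally show ?thesis .
  qed
  have "domain T"
  proof (rule domain.intro[OF T], unfold_locales)
    show "\<one>\<^bsub>T\<^esub> \<noteq> \<zero>\<^bsub>T\<^esub>" by (rule one)
    fix a b assume ab: "a \<otimes>\<^bsub>T\<^esub> b = \<zero>\<^bsub>T\<^esub>" "a \<in> carrier T" "b \<in> carrier T"
    show "a = \<zero>\<^bsub>T\<^esub> \<or> b = \<zero>\<^bsub>T\<^esub>"
    proof (cases "a = \<zero>\<^bsub>T\<^esub>")
      case False
      then have "d \<otimes>\<^bsub>T\<^esub> a \<noteq> \<zero>\<^bsub>T\<^esub>" using d_reg ab by blast
      moreover have "(d \<otimes>\<^bsub>T\<^esub> a) \<otimes>\<^bsub>T\<^esub> b = \<zero>\<^bsub>T\<^esub>" using ab dT by (simp add: T.m_assoc)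
      ultimately show ?thesis using reg[OF dR] ab by blast
    qed simp
  qed
  then interpret T: "domain" T .
  obtain c where c: "c \<in> carrier T" "C = Idl\<^bsub>T\<^esub> {c}" using principalideal.generate[OF C] by blast
  have C_eq: "C = PIdl\<^bsub>T\<^esub> c" using c T.cgenideal_eq_genideal by simp
  have c0: "c \<noteq> \<zero>\<^bsub>T\<^esub>"
  proof
    assume "c = \<zero>\<^bsub>T\<^esub>"
    then have "d = \<zero>\<^bsub>T\<^esub>" using dC c T.genideal_zero by simp
    then show False using d_reg[of "\<one>\<^bsub>T\<^esub>"] one by simp
  qed
  have cA: "cring A" unfolding A using ideal.quotient_is_cring[OF CR R.is_cring] .
  have "bezout_pullback T A (carrier R) c ((+>\<^bsub>R\<^esub>) C)"
  proof (intro bezout_pullback.intro bezout_pullback_axioms.intro)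
    show "domain T" by fact
    show "cring A" by fact
    show "subring (carrier R) T" by fact
    show "c \<in> carrier T" "c \<noteq> \<zero>\<^bsub>T\<^esub>" by fact+
    show "PIdl\<^bsub>T\<^esub> c \<subseteq> carrier R" using ideal.Icarr[OF CR] C_eq by blast
    show "(+>\<^bsub>R\<^esub>) C \<in> ring_hom (T\<lparr>carrier := carrier R\<rparr>) A"
      using ideal.rcos_ring_hom[OF CR] unfolding A R[symmetric] .
    show "(+>\<^bsub>R\<^esub>) C ` carrier R = carrier A"
      unfolding A FactRing_def A_RCOSETS_def' by auto
    show "(C +>\<^bsub>R\<^esub> x = C +>\<^bsub>R\<^esub> y) = (x \<ominus>\<^bsub>T\<^esub> y \<in> PIdl\<^bsub>T\<^esub> c)"
      if xy: "x \<in> carrier R" "y \<in> carrier R" for x y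
    proof -
      have "(x \<ominus>\<^bsub>R\<^esub> y) \<oplus>\<^bsub>R\<^esub> y = x" using xy by (simp add: R.minus_eq R.a_assoc R.l_neg)
      then have "(x \<ominus>\<^bsub>R\<^esub> y) \<oplus>\<^bsub>T\<^esub> y = x" by (simp add: R_simps)
      moreover have "x \<ominus>\<^bsub>R\<^esub> y \<in> carrier T" using xy RT by simp
      ultimately have "x \<ominus>\<^bsub>R\<^esub> y = x \<ominus>\<^bsub>T\<^esub> y"
        using xy RT by (metis T.add.inv_solve_right T.minus_eq)
      then show ?thesis using R.quotient_eq_iff_same_a_r_cos[OF CR xy] C_eq by simp
    qed
    fix a b assume ab: "a \<in> carrier R" "b \<in> carrier R"
    show "\<exists>r\<in>carrier R. \<exists>s\<in>carrier R. \<exists>u\<in>carrier R. \<exists>v\<in>carrier R. \<exists>p\<in>carrier T. \<exists>q\<in>carrier T. \<exists>r'\<in>carrier T.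
      r \<otimes>\<^bsub>T\<^esub> r' = \<one>\<^bsub>T\<^esub> \<and> r \<otimes>\<^bsub>T\<^esub> a = s \<otimes>\<^bsub>T\<^esub> u \<and> r \<otimes>\<^bsub>T\<^esub> b = s \<otimes>\<^bsub>T\<^esub> v \<and>
      u \<otimes>\<^bsub>T\<^esub> p \<oplus>\<^bsub>T\<^esub> v \<otimes>\<^bsub>T\<^esub> q = \<one>\<^bsub>T\<^esub>"
    proof (cases "a = \<zero>\<^bsub>T\<^esub> \<and> b = \<zero>\<^bsub>T\<^esub>")
      case True
      \<comment> \<open>The extension condition says nothing about the zero ideal. Here r = u = p =
        r' = 1 and s = v = q = 0 serve: s = 0 makes both products vanish, and (u, v) = (1, 0) is
        comaximal.\<close>
      have cl: "\<one>\<^bsub>T\<^esub> \<in> carrier R" "\<zero>\<^bsub>T\<^esub> \<in> carrier R" using R.one_closed R.zero_closed by (simp_all add: R_simps)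
      show ?thesis
        by (rule bexI[OF _ cl(1)], rule bexI[OF _ cl(2)], rule bexI[OF _ cl(1)], rule bexI[OF _ cl(2)],
            rule bexI[OF _ T.one_closed], rule bexI[OF _ T.zero_closed], rule bexI[OF _ T.one_closed])
          (use True in simp)
    next
      case False
      then have nz: "a \<noteq> \<zero>\<^bsub>T\<^esub> \<or> b \<noteq> \<zero>\<^bsub>T\<^esub>" by blast
      obtain r s u v p q r' where *: "r \<in> carrier R" "s \<in> carrier R" "u \<in> carrier R" "v \<in> carrier R"
        "p \<in> carrier T" "q \<in> carrier T" "r' \<in> carrier T" "r \<otimes>\<^bsub>T\<^esub> r' = \<one>\<^bsub>T\<^esub>"
        "r \<otimes>\<^bsub>T\<^esub> a = s \<otimes>\<^bsub>T\<^esub> u" "r \<otimes>\<^bsub>T\<^esub> b = s \<otimes>\<^bsub>T\<^esub> v"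
        "u \<otimes>\<^bsub>T\<^esub> p \<oplus>\<^bsub>T\<^esub> v \<otimes>\<^bsub>T\<^esub> q = \<one>\<^bsub>T\<^esub>"
        by (rule extension_conditionE[OF T sub R d dR ab ext'[OF ab nz]])
      then show ?thesis by blast
    qed
  qed
  then show thesis using R by (rule that)
qed

theorem theorem5p10:
  fixes R T :: "'a ring" and C :: "'a set" and A B :: "'a set ring"
  assumes "regular_conductor_square R T C A B"
    and "flat_module R (as_module T (carrier T))"
    and "principalideal C T"
    and "\<And>I. two_generated_ideal I R \<Longrightarrow> I \<noteq> {\<zero>\<^bsub>R\<^esub>} \<Longrightarrow> extension_condition R T I"
    and "locally_domain A"
    and "krull_dim A < \<infinity>"
  shows "(generalized_GCD_ring R \<longleftrightarrow> generalized_GCD_ring A) \<and>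
         (generalized_GCD_ring R \<longrightarrow> generalized_GCD_ring T)"
proof -
  obtain c where pullback: "bezout_pullback T A (carrier R) c ((+>\<^bsub>R\<^esub>) C)"
    and R: "R = T\<lparr>carrier := carrier R\<rparr>"
    using regular_conductor_square_imp_bezout_pullback[OF assms(1,3,4)] by metis
  show ?thesis
    using bezout_pullback.generalized_GCD_ring_imp_A[OF pullback assms(5)]
      bezout_pullback.generalized_GCD_ring_imp_R[OF pullback assms(5)]
      bezout_pullback.generalized_GCD_ring_T[OF pullback]
    unfolding R[symmetric] by blast
qed

end
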